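(* Let $k$ be a positive integer. If a signed graph $(G,\sigma)$ is $(12k-1)$-edge connected and essentially $(2k+1)$-unbalanced, then $(G,\sigma)$ admits a $(2k+1,k)$-flow.
   Context: A signed graph is a pair $(G,\sigma)$ where $G$ is a graph and $\sigma:E(G)\to\{1,-1\}$; edges with $\sigma(e)=1$ are positive, those with $\sigma(e)=-1$ negative. An orientation $\tau$ of $(G,\sigma)$ orients each positive edge $e=xy$ from one end to the other (if from $x$ to $y$, then $e\in E^+_\tau(x)\cap E^-_\tau(y)$), and labels each negative edge $e=xy$ either as a sink edge, with $e\in E^+_\tau(x)\cap E^+_\tau(y)$, or as a source edge, with $e\in E^-_\tau(x)\cap E^-_\tau(y)$. An integer flow is an orientation $\tau$ together with $f:E(G)\to\mathbb{Z}$ such that $\sum_{e\in E^+_\tau(v)}f(e)-\sum_{e\in E^-_\tau(v)}f(e)=0$ for every vertex $v$. For positive integers $p\ge 2q$, a $(p,q)$-flow is an integer flow with $f(e)\in\{q,q+1,\dots,p-q\}$ for every edge $e$. In particular, a $(2k+1,k)$-flow has $f(e)\in\{k,k+1\}$ for every edge $e$. Switching at a vertex $v$ negates the sign of every edge incident to $v$. Two signed graphs on the same underlying graph are equivalent if one is obtained from the other by a sequence of switchings. $(G,\sigma)$ is essentially $(2k+1)$-unbalanced if every signed graph equivalent to it has either an even number of negative edges or at least $2k+1$ negative edges. Edge connectivity refers to $G$. *)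

theory Defs
  imports Main
begin

text \<open>A (finite multi)graph: vertex set V, edge set E, and an endpoint map
  ends e = (x, y) giving the two ends of edge e (x = y for a loop).
  Each edge has two half-edges / ends, indexed by True (the end fst (ends e))
  and False (the end snd (ends e)).\<close>

definition graph :: "'v set \<Rightarrow> 'e set \<Rightarrow> ('e \<Rightarrow> 'v \<times> 'v) \<Rightarrow> bool" where
  "graph V E ends \<longleftrightarrow> finite V \<and> finite E \<and>
     (\<forall>e\<in>E. fst (ends e) \<in> V \<and> snd (ends e) \<in> V)"

definition end_of :: "('e \<Rightarrow> 'v \<times> 'v) \<Rightarrow> 'e \<Rightarrow> bool \<Rightarrow> 'v" where
  "end_of ends e b = (if b then fst (ends e) else snd (ends e))"

definition signature :: "'e set \<Rightarrow> ('e \<Rightarrow> int) \<Rightarrow> bool" where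
  "signature E \<sigma> \<longleftrightarrow> (\<forall>e\<in>E. \<sigma> e = 1 \<or> \<sigma> e = -1)"

text \<open>An orientation assigns to every end of every edge a sign +1 (the edge is in
  E^+(v) at that end) or -1 (the edge is in E^-(v) at that end).  A positive edge
  gets opposite signs at its two ends (oriented from the +1 end to the -1 end);
  a negative edge gets equal signs (both +1: sink edge, both -1: source edge).\<close>

definition orientation :: "'e set \<Rightarrow> ('e \<Rightarrow> int) \<Rightarrow> ('e \<Rightarrow> bool \<Rightarrow> int) \<Rightarrow> bool" where
  "orientation E \<sigma> \<tau> \<longleftrightarrow>
     (\<forall>e\<in>E. (\<tau> e True = 1 \<or> \<tau> e True = -1) \<and> (\<tau> e False = 1 \<or> \<tau> e False = -1) \<and>
             \<tau> e True * \<tau> e False = - \<sigma> e)"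

text \<open>Net flow at v: sum over E^+(v) minus sum over E^-(v) (ends counted separately,
  so a loop contributes at both of its ends).\<close>

definition net_flow :: "'e set \<Rightarrow> ('e \<Rightarrow> 'v \<times> 'v) \<Rightarrow> ('e \<Rightarrow> bool \<Rightarrow> int) \<Rightarrow> ('e \<Rightarrow> int) \<Rightarrow> 'v \<Rightarrow> int" where
  "net_flow E ends \<tau> f v =
     (\<Sum>e\<in>E. (if end_of ends e True = v then \<tau> e True * f e else 0)
            + (if end_of ends e False = v then \<tau> e False * f e else 0))"

definition integer_flow ::
  "'v set \<Rightarrow> 'e set \<Rightarrow> ('e \<Rightarrow> 'v \<times> 'v) \<Rightarrow> ('e \<Rightarrow> int) \<Rightarrow> ('e \<Rightarrow> bool \<Rightarrow> int) \<Rightarrow> ('e \<Rightarrow> int) \<Rightarrow> bool" where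
  "integer_flow V E ends \<sigma> \<tau> f \<longleftrightarrow> orientation E \<sigma> \<tau> \<and> (\<forall>v\<in>V. net_flow E ends \<tau> f v = 0)"

definition pq_flow ::
  "int \<Rightarrow> int \<Rightarrow> 'v set \<Rightarrow> 'e set \<Rightarrow> ('e \<Rightarrow> 'v \<times> 'v) \<Rightarrow> ('e \<Rightarrow> int) \<Rightarrow> ('e \<Rightarrow> bool \<Rightarrow> int) \<Rightarrow> ('e \<Rightarrow> int) \<Rightarrow> bool" where
  "pq_flow p q V E ends \<sigma> \<tau> f \<longleftrightarrow> integer_flow V E ends \<sigma> \<tau> f \<and> (\<forall>e\<in>E. q \<le> f e \<and> f e \<le> p - q)"

definition admits_pq_flow ::
  "int \<Rightarrow> int \<Rightarrow> 'v set \<Rightarrow> 'e set \<Rightarrow> ('e \<Rightarrow> 'v \<times> 'v) \<Rightarrow> ('e \<Rightarrow> int) \<Rightarrow> bool" where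
  "admits_pq_flow p q V E ends \<sigma> \<longleftrightarrow> (\<exists>\<tau> f. pq_flow p q V E ends \<sigma> \<tau> f)"

text \<open>Switching at vertex v negates the sign of every edge incident with v
  (a loop at v is negated twice, hence unchanged).\<close>

definition switch_at :: "('e \<Rightarrow> 'v \<times> 'v) \<Rightarrow> 'v \<Rightarrow> ('e \<Rightarrow> int) \<Rightarrow> ('e \<Rightarrow> int)" where
  "switch_at ends v \<sigma> = (\<lambda>e. (if fst (ends e) = v then -1 else 1) *
                             (if snd (ends e) = v then -1 else 1) * \<sigma> e)"

definition switch_step :: "'v set \<Rightarrow> ('e \<Rightarrow> 'v \<times> 'v) \<Rightarrow> ('e \<Rightarrow> int) \<Rightarrow> ('e \<Rightarrow> int) \<Rightarrow> bool" where
  "switch_step V ends \<sigma> \<sigma>' \<longleftrightarrow> (\<exists>v\<in>V. \<sigma>' = switch_at ends v \<sigma>)"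

definition equivalent_sig :: "'v set \<Rightarrow> ('e \<Rightarrow> 'v \<times> 'v) \<Rightarrow> ('e \<Rightarrow> int) \<Rightarrow> ('e \<Rightarrow> int) \<Rightarrow> bool" where
  "equivalent_sig V ends \<sigma> \<sigma>' \<longleftrightarrow> (switch_step V ends)\<^sup>*\<^sup>* \<sigma> \<sigma>'"

definition negative_edges :: "'e set \<Rightarrow> ('e \<Rightarrow> int) \<Rightarrow> 'e set" where
  "negative_edges E \<sigma> = {e\<in>E. \<sigma> e = -1}"

definition essentially_unbalanced :: "nat \<Rightarrow> 'v set \<Rightarrow> 'e set \<Rightarrow> ('e \<Rightarrow> 'v \<times> 'v) \<Rightarrow> ('e \<Rightarrow> int) \<Rightarrow> bool" where
  "essentially_unbalanced m V E ends \<sigma> \<longleftrightarrow>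
     (\<forall>\<sigma>'. equivalent_sig V ends \<sigma> \<sigma>' \<longrightarrow>
        even (card (negative_edges E \<sigma>')) \<or> card (negative_edges E \<sigma>') \<ge> m)"

definition edge_cut :: "'e set \<Rightarrow> ('e \<Rightarrow> 'v \<times> 'v) \<Rightarrow> 'v set \<Rightarrow> 'e set" where
  "edge_cut E ends X = {e\<in>E. (fst (ends e) \<in> X) \<noteq> (snd (ends e) \<in> X)}"

definition edge_connected :: "nat \<Rightarrow> 'v set \<Rightarrow> 'e set \<Rightarrow> ('e \<Rightarrow> 'v \<times> 'v) \<Rightarrow> bool" where
  "edge_connected m V E ends \<longleftrightarrow>
     (\<forall>X. X \<subseteq> V \<and> X \<noteq> {} \<and> X \<noteq> V \<longrightarrow> card (edge_cut E ends X) \<ge> m)"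

end

theory Submission
  imports Defs
begin

text \<open>
  Switch so that the number of negative edges is minimal. Then every cut has at least as many positive
  as negative edges, so the positive edges form a 6k-edge-connected graph.

  Orient the negative edges as sinks and sources and give them values k and k + 1 with total 0, such
  that the resulting demand b satisfies b(A) \<le> k d(A) + 2k for all vertex sets A, where d counts
  positive edges leaving A. For this, take two disjoint connected spanning subgraphs of the positive
  edges, extend the negative edges by one of them and a parity subgraph of the other, and alternate
  signs along an Euler trail. If the number of negative edges is odd, k sources get the value k + 1;
  this is where at least 2k + 1 negative edges are needed.

  By the theorem of Lovasz, Thomassen, Wu and Zhang, a 6k-edge-connected graph has an orientation with
  any prescribed boundary modulo 2k + 1. This gives a flow with values k and k + 1 on the positive edges
  that meets the demand modulo 2k + 1. Reversing edges along directed paths makes it exact, since the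
  cut bound on b is smaller than k d(A) + (2k + 1).

  The modulo orientation is found by induction on a stronger statement with one special vertex whose
  edges are already oriented. Tight sets are contracted. A vertex with boundary 0 is removed by lifting
  pairs of edges; the cut condition at that vertex is never needed. If there is none, every boundary is
  positive or negative modulo 2(2k + 1). An edge from a positive to a negative vertex can be oriented
  and deleted. If all vertices are positive, edges to the special vertex are added at one of them until
  it counts as negative.
\<close>

section \<open>Incidence sums\<close>

text \<open>The constants fit together through m = 2k + 1. An orientation whose net outflow is 2b
  modulo m meets the demand b after scaling by k, because 2k is -1 modulo m. The cut condition of
  the induction asks for 2m - 2 = 4k plus a distance of at most 2k + 1, and parity turns the
  resulting 6k + 1 into 6k. At least half of every cut is positive after switching, and half of 12k
  - 1, rounded up, is 6k.

  The special vertex is forced by contraction: once the outside of a tight set is oriented, the cut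
  edges are fixed, and the inside must be solved around a vertex whose edges are prescribed. The
  upper bound on the number of virtual edges is exactly what tightness provides.

  One surplus sink of value k contributes 2k to the total boundary, and a source raised from k to k
  + 1 takes away 2, which explains the k raised sources. Reversals along directed paths preserve the
  two admissible values because a shift by 2k + 1 exchanges k with -(k + 1).\<close>

definition dinc :: "('e \<Rightarrow> 'v \<times> 'v) \<Rightarrow> 'e \<Rightarrow> 'v \<Rightarrow> int" where
  "dinc ends e v = of_bool (fst (ends e) = v) - of_bool (snd (ends e) = v)"

definition inc :: "('e \<Rightarrow> 'v \<times> 'v) \<Rightarrow> 'e \<Rightarrow> 'v \<Rightarrow> int" where
  "inc ends e v = of_bool (fst (ends e) = v) + of_bool (snd (ends e) = v)"

definition net :: "'e set \<Rightarrow> ('e \<Rightarrow> 'v \<times> 'v) \<Rightarrow> ('e \<Rightarrow> int) \<Rightarrow> 'v \<Rightarrow> int" where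
  "net E ends g v = (\<Sum>e\<in>E. g e * dinc ends e v)"

definition deg :: "'e set \<Rightarrow> ('e \<Rightarrow> 'v \<times> 'v) \<Rightarrow> 'v \<Rightarrow> int" where
  "deg E ends v = (\<Sum>e\<in>E. inc ends e v)"

definition cutsize :: "'e set \<Rightarrow> ('e \<Rightarrow> 'v \<times> 'v) \<Rightarrow> 'v set \<Rightarrow> int" where
  "cutsize E ends A = int (card (edge_cut E ends A))"

lemma graph_finite: "graph V E ends \<Longrightarrow> finite V" "graph V E ends \<Longrightarrow> finite E"
  by (auto simp: graph_def)

lemma graph_ends: "graph V E ends \<Longrightarrow> e \<in> E \<Longrightarrow> fst (ends e) \<in> V"
  "graph V E ends \<Longrightarrow> e \<in> E \<Longrightarrow> snd (ends e) \<in> V"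
  by (auto simp: graph_def)

lemma sum_of_bool_single:
  "finite A \<Longrightarrow> (\<Sum>v\<in>A. c * of_bool (v = x)) = (c * of_bool (x \<in> A) :: int)"
  "finite A \<Longrightarrow> (\<Sum>v\<in>A. of_bool (v = x)) = (of_bool (x \<in> A) :: int)"
  "finite A \<Longrightarrow> (\<Sum>v\<in>A. of_bool (x = v)) = (of_bool (x \<in> A) :: int)"
  by (auto simp: of_bool_def if_distrib[where f="times c"] cong: if_cong)

lemma sum_dinc:
  "finite A \<Longrightarrow> (\<Sum>v\<in>A. dinc ends e v) = of_bool (fst (ends e) \<in> A) - of_bool (snd (ends e) \<in> A)"
  by (simp add: dinc_def sum_subtractf sum_of_bool_single)

lemma sum_inc:
  "finite A \<Longrightarrow> (\<Sum>v\<in>A. inc ends e v) = of_bool (fst (ends e) \<in> A) + of_bool (snd (ends e) \<in> A)"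
  by (simp add: inc_def sum.distrib sum_of_bool_single)

lemma sum_net:
  assumes "finite A"
  shows "(\<Sum>v\<in>A. net E ends g v) =
    (\<Sum>e\<in>E. g e * (of_bool (fst (ends e) \<in> A) - of_bool (snd (ends e) \<in> A)))"
  unfolding net_def
  by (subst sum.swap) (simp add: sum_distrib_left[symmetric] sum_dinc[OF assms])

lemma sum_deg:
  assumes "finite A"
  shows "(\<Sum>v\<in>A. deg E ends v) =
    (\<Sum>e\<in>E. of_bool (fst (ends e) \<in> A) + of_bool (snd (ends e) \<in> A))"
  unfolding deg_def by (subst sum.swap) (simp add: sum_inc[OF assms])

lemma sum_net_V:
  assumes "graph V E ends" shows "(\<Sum>v\<in>V. net E ends g v) = 0"
  using assms by (simp add: sum_net graph_finite graph_ends)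

definition crossing :: "('e \<Rightarrow> 'v \<times> 'v) \<Rightarrow> 'v set \<Rightarrow> 'e \<Rightarrow> int" where
  "crossing ends A e = of_bool ((fst (ends e) \<in> A) \<noteq> (snd (ends e) \<in> A))"

lemma ends_pair:
  assumes "ends e = (a, b)"
  shows "dinc ends e v = of_bool (v = a) - of_bool (v = b)"
    "inc ends e v = of_bool (v = a) + of_bool (v = b)"
    "crossing ends A e = of_bool ((a \<in> A) \<noteq> (b \<in> A))"
  using assms by (simp_all add: dinc_def inc_def crossing_def eq_commute)

lemma cutsize_eq_sum:
  assumes "finite E"
  shows "cutsize E ends A = (\<Sum>e\<in>E. crossing ends A e)"
  using assms by (simp add: cutsize_def edge_cut_def crossing_def of_bool_def sum.If_cases Int_def)

lemma cutsize_complement: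
  assumes "graph V E ends" "A \<subseteq> V"
  shows "cutsize E ends (V - A) = cutsize E ends A"
proof -
  have "edge_cut E ends (V - A) = edge_cut E ends A"
    using assms by (auto simp: edge_cut_def graph_def)
  then show ?thesis by (simp add: cutsize_def)
qed

text \<open>Degrees count an edge inside \<open>A\<close> twice and a cut edge once.\<close>

lemma even_sum_deg_cutsize:
  assumes "finite E" "finite A"
  shows "even ((\<Sum>v\<in>A. deg E ends v) - cutsize E ends A)"
proof -
  have "(\<Sum>v\<in>A. deg E ends v) - cutsize E ends A = (\<Sum>e\<in>E. 2 * of_bool (fst (ends e) \<in> A \<and> snd (ends e) \<in> A))"
    by (simp only: sum_deg[OF assms(2)] cutsize_eq_sum[OF assms(1)] sum_subtractf[symmetric])
       (rule sum.cong; auto simp: crossing_def)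
  then show ?thesis by (simp add: sum_distrib_left[symmetric])
qed

section \<open>Distance to the nearest multiple of 2m\<close>

definition cdist :: "int \<Rightarrow> int \<Rightarrow> int" where
  "cdist m t = min (t mod (2 * m)) (2 * m - t mod (2 * m))"

context
  fixes m :: int
  assumes m2: "2 \<le> m"
begin

text \<open>Together with \<open>cdist_le\<close> this makes \<open>cdist m\<close> the distance to
  the set of multiples of 2m. The triangle inequality and the symmetry follow from that without
  computing residues.\<close>

lemma cdist_attained: "\<exists>j. cdist m t = \<bar>t - 2 * m * j\<bar>"
proof -
  have eq: "t - 2 * m * (t div (2*m)) = t mod (2*m)"
    by (simp add: minus_mult_div_eq_mod)
  have b: "0 \<le> t mod (2*m)" "t mod (2*m) < 2*m" using m2 by auto
  show ?thesis
  proof (cases "t mod (2*m) \<le> 2*m - t mod (2*m)")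
    case True
    then show ?thesis using eq b by (intro exI[of _ "t div (2*m)"]) (simp add: cdist_def)
  next
    case False
    have "t - 2 * m * (t div (2*m) + 1) = t mod (2*m) - 2*m"
      using eq by (simp add: algebra_simps)
    then show ?thesis using False b by (intro exI[of _ "t div (2*m) + 1"]) (simp add: cdist_def)
  qed
qed

lemma cdist_le: "cdist m t \<le> \<bar>t - 2 * m * j\<bar>"
proof -
  define r where "r = t mod (2*m)"
  define i where "i = t div (2*m) - j"
  have b: "0 \<le> r" "r < 2*m" using m2 by (auto simp: r_def)
  have t: "t - 2 * m * j = 2 * m * i + r"
    unfolding i_def r_def by (simp add: algebra_simps minus_mult_div_eq_mod[symmetric])
  have "min r (2*m - r) \<le> \<bar>2 * m * i + r\<bar>"
  proof (cases "i \<ge> 0")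
    case True
    then have "0 \<le> 2 * m * i" using m2 by simp
    then show ?thesis using b by linarith
  next
    case False
    then have "2 * m * i \<le> 2 * m * (-1)" using m2 by (intro mult_left_mono) auto
    then show ?thesis using b by linarith
  qed
  then show ?thesis by (simp add: cdist_def t r_def)
qed

lemma cdist_le_abs: "cdist m t \<le> \<bar>t\<bar>"
  using cdist_le[of t 0] by simp

lemma cdist_triangle: "cdist m (s + t) \<le> cdist m s + cdist m t"
proof -
  obtain i j where "cdist m s = \<bar>s - 2 * m * i\<bar>" "cdist m t = \<bar>t - 2 * m * j\<bar>"
    using cdist_attained by metis
  then show ?thesis using cdist_le[of "s+t" "i+j"] by (simp add: algebra_simps)
qed

lemma cdist_minus [simp]: "cdist m (- t) = cdist m t"
proof -
  have "cdist m (- t) \<le> cdist m t" for t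
  proof -
    obtain j where "cdist m t = \<bar>t - 2 * m * j\<bar>" using cdist_attained by metis
    then show ?thesis using cdist_le[of "-t" "-j"] by simp
  qed
  from this[of t] this[of "-t"] show ?thesis by simp
qed

lemma cdist_cong:
  assumes "2 * m dvd s - t" shows "cdist m s = cdist m t"
proof -
  have "s mod (2*m) = t mod (2*m)" using assms by (simp add: mod_eq_dvd_iff)
  then show ?thesis by (simp add: cdist_def)
qed

lemma cdist_add_le: "cdist m (s + t) \<le> cdist m s + \<bar>t\<bar>"
  using cdist_triangle[of s t] cdist_le_abs[of t] by linarith

lemma even_cdist_diff: "even (cdist m t - t)"
proof -
  obtain j where "cdist m t = \<bar>t - 2 * m * j\<bar>" using cdist_attained by metis
  then show ?thesis by (auto simp: abs_if)
qed

text \<open>Positive means that a nearest multiple of 2m lies below, so a step down reduces the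
  distance. The residue m is positive for \<open>t\<close> and for \<open>- t\<close>, which
  \<open>all_pos_step\<close> exploits.\<close>

definition pos_residue :: "int \<Rightarrow> bool" where "pos_residue t \<longleftrightarrow> 1 \<le> t mod (2*m) \<and> t mod (2*m) \<le> m"

lemma cdist_less_m: "0 \<le> t \<Longrightarrow> t \<le> m \<Longrightarrow> cdist m t = t"
  using m2 by (simp add: cdist_def)

lemma cdist_ge_m: "m \<le> t \<Longrightarrow> t < 2*m \<Longrightarrow> cdist m t = 2*m - t"
  using m2 by (simp add: cdist_def)

lemma pos_cdist_minus1:
  assumes "pos_residue t" shows "cdist m (t - 1) = cdist m t - 1"
proof -
  have 1: "cdist m t = cdist m (t mod (2*m))" "cdist m (t - 1) = cdist m (t mod (2*m) - 1)"
    by (rule cdist_cong; simp add: minus_mod_eq_mult_div mod_simps algebra_simps)+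
  show ?thesis using assms by (simp add: 1 cdist_less_m pos_residue_def)
qed

lemma pos_or_neg:
  assumes "\<not> 2 * m dvd t" shows "pos_residue t \<or> pos_residue (- t)"
proof (rule ccontr)
  assume n: "\<not> ?thesis"
  have b: "0 \<le> t mod (2*m)" "t mod (2*m) < 2*m" "t mod (2*m) \<noteq> 0"
    using m2 assms by (auto simp: dvd_eq_mod_eq_0)
  have "(-t) mod (2*m) = 2*m - t mod (2*m)" using b(3) by (simp add: zmod_zminus1_eq_if)
  then show False using n b by (auto simp: pos_residue_def)
qed

end

section \<open>Orientations with prescribed boundary modulo 2m\<close>

text \<open>
  The prescribed boundary is h, and p v and q v count virtual edges from a special vertex to v and
  from v to it. These are already oriented, so the boundary of v in the graph with the special
  vertex is h - p + q, and cuts count them too. The special vertex itself is not represented.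
  The set X is empty or a singleton that is exempt from the cut condition. Boundaries are taken
  modulo 2m with the parity of the degrees, which for odd m amounts to prescribing them modulo m.
\<close>

definition boundary :: "('v \<Rightarrow> int) \<Rightarrow> ('v \<Rightarrow> int) \<Rightarrow> ('v \<Rightarrow> int) \<Rightarrow> 'v \<Rightarrow> int" where
  "boundary h p q v = h v - p v + q v"

definition full_cut :: "'e set \<Rightarrow> ('e \<Rightarrow> 'v \<times> 'v) \<Rightarrow> ('v \<Rightarrow> int) \<Rightarrow> ('v \<Rightarrow> int) \<Rightarrow> 'v set \<Rightarrow> int" where
  "full_cut E ends p q A = cutsize E ends A + sum p A + sum q A"

definition solvable :: "int \<Rightarrow> 'v set \<Rightarrow> 'e set \<Rightarrow> ('e \<Rightarrow> 'v \<times> 'v) \<Rightarrow> ('v \<Rightarrow> int) \<Rightarrow> bool" where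
  "solvable m V E ends h \<longleftrightarrow>
     (\<exists>s. (\<forall>e\<in>E. s e = 1 \<or> s e = -1) \<and> (\<forall>v\<in>V. 2 * m dvd net E ends s v - h v))"

text \<open>The bound on virtual edges is opposite to the cut condition: it is the size of a tight
  cut, so that the inside of a tight set is again an instance. If nothing is exempt, it also
  guarantees real edges across every cut, see \<open>instance_ok_crossing\<close>.\<close>

definition instance_ok :: "int \<Rightarrow> 'v set \<Rightarrow> 'e set \<Rightarrow> ('e \<Rightarrow> 'v \<times> 'v) \<Rightarrow> ('v \<Rightarrow> int) \<Rightarrow>
    ('v \<Rightarrow> int) \<Rightarrow> ('v \<Rightarrow> int) \<Rightarrow> 'v set \<Rightarrow> bool" where
  "instance_ok m V E ends h p q X \<longleftrightarrow>
     graph V E ends \<and> V \<noteq> {} \<and>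
     (\<forall>v\<in>V. 0 \<le> p v \<and> 0 \<le> q v) \<and>
     2 * m dvd sum h V \<and>
     (\<forall>v\<in>V. even (h v - deg E ends v)) \<and>
     sum p V + sum q V \<le> 2 * m - 2 + cdist m (sum p V - sum q V) \<and>
     (X = {} \<or> (\<exists>x\<in>V. X = {x} \<and> 2 * m dvd boundary h p q x)) \<and>
     (\<forall>A. A \<subseteq> V \<and> A \<noteq> {} \<and> A \<noteq> V \<and> A \<noteq> X \<longrightarrow>
        2 * m - 2 + cdist m (sum (boundary h p q) A) \<le> full_cut E ends p q A)"

lemma instance_okI:
  assumes "graph V E ends" "V \<noteq> {}" "\<forall>v\<in>V. 0 \<le> p v \<and> 0 \<le> q v" "2 * m dvd sum h V"
    "\<And>v. v \<in> V \<Longrightarrow> even (h v - deg E ends v)"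
    "sum p V + sum q V \<le> 2 * m - 2 + cdist m (sum p V - sum q V)"
    "X = {} \<or> (\<exists>x\<in>V. X = {x} \<and> 2 * m dvd boundary h p q x)"
    "\<And>A. A \<subseteq> V \<Longrightarrow> A \<noteq> {} \<Longrightarrow> A \<noteq> V \<Longrightarrow> A \<noteq> X \<Longrightarrow>
        2 * m - 2 + cdist m (sum (boundary h p q) A) \<le> full_cut E ends p q A"
  shows "instance_ok m V E ends h p q X"
  unfolding instance_ok_def using assms by (intro conjI allI impI ballI) simp_all

lemma instance_okD:
  assumes "instance_ok m V E ends h p q X"
  shows "graph V E ends" "V \<noteq> {}" "\<forall>v\<in>V. 0 \<le> p v \<and> 0 \<le> q v" "2 * m dvd sum h V"
    "\<And>v. v \<in> V \<Longrightarrow> even (h v - deg E ends v)"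
    "sum p V + sum q V \<le> 2 * m - 2 + cdist m (sum p V - sum q V)"
    "X = {} \<or> (\<exists>x\<in>V. X = {x} \<and> 2 * m dvd boundary h p q x)"
  using assms by (simp_all add: instance_ok_def)

lemma sum_boundary: "sum (boundary h p q) A = sum h A - sum p A + sum q A"
  by (simp add: boundary_def sum.distrib sum_subtractf)

lemma cutsize_remove:
  assumes "finite E" "e \<in> E"
  shows "cutsize (E - {e}) ends A =
    cutsize E ends A - crossing ends A e"
  using assms by (simp add: cutsize_eq_sum sum_diff1)

lemma deg_remove:
  assumes "finite E" "e \<in> E"
  shows "deg (E - {e}) ends v = deg E ends v - inc ends e v"
  using assms by (simp add: deg_def sum_diff1)

lemma net_remove:
  assumes "finite E" "e \<in> E"
  shows "net E ends s v = net (E - {e}) ends s v + s e * dinc ends e v"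
  using assms by (simp add: net_def sum_diff1)

lemma net_cong: "(\<And>e. e \<in> E \<Longrightarrow> s e = s' e) \<Longrightarrow> net E ends s v = net E ends s' v"
  by (simp add: net_def cong: sum.cong)

lemma cutsize_split:
  assumes "finite E" "finite F" "E \<inter> F = {}"
  shows "cutsize (E \<union> F) ends A = cutsize E ends A + cutsize F ends A"
  using assms by (simp add: cutsize_eq_sum sum.union_disjoint)

text \<open>Modulo 2 the signs of \<open>p\<close> and \<open>q\<close> do not matter, and the rest
  reduces to the degree sum of \<open>A\<close>. With \<open>even_cdist_diff\<close>, the excess
  over the cut condition comes in steps of two.\<close>

lemma boundary_even:
  assumes "instance_ok m V E ends h p q X" "A \<subseteq> V"
  shows "even (full_cut E ends p q A - sum (boundary h p q) A)"
proof -
  have g: "graph V E ends" and par: "\<forall>v\<in>V. even (h v - deg E ends v)"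
    using assms by (auto simp: instance_ok_def)
  have fin: "finite E" "finite A" using g assms(2) by (auto simp: graph_def intro: finite_subset)
  have "even (\<Sum>v\<in>A. h v - deg E ends v)" using par assms(2) by (intro dvd_sum) auto
  moreover have "even (sum (deg E ends) A - cutsize E ends A)" using even_sum_deg_cutsize fin .
  moreover have "full_cut E ends p q A - sum (boundary h p q) A = 2 * sum p A
      - (\<Sum>v\<in>A. h v - deg E ends v) - (sum (deg E ends) A - cutsize E ends A)"
    by (simp add: full_cut_def sum_boundary sum_subtractf)
  ultimately show ?thesis by simp
qed

section \<open>Reversal and deletion of edges\<close>

text \<open>Reversing every edge negates boundaries and exchanges the two kinds of virtual edges.
  This halves the later case distinctions by sign.\<close>

lemma instance_ok_mirror:
  assumes m: "2 \<le> m" and I: "instance_ok m V E ends h p q X"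
  shows "instance_ok m V E ends (\<lambda>v. - h v) q p X"
proof -
  have b: "boundary (\<lambda>v. - h v) q p = (\<lambda>v. - boundary h p q v)" by (auto simp: boundary_def)
  have c: "cdist m (sum q V - sum p V) = cdist m (sum p V - sum q V)"
    using cdist_minus[OF m, of "sum p V - sum q V"] by simp
  have d: "full_cut E ends q p A = full_cut E ends p q A" for A by (simp add: full_cut_def)
  have e: "even (- h v - deg E ends v) = even (h v - deg E ends v)" for v
    by presburger
  show ?thesis using I unfolding instance_ok_def b c d e
    by (simp only: sum_negf cdist_minus[OF m] dvd_minus_iff add.commute[of "sum q V"]) blast
qed

lemma solvable_mirror:
  assumes "solvable m V E ends (\<lambda>v. - h v)" shows "solvable m V E ends h"
proof -
  obtain s where s: "\<forall>e\<in>E. s e = 1 \<or> s e = -1" "\<forall>v\<in>V. 2 * m dvd net E ends s v - - h v"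
    using assms by (auto simp: solvable_def)
  have n: "net E ends (\<lambda>e. - s e) v - h v = - (net E ends s v - - h v)" for v
    by (simp add: net_def sum_negf)
  show ?thesis unfolding solvable_def
    by (rule exI[of _ "\<lambda>e. - s e"]) (use s in \<open>auto simp only: n dvd_minus_iff\<close>)
qed

text \<open>What remains to be met once an edge oriented from \<open>x\<close> to \<open>y\<close>
  is deleted.\<close>

definition boundary_del :: "'v \<Rightarrow> 'v \<Rightarrow> ('v \<Rightarrow> int) \<Rightarrow> 'v \<Rightarrow> int" where
  "boundary_del x y h v = h v - of_bool (v = x) + of_bool (v = y)"

lemma sum_boundary_del:
  "finite A \<Longrightarrow> sum (boundary_del x y h) A = sum h A - of_bool (x \<in> A) + of_bool (y \<in> A)"
  by (simp add: boundary_del_def sum.distrib sum_subtractf sum_of_bool_single)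

lemma solvable_delete:
  assumes "finite E" "e \<in> E" "ends e = (x, y) \<or> ends e = (y, x)" "x \<noteq> y"
    and "solvable m V (E - {e}) ends (boundary_del x y h)"
  shows "solvable m V E ends h"
proof -
  obtain s where s: "\<forall>e\<in>E-{e}. s e = 1 \<or> s e = -1"
    "\<forall>v\<in>V. 2 * m dvd net (E - {e}) ends s v - boundary_del x y h v"
    using assms by (auto simp: solvable_def)
  define s' where "s' = s(e := if fst (ends e) = x then 1 else -1)"
  have "net E ends s' v - h v = net (E - {e}) ends s v - boundary_del x y h v" for v
  proof -
    have "net (E - {e}) ends s' v = net (E - {e}) ends s v" by (rule net_cong) (simp add: s'_def)
    moreover have "s' e * dinc ends e v = of_bool (v = x) - of_bool (v = y)"
      using assms(3,4) by (elim disjE) (simp_all add: ends_pair s'_def)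
    ultimately show ?thesis
      by (simp add: net_remove[OF assms(1,2)] boundary_del_def)
  qed
  then show ?thesis unfolding solvable_def using s
    by (intro exI[of _ s']) (auto simp: s'_def)
qed

text \<open>Common to lifting through a virtual edge and to orienting a single edge: both delete
  \<open>e\<close> and may change virtual edges. The cut hypothesis is phrased through increments,
  so that each use compares the old cut condition with a small change.\<close>

lemma instance_ok_delete:
  assumes m: "2 \<le> m" and I: "instance_ok m V E ends h p q X"
    and e: "e \<in> E" "ends e = (x, y) \<or> ends e = (y, x)" "x \<noteq> y"
    and nn: "\<forall>v\<in>V. 0 \<le> p' v \<and> 0 \<le> q' v"
    and C2: "sum p' V + sum q' V \<le> 2 * m - 2 + cdist m (sum p' V - sum q' V)"
    and X: "X' = {} \<or> (\<exists>z\<in>V. X' = {z} \<and> 2 * m dvd boundary (boundary_del x y h) p' q' z)"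
    and C3: "\<And>A. A \<subseteq> V \<Longrightarrow> A \<noteq> {} \<Longrightarrow> A \<noteq> V \<Longrightarrow> A \<noteq> X' \<Longrightarrow>
       2 * m - 2 + cdist m (sum (boundary h p q) A - of_bool (x \<in> A) + of_bool (y \<in> A)
           - (sum p' A - sum p A) + (sum q' A - sum q A))
       \<le> full_cut E ends p q A - of_bool ((x \<in> A) \<noteq> (y \<in> A)) + (sum p' A - sum p A) + (sum q' A - sum q A)"
  shows "instance_ok m V (E - {e}) ends (boundary_del x y h) p' q' X'"
proof -
  have g: "graph V E ends" and V: "V \<noteq> {}" and par: "\<forall>v\<in>V. even (h v - deg E ends v)"
    and tot: "2 * m dvd sum h V" using I by (auto simp: instance_ok_def)
  have fin: "finite E" "finite V" using g by (auto simp: graph_def)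
  have xy: "x \<in> V" "y \<in> V" using e g by (auto simp: graph_def)
  have "graph V (E - {e}) ends" using g by (auto simp: graph_def)
  moreover note V nn
  moreover have "2 * m dvd sum (boundary_del x y h) V" using tot xy fin by (simp add: sum_boundary_del)
  moreover have "even (boundary_del x y h v - deg (E - {e}) ends v)" if "v \<in> V" for v
  proof -
    have "boundary_del x y h v - deg (E - {e}) ends v = (h v - deg E ends v) + (inc ends e v - of_bool (v = x) + of_bool (v = y))"
      using fin e by (simp add: boundary_del_def deg_remove)
    moreover have "inc ends e v = of_bool (v = x) + of_bool (v = y)"
      using e(2) by (elim disjE) (simp_all add: inc_def eq_commute)
    ultimately show ?thesis using par that by simp
  qed
  moreover note C2 X
  moreover have "2 * m - 2 + cdist m (sum (boundary (boundary_del x y h) p' q') A) \<le> full_cut (E - {e}) ends p' q' A"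
    if A: "A \<subseteq> V" "A \<noteq> {}" "A \<noteq> V" "A \<noteq> X'" for A
  proof -
    have fA: "finite A" using A fin by (auto intro: finite_subset)
    have "crossing ends A e = of_bool ((x \<in> A) \<noteq> (y \<in> A))"
      using e by (auto simp: crossing_def)
    then have "full_cut (E - {e}) ends p' q' A =
      full_cut E ends p q A - of_bool ((x \<in> A) \<noteq> (y \<in> A)) + (sum p' A - sum p A) + (sum q' A - sum q A)"
      using fin e by (simp add: full_cut_def cutsize_remove)
    moreover have "sum (boundary (boundary_del x y h) p' q') A = sum (boundary h p q) A - of_bool (x \<in> A) + of_bool (y \<in> A)
           - (sum p' A - sum p A) + (sum q' A - sum q A)"
      using fA by (simp add: sum_boundary sum_boundary_del)
    ultimately show ?thesis using C3[OF A] by metis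
  qed
  ultimately show ?thesis by (rule instance_okI)
qed

section \<open>Lifting edges at a vertex\<close>

text \<open>The lifted edge keeps the name \<open>e\<close> while \<open>e'\<close> disappears. Its
  direction is copied to the path between \<open>u\<close> and \<open>w\<close> through
  \<open>x\<close>, which contributes nothing at \<open>x\<close>.\<close>

lemma solvable_lift:
  assumes "finite E" "e \<in> E" "e' \<in> E" "e \<noteq> e'" "x \<noteq> u" "x \<noteq> w"
    and e: "ends e = (x, u) \<or> ends e = (u, x)" and e': "ends e' = (x, w) \<or> ends e' = (w, x)"
    and S: "solvable m V (E - {e'}) (ends(e := (u, w))) h"
  shows "solvable m V E ends h"
proof -
  let ?ends = "ends(e := (u, w))"
  obtain s where s: "\<forall>f\<in>E-{e'}. s f = 1 \<or> s f = -1"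
    "\<forall>v\<in>V. 2 * m dvd net (E - {e'}) ?ends s v - h v"
    using S by (auto simp: solvable_def)
  define s' where "s' = s(e := if fst (ends e) = x then - s e else s e, e' := if fst (ends e') = x then s e else - s e)"
  have "net E ends s' v = net (E - {e'}) ?ends s v" for v
  proof -
    have fin: "finite (E - {e'})" "e \<in> E - {e'}" using assms by auto
    have 1: "net E ends s' v = net (E - {e'} - {e}) ends s' v + s' e * dinc ends e v + s' e' * dinc ends e' v"
      using net_remove[OF assms(1,3), of ends s' v] net_remove[OF fin, of ends s' v] by simp
    have e1: "s' e * dinc ends e v = s e * (of_bool (v = u) - of_bool (v = x))"
      using e assms(4-6) by (elim disjE) (simp_all add: ends_pair s'_def)
    have e2: "s' e' * dinc ends e' v = s e * (of_bool (v = x) - of_bool (v = w))"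
      using e' assms(4-6) by (elim disjE) (simp_all add: ends_pair s'_def)
    have e3: "s e * dinc ?ends e v = s e * (of_bool (v = u) - of_bool (v = w))"
      by (simp add: ends_pair)
    have "net (E - {e'} - {e}) ends s' v = net (E - {e'} - {e}) ?ends s v"
      unfolding net_def by (rule sum.cong) (auto simp: s'_def dinc_def)
    then show ?thesis using 1 net_remove[OF fin, of ?ends s v]
      by (simp add: e1 e2 e3 algebra_simps)
  qed
  then show ?thesis unfolding solvable_def using s assms(2,4)
    by (intro exI[of _ s']) (auto simp: s'_def)
qed

lemma cutsize_lift:
  assumes "finite E" "e \<in> E" "e' \<in> E" "e \<noteq> e'"
    and e: "ends e = (x, u) \<or> ends e = (u, x)" and e': "ends e' = (x, w) \<or> ends e' = (w, x)"
  shows "cutsize (E - {e'}) (ends(e := (u, w))) A =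
     cutsize E ends A - 2 * of_bool ((u \<in> A) = (w \<in> A) \<and> (u \<in> A) \<noteq> (x \<in> A))"
proof -
  have "cutsize (E - {e'} - {e}) (ends(e := (u, w))) A = cutsize (E - {e'} - {e}) ends A"
    using assms(1) by (simp add: cutsize_eq_sum crossing_def)
  moreover have "crossing ends A e = of_bool ((x \<in> A) \<noteq> (u \<in> A))" "crossing ends A e' = of_bool ((x \<in> A) \<noteq> (w \<in> A))"
    using e e' by (auto simp: crossing_def)
  moreover have "crossing (ends(e := (u, w))) A e = of_bool ((u \<in> A) \<noteq> (w \<in> A))"
    by (simp add: crossing_def)
  ultimately show ?thesis using assms(1-4)
    cutsize_remove[of "E - {e'}" e "ends(e := (u, w))" A] cutsize_remove[of "E - {e'}" e ends A]
    cutsize_remove[of E e' ends A] by (cases "x \<in> A"; cases "u \<in> A"; cases "w \<in> A") simp_all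
qed

lemma deg_lift:
  assumes "finite E" "e \<in> E" "e' \<in> E" "e \<noteq> e'"
    and e: "ends e = (x, u) \<or> ends e = (u, x)" and e': "ends e' = (x, w) \<or> ends e' = (w, x)"
  shows "deg (E - {e'}) (ends(e := (u, w))) v = deg E ends v - 2 * of_bool (v = x)"
proof -
  have "deg (E - {e'} - {e}) (ends(e := (u, w))) v = deg (E - {e'} - {e}) ends v"
    using assms(1) by (simp add: deg_def inc_def)
  moreover have "inc ends e v = of_bool (v = x) + of_bool (v = u)" 
    using e by (elim disjE) (simp_all add: inc_def eq_commute)
  moreover have "inc ends e' v = of_bool (v = x) + of_bool (v = w)"
    using e' by (elim disjE) (simp_all add: inc_def eq_commute)
  moreover have "inc (ends(e := (u, w))) e v = of_bool (v = u) + of_bool (v = w)"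
    by (simp add: inc_def eq_commute)
  ultimately show ?thesis using assms(1-4)
    deg_remove[of "E - {e'}" e "ends(e := (u, w))" v] deg_remove[of "E - {e'}" e ends v]
    deg_remove[of E e' ends v] by simp
qed

text \<open>No proper set with at least two vertices is tight: by parity a nonzero excess is at
  least 2. These two units are what lifting and deletion spend.\<close>

definition slack :: "int \<Rightarrow> 'v set \<Rightarrow> 'e set \<Rightarrow> ('e \<Rightarrow> 'v \<times> 'v) \<Rightarrow> ('v \<Rightarrow> int) \<Rightarrow>
    ('v \<Rightarrow> int) \<Rightarrow> ('v \<Rightarrow> int) \<Rightarrow> bool" where
  "slack m V E ends h p q \<longleftrightarrow>
     (\<forall>A a b. A \<subseteq> V \<and> A \<noteq> V \<and> a \<in> A \<and> b \<in> A \<and> a \<noteq> b \<longrightarrow>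
        2 * m + cdist m (sum (boundary h p q) A) \<le> full_cut E ends p q A)"

lemma instance_ok_graph: "instance_ok m V E ends h p q X \<Longrightarrow> graph V E ends"
  by (simp add: instance_ok_def)

lemma instance_ok_cut:
  "instance_ok m V E ends h p q X \<Longrightarrow> A \<subseteq> V \<Longrightarrow> A \<noteq> {} \<Longrightarrow> A \<noteq> V \<Longrightarrow> A \<noteq> X \<Longrightarrow>
     2 * m - 2 + cdist m (sum (boundary h p q) A) \<le> full_cut E ends p q A"
  by (simp add: instance_ok_def)

lemma slackD:
  "slack m V E ends h p q \<Longrightarrow> A \<subseteq> V \<Longrightarrow> A \<noteq> V \<Longrightarrow> a \<in> A \<Longrightarrow> b \<in> A \<Longrightarrow> a \<noteq> b \<Longrightarrow>
     2 * m + cdist m (sum (boundary h p q) A) \<le> full_cut E ends p q A"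
  unfolding slack_def by blast

text \<open>A set that loses two cut edges separates \<open>x\<close> from both \<open>u\<close> and
  \<open>w\<close>. It contains these two, or it contains \<open>x\<close> and some further vertex,
  and then the slack pays. The only exception is \<open>{x}\<close>, which becomes exempt.\<close>

lemma instance_ok_lift:
  assumes I: "instance_ok m V E ends h p q X" and sl: "slack m V E ends h p q"
    and X: "X \<subseteq> {x}" "x \<in> V" "2 * m dvd boundary h p q x"
    and E: "e \<in> E" "e' \<in> E" "e \<noteq> e'" "u \<noteq> x" "w \<noteq> x" "u \<noteq> w"
    and e: "ends e = (x, u) \<or> ends e = (u, x)" and e': "ends e' = (x, w) \<or> ends e' = (w, x)"
  shows "instance_ok m V (E - {e'}) (ends(e := (u, w))) h p q {x}"
proof -
  let ?E = "E - {e'}" and ?ends = "ends(e := (u, w))"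
  have g: "graph V E ends" by (rule instance_ok_graph[OF I])
  have fin: "finite E" "finite V" using g by (auto simp: graph_def)
  have uw: "u \<in> V" "w \<in> V" using g E e e' by (auto simp: graph_def)
  have "graph V ?E ?ends" using g uw by (auto simp: graph_def)
  moreover note instance_okD(2-4)[OF I]
  moreover have "even (h v - deg ?E ?ends v)" if "v \<in> V" for v
  proof -
    have "even (h v - deg E ends v)" using instance_okD(5)[OF I that] .
    then show ?thesis using fin E e e' by (simp add: deg_lift[of E e e' ends x u w])
  qed
  moreover note instance_okD(6)[OF I]
  moreover have "{x} = {} \<or> (\<exists>z\<in>V. {x} = {z} \<and> 2 * m dvd boundary h p q z)" using X by simp
  moreover have "2 * m - 2 + cdist m (sum (boundary h p q) A) \<le> full_cut ?E ?ends p q A"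
    if A: "A \<subseteq> V" "A \<noteq> {}" "A \<noteq> V" "A \<noteq> {x}" for A
  proof -
    have d: "full_cut ?E ?ends p q A = full_cut E ends p q A
        - 2 * of_bool ((u \<in> A) = (w \<in> A) \<and> (u \<in> A) \<noteq> (x \<in> A))"
      using fin E e e' by (simp add: full_cut_def cutsize_lift[of E e e' ends x u w])
    show ?thesis
    proof (cases "(u \<in> A) = (w \<in> A) \<and> (u \<in> A) \<noteq> (x \<in> A)")
      case True
      then obtain a b where "a \<in> A" "b \<in> A" "a \<noteq> b" using E(6) A(2,4) by blast
      then have "2 * m + cdist m (sum (boundary h p q) A) \<le> full_cut E ends p q A"
        using slackD[OF sl A(1,3)] by blast
      then show ?thesis using d True by simp
    next
      case False
      moreover have "A \<noteq> X" using A X by blast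
      ultimately show ?thesis using instance_ok_cut[OF I A(1-3)] d by auto
    qed
  qed
  ultimately show ?thesis by (rule instance_okI)
qed

text \<open>A virtual edge into \<open>x\<close> and an edge to \<open>u\<close> are lifted to a
  virtual edge into \<open>u\<close>. The direction of the virtual edge is fixed, so
  \<open>e\<close> must leave \<open>x\<close>; it is deleted, and \<open>boundary\<close> is the
  same as before at every vertex.\<close>

lemma instance_ok_lift_virtual:
  assumes m: "2 \<le> m" and I: "instance_ok m V E ends h p q X" and sl: "slack m V E ends h p q"
    and X: "X \<subseteq> {x}" "x \<in> V" "2 * m dvd boundary h p q x" "p x > 0"
    and e: "e \<in> E" "u \<noteq> x" "ends e = (x, u) \<or> ends e = (u, x)"
  shows "instance_ok m V (E - {e}) ends (boundary_del x u h) (\<lambda>v. p v - of_bool (v = x) + of_bool (v = u)) q {x}"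
proof (rule instance_ok_delete[OF m I e(1,3)])
  let ?p = "\<lambda>v. p v - of_bool (v = x) + of_bool (v = u)"
  have g: "graph V E ends" by (rule instance_ok_graph[OF I])
  have fin: "finite E" "finite V" using g by (auto simp: graph_def)
  have u: "u \<in> V" using g e by (auto simp: graph_def)
  have sp: "sum ?p A = sum p A - of_bool (x \<in> A) + of_bool (u \<in> A)" if "A \<subseteq> V" for A
    using finite_subset[OF that fin(2)] by (simp add: sum.distrib sum_subtractf sum_of_bool_single)
  show "\<forall>v\<in>V. 0 \<le> ?p v \<and> 0 \<le> q v" using instance_okD(3)[OF I] X(4) by auto
  show "sum ?p V + sum q V \<le> 2 * m - 2 + cdist m (sum ?p V - sum q V)"
    using instance_okD(6)[OF I] X u by (simp add: sp)
  show "{x} = {} \<or> (\<exists>z\<in>V. {x} = {z} \<and> 2 * m dvd boundary (boundary_del x u h) ?p q z)"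
    using X e(2) by (auto simp: boundary_def boundary_del_def)
  show "x \<noteq> u" using e by simp
  fix A assume A: "A \<subseteq> V" "A \<noteq> {}" "A \<noteq> V" "A \<noteq> {x}"
  have AX: "A \<noteq> X" using A X by blast
  show "2 * m - 2 + cdist m (sum (boundary h p q) A - of_bool (x \<in> A) + of_bool (u \<in> A)
           - (sum ?p A - sum p A) + (sum q A - sum q A))
       \<le> full_cut E ends p q A - of_bool ((x \<in> A) \<noteq> (u \<in> A)) + (sum ?p A - sum p A) + (sum q A - sum q A)"
  proof (cases "x \<in> A \<and> u \<notin> A")
    case True
    then obtain b where "b \<in> A" "b \<noteq> x" using A by blast
    then have "2 * m + cdist m (sum (boundary h p q) A) \<le> full_cut E ends p q A"
      using slackD[OF sl A(1,3)] True by blast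
    then show ?thesis using True by (simp add: sp[OF A(1)])
  next
    case False
    then show ?thesis using instance_ok_cut[OF I A(1-3) AX] by (auto simp: sp[OF A(1)])
  qed
qed

section \<open>Removal of a vertex with a single neighbour\<close>

definition edges_off :: "'e set \<Rightarrow> ('e \<Rightarrow> 'v \<times> 'v) \<Rightarrow> 'v \<Rightarrow> 'e set" where
  "edges_off E ends x = {e \<in> E. fst (ends e) \<noteq> x \<and> snd (ends e) \<noteq> x}"

lemma even_balanced_signs:
  assumes "finite B" "even (card B)"
  shows "\<exists>t. (\<forall>e\<in>B. t e = 1 \<or> t e = -1) \<and> (\<Sum>e\<in>B. t e) = (0::int)"
proof -
  obtain C where C: "C \<subseteq> B" "card C = card B div 2"
    by (meson div_le_dividend obtain_subset_with_card_n)
  have "(\<Sum>e\<in>B. if e \<in> C then 1 else -1) = int (card C) - int (card (B - C))"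
    using assms C by (simp add: sum.If_cases Int_absorb1 Diff_eq)
  also have "\<dots> = 0" using assms C by (auto simp: card_Diff_subset finite_subset elim!: evenE)
  finally show ?thesis by (intro exI[of _ "\<lambda>e. if e \<in> C then 1 else -1"]) simp
qed

text \<open>Boundary 0 and parity make the number of edges between \<open>x\<close> and
  \<open>u\<close> even, so half of them can go each way without affecting the rest. For the cut
  condition, a set containing \<open>u\<close> is compared with the same set plus \<open>x\<close>,
  a set avoiding \<open>u\<close> with itself.\<close>

lemma pendant:
  assumes I: "instance_ok m V E ends h p q X"
    and X: "X \<subseteq> {x}" "x \<in> V" "2 * m dvd boundary h p q x" "p x = 0" "q x = 0"
    and u: "u \<in> V" "u \<noteq> x"
    and nb: "\<And>e. e \<in> E \<Longrightarrow> fst (ends e) = x \<Longrightarrow> snd (ends e) = x \<or> snd (ends e) = u"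
      "\<And>e. e \<in> E \<Longrightarrow> snd (ends e) = x \<Longrightarrow> fst (ends e) = x \<or> fst (ends e) = u"
  shows "instance_ok m (V - {x}) (edges_off E ends x) ends h p q {}"
    and "solvable m (V - {x}) (edges_off E ends x) ends h \<Longrightarrow> solvable m V E ends h"
proof -
  let ?E = "edges_off E ends x" let ?F = "E - ?E"
  have g: "graph V E ends" by (rule instance_ok_graph[OF I])
  have fin: "finite E" "finite V" using g by (auto simp: graph_def)
  have finF: "finite ?F" "finite ?E" using fin by (auto simp: edges_off_def)
  have EF: "E = ?E \<union> ?F" "?E \<inter> ?F = {}" by (auto simp: edges_off_def)
  have F: "ends e = (x, x) \<or> ends e = (x, u) \<or> ends e = (u, x)" if "e \<in> ?F" for e
    using that nb[of e] by (cases "ends e") (auto simp: edges_off_def)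
  have hx: "2 * m dvd h x" using X by (simp add: boundary_def)
  have cE: "cutsize E ends A = cutsize ?E ends A + cutsize ?F ends A" for A
    using cutsize_split[OF finF(2,1) EF(2)] EF(1) by simp
  have dE: "deg E ends v = deg ?E ends v + deg ?F ends v" for v
    using sum.union_disjoint[OF finF(2,1) EF(2)] EF(1) by (metis deg_def)
  have nE: "net E ends s v = net ?E ends s v + net ?F ends s v" for s v
    using sum.union_disjoint[OF finF(2,1) EF(2)] EF(1) by (metis net_def)
  have cF: "cutsize ?F ends A = 0" if "(x \<in> A) = (u \<in> A)" for A
    unfolding cutsize_eq_sum[OF finF(1)]
    by (rule sum.neutral, rule ballI, drule F) (use that in \<open>auto simp: crossing_def\<close>)
  have dEx: "deg ?E ends x = 0" by (auto simp: deg_def edges_off_def inc_def intro: sum.neutral)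
  have nEx: "net ?E ends s x = 0" for s by (auto simp: net_def edges_off_def dinc_def intro: sum.neutral)
  \<comment> \<open>Loops at \<open>x\<close> count twice, so only the edges in \<open>B\<close>
    decide the parity of the degree.\<close>
  define B where "B = {e \<in> ?F. fst (ends e) \<noteq> snd (ends e)}"
  have evx: "even (deg ?F ends x)"
  proof -
    have "even (h x - deg E ends x)" using instance_okD(5)[OF I X(2)] .
    moreover have "even (h x)" using hx by auto
    ultimately show ?thesis using dE dEx by simp
  qed
  have incF: "inc ends e x = 2 - of_bool (e \<in> B)" if "e \<in> ?F" for e
    using F[OF that] that u by (elim disjE) (simp_all add: ends_pair B_def)
  have incF': "inc ends e u = of_bool (e \<in> B)" if "e \<in> ?F" for e
    using F[OF that] that u by (elim disjE) (simp_all add: ends_pair B_def)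
  have finB: "finite B" "B \<subseteq> ?F" using finF by (auto simp: B_def)
  have sB: "(\<Sum>e\<in>?F. of_bool (e \<in> B)) = int (card B)"
    using finF finB by (simp add: of_bool_def sum.If_cases Int_absorb1 Int_absorb2)
  have dFx: "deg ?F ends x = 2 * int (card ?F) - int (card B)"
    unfolding deg_def using sB by (simp add: incF sum_subtractf)
  have dFu: "deg ?F ends u = int (card B)"
    unfolding deg_def using sB by (simp add: incF')
  have evB: "even (card B)" using evx dFx by simp
  have dFv: "deg ?F ends v = 0" if "v \<noteq> x" "v \<noteq> u" for v
    unfolding deg_def by (rule sum.neutral, rule ballI, drule F) (use that in \<open>auto simp: inc_def\<close>)
  show "instance_ok m (V - {x}) (edges_off E ends x) ends h p q {}"
  proof -
    have "graph (V - {x}) ?E ends" using g by (auto simp: graph_def edges_off_def)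
    moreover have "V - {x} \<noteq> {}" using u by auto
    moreover have "\<forall>v\<in>V - {x}. 0 \<le> p v \<and> 0 \<le> q v" using instance_okD(3)[OF I] by simp
    moreover have "2 * m dvd sum h (V - {x})"
      using hx instance_okD(4)[OF I] X(2) fin by (simp add: sum_diff1)
    moreover have "even (h v - deg ?E ends v)" if "v \<in> V - {x}" for v
    proof -
      have "even (h v - deg E ends v)" using instance_okD(5)[OF I] that by simp
      moreover have "even (deg ?F ends v)" using dFu dFv[of v] evB that by (cases "v = u") auto
      ultimately show ?thesis using dE[of v] by simp
    qed
    moreover have "sum p (V - {x}) + sum q (V - {x}) \<le> 2 * m - 2 + cdist m (sum p (V - {x}) - sum q (V - {x}))"
      using instance_okD(6)[OF I] X fin by (simp add: sum_diff1)
    moreover have "{} = {} \<or> (\<exists>z\<in>V - {x}. {} = {z} \<and> 2 * m dvd boundary h p q z)" by simp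
    moreover have "2 * m - 2 + cdist m (sum (boundary h p q) A) \<le> full_cut ?E ends p q A"
      if A: "A \<subseteq> V - {x}" "A \<noteq> {}" "A \<noteq> V - {x}" for A
    proof (cases "u \<in> A")
      case True
      have fA: "finite A" "x \<notin> A" using A fin by (auto intro: finite_subset)
      have "2 * m - 2 + cdist m (sum (boundary h p q) (insert x A)) \<le> full_cut E ends p q (insert x A)"
        using A X True u by (intro instance_ok_cut[OF I]) auto
      moreover have "cdist m (sum (boundary h p q) (insert x A)) = cdist m (sum (boundary h p q) A)"
        using X fA by (simp add: cdist_def mod_add_left_eq[symmetric, of "boundary h p q x"])
      moreover have "cutsize ?E ends (insert x A) = cutsize ?E ends A"
        unfolding cutsize_eq_sum[OF finF(2)] by (rule sum.cong) (auto simp: crossing_def edges_off_def)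
      then have "full_cut E ends p q (insert x A) = full_cut ?E ends p q A"
        using fA True X by (simp add: full_cut_def cE cF)
      ultimately show ?thesis by simp
    next
      case False
      have "2 * m - 2 + cdist m (sum (boundary h p q) A) \<le> full_cut E ends p q A"
        using A X by (intro instance_ok_cut[OF I]) auto
      moreover have "cutsize ?F ends A = 0" using A False by (intro cF) auto
      ultimately show ?thesis by (simp add: full_cut_def cE)
    qed
    ultimately show ?thesis by (rule instance_okI)
  qed
  assume "solvable m (V - {x}) ?E ends h"
  then obtain s where s: "\<forall>e\<in>?E. s e = 1 \<or> s e = -1" "\<forall>v\<in>V-{x}. 2 * m dvd net ?E ends s v - h v"
    by (auto simp: solvable_def)
  obtain t where t: "\<forall>e\<in>B. t e = 1 \<or> t e = -1" "(\<Sum>e\<in>B. t e) = (0::int)"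
    using even_balanced_signs[OF finB(1) evB] by blast
  define s' where "s' e = (if e \<in> B then if fst (ends e) = x then t e else - t e else if e \<in> ?F then 1 else s e)" for e
  have "net ?F ends s' v = 0" for v
  proof -
    have "s' e * dinc ends e v = (of_bool (v = x) - of_bool (v = u)) * (of_bool (e \<in> B) * t e)" if "e \<in> ?F" for e
      using F[OF that] that u by (elim disjE) (simp_all add: ends_pair s'_def B_def)
    then have "net ?F ends s' v = (of_bool (v = x) - of_bool (v = u)) * (\<Sum>e\<in>?F. of_bool (e \<in> B) * t e)"
      by (simp add: net_def sum_distrib_left)
    also have "(\<Sum>e\<in>?F. of_bool (e \<in> B) * t e) = (\<Sum>e\<in>B. t e)"
      using finF finB by (intro sum.mono_neutral_cong_right) auto
    finally show ?thesis using t by simp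
  qed
  moreover have "net ?E ends s' v = net ?E ends s v" for v
    by (rule net_cong) (auto simp: s'_def B_def)
  ultimately have n: "net E ends s' v = net ?E ends s v" for v using nE by simp
  show "solvable m V E ends h" unfolding solvable_def
  proof (intro exI[of _ s'] conjI ballI)
    fix v assume "v \<in> V"
    then show "2 * m dvd net E ends s' v - h v" using s hx nEx[of s] by (cases "v = x") (auto simp: n)
  next
    fix e assume "e \<in> E" then show "s' e = 1 \<or> s' e = -1" using s t by (auto simp: s'_def)
  qed
qed

section \<open>Contraction of tight sets\<close>

text \<open>Edges inside \<open>A\<close> become loops at \<open>r\<close>, so the edge set is kept
  and signs transfer as they are. Sets of the new graph correspond to old sets containing all of
  \<open>A\<close> or none of it. Those containing \<open>A\<close> have two elements, so they
  differ from the exempt singleton, and an exemption inside \<open>A\<close> disappears.\<close>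

lemma contract_outside:
  fixes ends :: "'e \<Rightarrow> 'v \<times> 'v"
  assumes I: "instance_ok m V E ends h p q X"
    and A: "A \<subseteq> V" "r \<in> A" "b \<in> A" "r \<noteq> b"
  defines "\<phi> \<equiv> \<lambda>v. if v \<in> A then r else v"
  defines "cf \<equiv> \<lambda>(f :: 'v \<Rightarrow> int) v. if v = r then sum f A else f v"
  shows "instance_ok m (insert r (V - A)) E (map_prod \<phi> \<phi> \<circ> ends) (cf h) (cf p) (cf q) (if X \<subseteq> A then {} else X)"
    and "v \<notin> A \<Longrightarrow> net E (map_prod \<phi> \<phi> \<circ> ends) s v = net E ends s v"
proof -
  let ?V = "insert r (V - A)" and ?ends = "map_prod \<phi> \<phi> \<circ> ends"
  have g: "graph V E ends" using I by (rule instance_ok_graph)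
  have fin: "finite E" "finite V" "finite A" using g A by (auto simp: graph_def intro: finite_subset)
  define up where "up B = (if r \<in> B then (B - {r}) \<union> A else B)" for B
  have sum_cf: "sum (cf f) B = sum f (up B)" if "B \<subseteq> ?V" for f B
  proof -
    have fB: "finite B" using that fin by (auto intro: finite_subset)
    have "sum (cf f) (B - {r}) = sum f (B - {r})" by (rule sum.cong) (auto simp: cf_def)
    moreover have "sum f ((B - {r}) \<union> A) = sum f (B - {r}) + sum f A"
      using that A fB fin by (intro sum.union_disjoint) auto
    moreover have "sum (cf f) B = sum (cf f) (B - {r}) + of_bool (r \<in> B) * sum f A"
      using fB by (cases "r \<in> B") (auto simp: cf_def sum.remove[of B r] intro!: sum.cong)
    ultimately show ?thesis by (auto simp: up_def)
  qed
  have upV: "up ?V = V" using A by (auto simp: up_def)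
  have bdcf: "boundary (cf h) (cf p) (cf q) = cf (boundary h p q)"
    by (auto simp: cf_def boundary_def sum.distrib sum_subtractf)
  have dincv: "dinc ?ends e v = dinc ends e v" "inc ?ends e v = inc ends e v" if "v \<notin> A" for e v
    using that A by (auto simp: dinc_def inc_def \<phi>_def)
  have incr: "inc ?ends e r = (\<Sum>v\<in>A. inc ends e v)" if "e \<in> E" for e
    unfolding sum_inc[OF fin(3)] using A by (auto simp: inc_def \<phi>_def)
  show "net E ?ends s v = net E ends s v" if "v \<notin> A"
    using dincv[OF that] by (simp add: net_def)
  have cut: "cutsize E ?ends B = cutsize E ends (up B)" if "B \<subseteq> ?V" for B
    unfolding cutsize_eq_sum[OF fin(1)]
  proof (rule sum.cong)
    fix e assume "e \<in> E"
    have "(\<phi> v \<in> B) = (v \<in> up B)" for v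
      using A that by (auto simp: \<phi>_def up_def)
    then show "crossing ?ends B e = crossing ends (up B) e" by (simp add: crossing_def)
  qed simp
  have "graph ?V E ?ends" using g by (auto simp: graph_def \<phi>_def)
  moreover have "?V \<noteq> {}" by simp
  moreover have "\<forall>v\<in>?V. 0 \<le> cf p v \<and> 0 \<le> cf q v"
    using instance_okD(3)[OF I] A(1) unfolding cf_def by (auto intro!: sum_nonneg)
  moreover have "2 * m dvd sum (cf h) ?V" using instance_okD(4)[OF I] by (simp only: sum_cf upV order_refl)
  moreover have "even (cf h v - deg E ?ends v)" if "v \<in> ?V" for v
  proof (cases "v = r")
    case True
    have "deg E ?ends r = (\<Sum>v\<in>A. deg E ends v)"
      unfolding deg_def by (subst sum.swap) (simp add: incr)
    then have "cf h v - deg E ?ends v = (\<Sum>v\<in>A. h v - deg E ends v)"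
      using True by (simp add: cf_def sum_subtractf)
    also have "even \<dots>" using instance_okD(5)[OF I] A(1) by (intro dvd_sum) auto
    finally show ?thesis .
  next
    case False
    then have "v \<notin> A" "v \<in> V" using that by auto
    then show ?thesis using instance_okD(5)[OF I] False dincv by (simp add: cf_def deg_def)
  qed
  moreover have "sum (cf p) ?V + sum (cf q) ?V \<le> 2 * m - 2 + cdist m (sum (cf p) ?V - sum (cf q) ?V)"
    using instance_okD(6)[OF I] by (simp only: sum_cf upV order_refl)
  moreover have "(if X \<subseteq> A then {} else X) = {} \<or>
     (\<exists>x\<in>?V. (if X \<subseteq> A then {} else X) = {x} \<and> 2 * m dvd boundary (cf h) (cf p) (cf q) x)"
    using instance_okD(7)[OF I] A unfolding bdcf by (auto simp: cf_def)
  moreover have "2 * m - 2 + cdist m (sum (boundary (cf h) (cf p) (cf q)) B) \<le> full_cut E ?ends (cf p) (cf q) B"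
    if B: "B \<subseteq> ?V" "B \<noteq> {}" "B \<noteq> ?V" "B \<noteq> (if X \<subseteq> A then {} else X)" for B
  proof -
    have 1: "up B \<subseteq> V" "up B \<noteq> {}" using B A by (auto simp: up_def)
    have 2: "up B \<noteq> V" using B A by (auto simp: up_def split: if_splits)
    have Xs: "X = {} \<or> (\<exists>x. X = {x})" using instance_okD(7)[OF I] by blast
    have 3: "up B \<noteq> X"
    proof (cases "r \<in> B")
      case True
      then have "r \<in> up B" "b \<in> up B" using A by (auto simp: up_def)
      then show ?thesis using Xs A(4) by (metis empty_iff singletonD)
    next
      case False
      then have "up B = B" "B \<inter> A = {}" using B(1) by (auto simp: up_def)
      then show ?thesis using B(2,4) by (cases "X \<subseteq> A") auto
    qed
    show ?thesis using instance_ok_cut[OF I 1 2 3] B(1)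
      by (simp add: full_cut_def bdcf sum_cf cut)
  qed
  ultimately show "instance_ok m ?V E ?ends (cf h) (cf p) (cf q) (if X \<subseteq> A then {} else X)"
    by (rule instance_okI)
qed

definition eout :: "('e \<Rightarrow> 'v \<times> 'v) \<Rightarrow> ('e \<Rightarrow> int) \<Rightarrow> 'e \<Rightarrow> 'v \<Rightarrow> int" where
  "eout ends s e v = of_bool ((if s e = 1 then fst (ends e) else snd (ends e)) = v)"

definition ein :: "('e \<Rightarrow> 'v \<times> 'v) \<Rightarrow> ('e \<Rightarrow> int) \<Rightarrow> 'e \<Rightarrow> 'v \<Rightarrow> int" where
  "ein ends s e v = of_bool ((if s e = 1 then snd (ends e) else fst (ends e)) = v)"

text \<open>The complement of \<open>A\<close> is merged into the special vertex. A cut edge that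
  \<open>s\<close> directs into \<open>A\<close> becomes a virtual edge counted by
  \<open>p'\<close>, one directed out of \<open>A\<close> is counted by \<open>q'\<close>. As
  \<open>h'\<close> subtracts their effect, \<open>boundary\<close> and \<open>full_cut\<close> are
  unchanged on subsets of \<open>A\<close>; the bound on virtual edges comes from tightness.\<close>

lemma contract_inside:
  fixes ends :: "'e \<Rightarrow> 'v \<times> 'v"
  assumes m: "2 \<le> m" and I: "instance_ok m V E ends h p q X"
    and A: "A \<subseteq> V" "A \<noteq> V" "A \<noteq> {}" "A \<noteq> X"
    and tight: "full_cut E ends p q A < 2 * m + cdist m (sum (boundary h p q) A)"
    and s: "\<forall>e\<in>E. s e = 1 \<or> s e = -1" "2 * m dvd (\<Sum>v\<in>A. net E ends s v - h v)"
  defines "F \<equiv> {e \<in> E. fst (ends e) \<in> A \<and> snd (ends e) \<in> A}" and "C \<equiv> edge_cut E ends A"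
  defines "h' \<equiv> \<lambda>v. h v - net C ends s v"
    and "p' \<equiv> \<lambda>v. p v + (\<Sum>e\<in>C. ein ends s e v)" and "q' \<equiv> \<lambda>v. q v + (\<Sum>e\<in>C. eout ends s e v)"
  shows "instance_ok m A F ends h' p' q' (if X \<subseteq> A then X else {})"
proof -
  have g: "graph V E ends" using I by (rule instance_ok_graph)
  have fin: "finite E" "finite V" "finite A" "finite F" "finite C"
    using g A by (auto simp: graph_def F_def C_def edge_cut_def intro: finite_subset)
  have CE: "C \<subseteq> E" "F \<subseteq> E" "F \<inter> C = {}" by (auto simp: C_def F_def edge_cut_def)
  have io: "eout ends s e v - ein ends s e v = s e * dinc ends e v" "eout ends s e v + ein ends s e v = inc ends e v"
    if "e \<in> E" for e v
    using s that by (auto simp: eout_def ein_def dinc_def inc_def)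
  have bd': "boundary h' p' q' = boundary h p q"
  proof
    fix v
    have "(\<Sum>e\<in>C. eout ends s e v) - (\<Sum>e\<in>C. ein ends s e v) = net C ends s v"
      using CE by (auto simp: net_def sum_subtractf[symmetric] io intro!: sum.cong)
    then show "boundary h' p' q' v = boundary h p q v" by (simp add: boundary_def h'_def p'_def q'_def)
  qed
  have dg': "full_cut F ends p' q' B = full_cut E ends p q B" if B: "B \<subseteq> A" for B
  proof -
    have fB: "finite B" using B fin by (auto intro: finite_subset)
    have "sum p' B + sum q' B = sum p B + sum q B + (\<Sum>v\<in>B. \<Sum>e\<in>C. inc ends e v)"
    proof -
      have "(\<Sum>e\<in>C. ein ends s e v) + (\<Sum>e\<in>C. eout ends s e v) = (\<Sum>e\<in>C. inc ends e v)" for v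
        unfolding sum.distrib[symmetric] using io(2) CE(1) by (intro sum.cong) (auto simp: add.commute)
      then show ?thesis by (simp add: p'_def q'_def sum.distrib flip: add.assoc) (simp add: add_ac flip: sum.distrib)
    qed
    also have "(\<Sum>v\<in>B. \<Sum>e\<in>C. inc ends e v) = (\<Sum>e\<in>C. of_bool (fst (ends e) \<in> B) + of_bool (snd (ends e) \<in> B))"
      by (subst sum.swap) (simp add: sum_inc[OF fB])
    also have "\<dots> = (\<Sum>e\<in>C. crossing ends B e)"
      using B by (intro sum.cong) (auto simp: C_def edge_cut_def crossing_def)
    finally have "sum p' B + sum q' B = sum p B + sum q B + (\<Sum>e\<in>C. crossing ends B e)" .
    moreover have "(\<Sum>e\<in>E. crossing ends B e) = (\<Sum>e\<in>F \<union> C. crossing ends B e)"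
      using B fin CE by (intro sum.mono_neutral_right) (auto simp: F_def C_def edge_cut_def crossing_def)
    ultimately show ?thesis using fin CE
      by (simp add: full_cut_def cutsize_eq_sum sum.union_disjoint)
  qed
  have "graph A F ends" using fin by (auto simp: graph_def F_def)
  moreover note A(3)
  moreover have "\<forall>v\<in>A. 0 \<le> p' v \<and> 0 \<le> q' v"
    using instance_okD(3)[OF I] A(1) unfolding p'_def q'_def eout_def ein_def
    by (auto intro!: sum_nonneg add_nonneg_nonneg)
  moreover have tot: "2 * m dvd sum h' A"
  proof -
    have "(\<Sum>v\<in>A. net E ends s v) = (\<Sum>v\<in>A. net C ends s v)"
    proof -
      have "(\<Sum>e\<in>E. s e * (of_bool (fst (ends e) \<in> A) - of_bool (snd (ends e) \<in> A)))
        = (\<Sum>e\<in>C. s e * (of_bool (fst (ends e) \<in> A) - of_bool (snd (ends e) \<in> A)))"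
        using fin CE by (intro sum.mono_neutral_right) (auto simp: C_def edge_cut_def)
      then show ?thesis by (simp add: sum_net[OF fin(3)])
    qed
    then have "sum h' A = - (\<Sum>v\<in>A. net E ends s v - h v)"
      by (simp add: h'_def sum_subtractf)
    then show ?thesis using s(2) by simp
  qed
  moreover have "even (h' v - deg F ends v)" if v: "v \<in> A" for v
  proof -
    have "even (h v - deg E ends v)" using instance_okD(5)[OF I] v A(1) by blast
    moreover have "deg E ends v = deg F ends v + deg C ends v"
    proof -
      have "(\<Sum>e\<in>E. inc ends e v) = (\<Sum>e\<in>F \<union> C. inc ends e v)"
        using v fin CE by (intro sum.mono_neutral_right) (auto simp: F_def C_def edge_cut_def inc_def)
      then show ?thesis using fin CE by (simp add: deg_def sum.union_disjoint)
    qed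
    moreover have "even (net C ends s v - deg C ends v)"
      unfolding net_def deg_def sum_subtractf[symmetric]
    proof (rule dvd_sum)
      fix e assume "e \<in> C"
      then have "s e = 1 \<or> s e = -1" using s(1) CE by blast
      then have "odd (s e)" by auto
      then show "even (s e * dinc ends e v - inc ends e v)" by (auto simp: dinc_def inc_def)
    qed
    moreover have "h' v - deg F ends v = (h v - deg E ends v) - (net C ends s v - deg C ends v)"
      using calculation(2) by (simp add: h'_def)
    ultimately show ?thesis using dvd_diff by metis
  qed
  moreover have "sum p' A + sum q' A \<le> 2 * m - 2 + cdist m (sum p' A - sum q' A)"
  proof -
    have "cutsize F ends A = 0"
      unfolding cutsize_eq_sum[OF fin(4)] by (rule sum.neutral) (auto simp: F_def crossing_def)
    then have 1: "sum p' A + sum q' A = full_cut E ends p q A" using dg'[of A] by (simp add: full_cut_def)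
    have "sum (boundary h p q) A = sum h' A - (sum p' A - sum q' A)"
      by (simp add: sum_boundary bd'[symmetric])
    then have "2 * m dvd - sum (boundary h p q) A - (sum p' A - sum q' A)" using tot by simp
    then have "cdist m (sum p' A - sum q' A) = cdist m (sum (boundary h p q) A)"
      using cdist_cong[OF m] cdist_minus[OF m] by metis
    \<comment> \<open>Tightness says that the excess is below 2, and parity makes it at most
      0.\<close>
    moreover have "full_cut E ends p q A \<le> 2 * m - 2 + cdist m (sum (boundary h p q) A)"
    proof -
      obtain i j where ij: "full_cut E ends p q A - sum (boundary h p q) A = 2 * i"
        "cdist m (sum (boundary h p q) A) - sum (boundary h p q) A = 2 * j"
        using boundary_even[OF I A(1)] even_cdist_diff[OF m, of "sum (boundary h p q) A"] by (meson evenE)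
      then have "i < m + j" using tight by linarith
      then show ?thesis using ij by linarith
    qed
    ultimately show ?thesis using 1 by simp
  qed
  moreover have "(if X \<subseteq> A then X else {}) = {} \<or>
     (\<exists>x\<in>A. (if X \<subseteq> A then X else {}) = {x} \<and> 2 * m dvd boundary h' p' q' x)"
    using instance_okD(7)[OF I] unfolding bd' by auto
  moreover have "2 * m - 2 + cdist m (sum (boundary h' p' q') B) \<le> full_cut F ends p' q' B"
    if B: "B \<subseteq> A" "B \<noteq> {}" "B \<noteq> A" "B \<noteq> (if X \<subseteq> A then X else {})" for B
  proof -
    have "B \<noteq> X" using B by auto
    then show ?thesis using instance_ok_cut[OF I, of B] A B(1-3) unfolding bd' dg'[OF B(1)] by auto
  qed
  ultimately show ?thesis by (rule instance_okI)
qed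

text \<open>Only edges inside \<open>A\<close> get new signs. Cut edges keep those of
  \<open>s\<close>, and no vertex outside \<open>A\<close> meets a changed edge.\<close>

lemma contract_combine:
  fixes ends :: "'e \<Rightarrow> 'v \<times> 'v"
  assumes g: "graph V E ends" and A: "A \<subseteq> V" "r \<in> A"
    and s: "\<forall>e\<in>E. s e = 1 \<or> s e = -1" "\<forall>v\<in>V-A. 2 * m dvd net E ends s v - h v"
  defines "F \<equiv> {e \<in> E. fst (ends e) \<in> A \<and> snd (ends e) \<in> A}" and "C \<equiv> edge_cut E ends A"
  assumes S: "solvable m A F ends (\<lambda>v. h v - net C ends s v)"
  shows "solvable m V E ends h"
proof -
  have fin: "finite E" using g by (simp add: graph_def)
  obtain t where t: "\<forall>e\<in>F. t e = 1 \<or> t e = -1" "\<forall>v\<in>A. 2 * m dvd net F ends t v - (h v - net C ends s v)"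
    using S by (auto simp: solvable_def)
  define u where "u e = (if e \<in> F then t e else s e)" for e
  have FC: "F \<subseteq> E" "C \<subseteq> E" "F \<inter> C = {}" by (auto simp: F_def C_def edge_cut_def)
  have "2 * m dvd net E ends u v - h v" if v: "v \<in> V" for v
  proof (cases "v \<in> A")
    case True
    have "net E ends u v = (\<Sum>e\<in>F \<union> C. u e * dinc ends e v)"
      unfolding net_def using True fin FC
      by (intro sum.mono_neutral_right) (auto simp: F_def C_def edge_cut_def dinc_def)
    also have "\<dots> = net F ends u v + net C ends u v"
      using fin FC by (simp add: net_def sum.union_disjoint finite_subset)
    also have "net F ends u v = net F ends t v" by (rule net_cong) (simp add: u_def)
    also have "net C ends u v = net C ends s v" by (rule net_cong) (use FC in \<open>auto simp: u_def\<close>)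
    finally show ?thesis using t(2) True by (simp add: algebra_simps)
  next
    case False
    have "net E ends u v = net E ends s v" unfolding net_def
      by (rule sum.cong) (use False in \<open>auto simp: u_def F_def dinc_def\<close>)
    then show ?thesis using s(2) v False by simp
  qed
  then show ?thesis unfolding solvable_def using s t FC
    by (intro exI[of _ u]) (auto simp: u_def)
qed

section \<open>The induction for modulo orientations\<close>

text \<open>Contraction and removal of a vertex lower the first component of this lexicographic
  order. Lifting and orienting an edge lower the second and may add virtual edges; dropping a
  virtual edge lowers the third.\<close>

definition smaller :: "'v set \<Rightarrow> 'e set \<Rightarrow> ('v \<Rightarrow> int) \<Rightarrow> ('v \<Rightarrow> int) \<Rightarrow>
    'v set \<Rightarrow> 'e set \<Rightarrow> ('v \<Rightarrow> int) \<Rightarrow> ('v \<Rightarrow> int) \<Rightarrow> bool" where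
  "smaller V' E' p' q' V E p q \<longleftrightarrow> card V' < card V \<or> card V' = card V \<and>
     (card E' < card E \<or> card E' = card E \<and> sum p' V' + sum q' V' < sum p V + sum q V)"

definition smaller_solvable :: "int \<Rightarrow> 'v set \<Rightarrow> 'e set \<Rightarrow> ('v \<Rightarrow> int) \<Rightarrow> ('v \<Rightarrow> int) \<Rightarrow> bool" where
  "smaller_solvable m V E p q \<longleftrightarrow> (\<forall>V' (E' :: 'e set) ends' h' p' q' X'. instance_ok m V' E' ends' h' p' q' X' \<longrightarrow>
     smaller V' E' p' q' V E p q \<longrightarrow> solvable m V' E' ends' h')"

lemma smaller_solvableD: "smaller_solvable m V E p q \<Longrightarrow> instance_ok m V' E' ends' h' p' q' X' \<Longrightarrow>
    smaller V' E' p' q' V E p q \<Longrightarrow> solvable m V' E' ends' h'"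
  unfolding smaller_solvable_def by blast

lemma smaller_remove: "finite E \<Longrightarrow> e \<in> E \<Longrightarrow> smaller V (E - {e}) p' q' V E p q"
  using card_Diff1_less[of E e] by (simp add: smaller_def del: card_Diff_insert)

lemma smaller_solvable_mirror: "smaller_solvable m V E p q \<Longrightarrow> smaller_solvable m V E q p"
  by (simp add: smaller_solvable_def smaller_def add.commute)

lemma slack_mirror:
  assumes m: "2 \<le> m" and s: "slack m V E ends h p q"
  shows "slack m V E ends (\<lambda>v. - h v) q p"
proof -
  have "boundary (\<lambda>v. - h v) q p = (\<lambda>v. - boundary h p q v)" by (auto simp: boundary_def)
  moreover have "full_cut E ends q p A = full_cut E ends p q A" for A by (simp add: full_cut_def)
  ultimately show ?thesis using s by (simp add: slack_def sum_negf cdist_minus[OF m])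
qed

lemma sum_boundary_V:
  assumes m: "2 \<le> m" and I: "instance_ok m V E ends h p q X"
  shows "cdist m (sum (boundary h p q) V) = cdist m (sum p V - sum q V)"
proof -
  have "cdist m (sum (boundary h p q) V) = cdist m (- (sum p V - sum q V))"
    using instance_okD(4)[OF I] by (intro cdist_cong[OF m]) (simp add: sum_boundary)
  then show ?thesis by (simp only: cdist_minus[OF m])
qed

lemma full_cut_complement:
  assumes I: "instance_ok m V E ends h p q X" and A: "A \<subseteq> V"
  shows "full_cut E ends p q A + full_cut E ends p q (V - A) = 2 * cutsize E ends A + sum p V + sum q V"
proof -
  have g: "graph V E ends" using I by (rule instance_ok_graph)
  then have "finite V" by (simp add: graph_def)
  then show ?thesis using A cutsize_complement[OF g A]
    by (simp add: full_cut_def sum_diff finite_subset)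
qed

text \<open>Modulo 2m the set \<open>V - {x}\<close> has the same boundary as \<open>V\<close>.
  Without real edges across, its cut condition demands as many virtual edges as the total bound
  allows, and none is left for \<open>x\<close>.\<close>

lemma exempt_no_virtual:
  assumes m: "2 \<le> m" and I: "instance_ok m V E ends h p q X"
    and X: "X \<subseteq> {x}" "x \<in> V" "2 * m dvd boundary h p q x" and V: "V \<noteq> {x}" and c: "cutsize E ends {x} = 0"
  shows "p x = 0 \<and> q x = 0"
proof -
  have fin: "finite V" using instance_ok_graph[OF I] by (simp add: graph_def)
  have "2 * m - 2 + cdist m (sum (boundary h p q) (V - {x})) \<le> full_cut E ends p q (V - {x})"
    using X V by (intro instance_ok_cut[OF I]) auto
  moreover have "cdist m (sum (boundary h p q) (V - {x})) = cdist m (sum (boundary h p q) V)"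
    using X fin by (intro cdist_cong[OF m]) (simp add: sum_diff1)
  moreover have "full_cut E ends p q {x} + full_cut E ends p q (V - {x}) = sum p V + sum q V"
    using full_cut_complement[OF I, of "{x}"] X c by simp
  moreover have "full_cut E ends p q {x} = p x + q x" using c by (simp add: full_cut_def)
  moreover have "sum p V + sum q V \<le> 2 * m - 2 + cdist m (sum p V - sum q V)"
    "0 \<le> p x" "0 \<le> q x" using instance_okD(3,6)[OF I] X(2) by simp_all
  ultimately show ?thesis using sum_boundary_V[OF m I] by linarith
qed

text \<open>Since \<open>X\<close> is contained in \<open>{x}\<close>, exempting \<open>x\<close>
  creates no second exempt vertex. Lifting applies if \<open>x\<close> has two neighbours, or one
  neighbour and a virtual edge. Otherwise \<open>x\<close> has no virtual edge and at most one
  neighbour, which is the situation of \<open>pendant\<close>.\<close>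

lemma exempt_step:
  assumes m: "2 \<le> m" and I: "instance_ok m V E ends h p q X" and sl: "slack m V E ends h p q"
    and X: "X \<subseteq> {x}" "x \<in> V" "2 * m dvd boundary h p q x" and V: "V \<noteq> {x}"
    and H: "smaller_solvable m V E p q"
  shows "solvable m V E ends h"
proof -
  have g: "graph V E ends" using I by (rule instance_ok_graph)
  have fin: "finite E" "finite V" using g by (auto simp: graph_def)
  define nbr where "nbr e u \<longleftrightarrow> e \<in> E \<and> u \<noteq> x \<and> (ends e = (x, u) \<or> ends e = (u, x))" for e u
  have nbr_ex: "\<exists>u. nbr e u" if "e \<in> E" "(fst (ends e) = x) \<noteq> (snd (ends e) = x)" for e
    using that unfolding nbr_def by (metis prod.collapse)
  consider (lift) e e' u w where "nbr e u" "nbr e' w" "u \<noteq> w"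
    | (vp) e u where "nbr e u" "p x > 0" | (vq) e u where "nbr e u" "q x > 0"
    | (one) e u where "nbr e u" "\<forall>e' w. nbr e' w \<longrightarrow> w = u" "p x \<le> 0" "q x \<le> 0"
    | (none) "\<forall>e u. \<not> nbr e u"
    by (metis linorder_not_less)
  then show ?thesis
  proof cases
    case lift
    then have *: "e \<in> E" "e' \<in> E" "e \<noteq> e'" "u \<noteq> x" "w \<noteq> x" "u \<noteq> w"
      "ends e = (x, u) \<or> ends e = (u, x)" "ends e' = (x, w) \<or> ends e' = (w, x)"
      by (auto simp: nbr_def)
    have "solvable m V (E - {e'}) (ends(e := (u, w))) h"
      using smaller_solvableD[OF H instance_ok_lift[OF I sl X *]] smaller_remove[OF fin(1) *(2)] by blast
    then show ?thesis using solvable_lift[OF fin(1) *(1-3) _ _ *(7,8)] *(4,5) by metis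
  next
    case vp
    then have *: "e \<in> E" "u \<noteq> x" "ends e = (x, u) \<or> ends e = (u, x)" by (auto simp: nbr_def)
    have "solvable m V (E - {e}) ends (boundary_del x u h)"
      using smaller_solvableD[OF H instance_ok_lift_virtual[OF m I sl X vp(2) *]] smaller_remove[OF fin(1) *(1)] by blast
    then show ?thesis using solvable_delete[of E e ends x u m V h] fin * by metis
  next
    case vq
    then have *: "e \<in> E" "u \<noteq> x" "ends e = (x, u) \<or> ends e = (u, x)" by (auto simp: nbr_def)
    have X3: "2 * m dvd boundary (\<lambda>v. - h v) q p x"
    proof -
      have "boundary (\<lambda>v. - h v) q p x = - boundary h p q x" by (simp add: boundary_def)
      then show ?thesis using X(3) by simp
    qed
    have "solvable m V (E - {e}) ends (boundary_del x u (\<lambda>v. - h v))"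
      using smaller_solvableD[OF smaller_solvable_mirror[OF H] instance_ok_lift_virtual[OF m instance_ok_mirror[OF m I] slack_mirror[OF m sl] X(1,2) X3 vq(2) *]]
        smaller_remove[OF fin(1) *(1)] by blast
    then have "solvable m V E ends (\<lambda>v. - h v)"
      using solvable_delete[of E e ends x u m V "\<lambda>v. - h v"] fin * by metis
    then show ?thesis by (rule solvable_mirror)
  next
    case one
    have u: "u \<in> V" "u \<noteq> x" using one(1) g by (auto simp: nbr_def graph_def)
    have "0 \<le> p x" "0 \<le> q x" using instance_okD(3)[OF I] X(2) by simp_all
    then have "p x = 0" "q x = 0" using one(3,4) by simp_all
    note P = pendant[OF I X this u]
    have 1: "fst (ends e) = x \<Longrightarrow> snd (ends e) = x \<or> snd (ends e) = u" if "e \<in> E" for e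
      using nbr_ex[OF that] one(2) unfolding nbr_def by (metis fst_conv snd_conv)
    have 2: "snd (ends e) = x \<Longrightarrow> fst (ends e) = x \<or> fst (ends e) = u" if "e \<in> E" for e
      using nbr_ex[OF that] one(2) unfolding nbr_def by (metis fst_conv snd_conv)
    have "smaller (V - {x}) (edges_off E ends x) p q V E p q"
      using card_Diff1_less[OF fin(2) X(2)] by (simp add: smaller_def)
    then show ?thesis using P(2)[OF 1 2 smaller_solvableD[OF H P(1)[OF 1 2]]] by blast
  next
    case none
    \<comment> \<open>With no edge leaving \<open>x\<close>, any other vertex can play the single
      neighbour.\<close>
    obtain u where u: "u \<in> V" "u \<noteq> x" using V X(2) by blast
    have nb: "(fst (ends e) = x) = (snd (ends e) = x)" if "e \<in> E" for e
      using nbr_ex[OF that] none by blast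
    then have "cutsize E ends {x} = 0"
      unfolding cutsize_eq_sum[OF fin(1)] by (intro sum.neutral) (auto simp: crossing_def)
    then have "p x = 0" "q x = 0" using exempt_no_virtual[OF m I X V] by auto
    note P = pendant[OF I X this u]
    have "smaller (V - {x}) (edges_off E ends x) p q V E p q"
      using card_Diff1_less[OF fin(2) X(2)] by (simp add: smaller_def)
    then show ?thesis using P(2)[OF _ _ smaller_solvableD[OF H P(1)]] nb by blast
  qed
qed

text \<open>Orienting an edge from a positive to a negative vertex moves both boundaries towards
  multiples of 2m, so at each end the lost cut edge is matched by a smaller distance. Larger sets
  separating the ends pay with their slack. The \<open>c\<close> virtual edges from
  \<open>y\<close>, added to make \<open>y\<close> negative, enlarge cuts around \<open>y\<close> by
  \<open>c\<close> and distances by no more.\<close>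

lemma instance_ok_delete_pos:
  assumes m: "2 \<le> m" and I: "instance_ok m V E ends h p q {}" and sl: "slack m V E ends h p q"
    and e: "e \<in> E" "ends e = (x, y) \<or> ends e = (y, x)" "x \<noteq> y"
    and x: "pos_residue m (boundary h p q x)" and y: "0 \<le> c" "pos_residue m (- (boundary h p q y + c))"
    and C2: "sum p V + sum q V + c \<le> 2 * m - 2 + cdist m (sum p V - sum q V - c)"
  shows "instance_ok m V (E - {e}) ends (boundary_del x y h) p (\<lambda>v. q v + c * of_bool (v = y)) {}"
proof (rule instance_ok_delete[OF m I e])
  let ?q = "\<lambda>v. q v + c * of_bool (v = y)"
  have g: "graph V E ends" using I by (rule instance_ok_graph)
  have fin: "finite V" using g by (simp add: graph_def)
  have xy: "x \<in> V" "y \<in> V" using g e by (auto simp: graph_def)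
  have sq: "sum ?q A = sum q A + c * of_bool (y \<in> A)" if "A \<subseteq> V" for A
    using finite_subset[OF that fin] by (simp add: sum.distrib sum_of_bool_single)
  show "\<forall>v\<in>V. 0 \<le> p v \<and> 0 \<le> ?q v" using instance_okD(3)[OF I] y(1) by simp
  show "sum p V + sum ?q V \<le> 2 * m - 2 + cdist m (sum p V - sum ?q V)"
    using C2 xy by (simp add: sq algebra_simps)
  show "{} = {} \<or> (\<exists>z\<in>V. {} = {z} \<and> 2 * m dvd boundary (boundary_del x y h) p ?q z)" by simp
  fix A assume A: "A \<subseteq> V" "A \<noteq> {}" "A \<noteq> V" "A \<noteq> {}"
  let ?b = "sum (boundary h p q) A"
  have c0: "2 * m - 2 + cdist m ?b \<le> full_cut E ends p q A" using instance_ok_cut[OF I] A by blast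
  have "2 * m - 2 + cdist m (?b - of_bool (x \<in> A) + of_bool (y \<in> A) + c * of_bool (y \<in> A))
    \<le> full_cut E ends p q A - of_bool ((x \<in> A) \<noteq> (y \<in> A)) + c * of_bool (y \<in> A)"
  proof (cases "(x \<in> A) = (y \<in> A)")
    case True
    then show ?thesis using c0 cdist_add_le[OF m, of ?b c] y(1) by (cases "x \<in> A") auto
  next
    case False
    show ?thesis
    proof (cases "\<exists>a b. a \<in> A \<and> b \<in> A \<and> a \<noteq> b")
      case True
      then have "2 * m + cdist m ?b \<le> full_cut E ends p q A" using slackD[OF sl A(1,3)] by blast
      then show ?thesis using False cdist_add_le[OF m, of ?b "c + 1"] cdist_add_le[OF m, of ?b "-1"] y(1)
        by (cases "x \<in> A") (auto simp: add_ac)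
    next
      case single: False
      show ?thesis
      proof (cases "x \<in> A")
        case True
        then have "A = {x}" using single by blast
        then show ?thesis using c0 pos_cdist_minus1[OF m x] e(3) by simp
      next
        case x0: False
        then have "A = {y}" using single False by blast
        moreover have "- (boundary h p q y + c) - 1 = - (boundary h p q y + c + 1)" by simp
        then have "cdist m (boundary h p q y + c + 1) = cdist m (boundary h p q y + c) - 1"
          using pos_cdist_minus1[OF m y(2)] by (simp only: cdist_minus[OF m])
        ultimately show ?thesis using c0 e(3) cdist_add_le[OF m, of "boundary h p q y" c] y(1)
          by (simp add: add_ac)
      qed
    qed
  qed
  then show "2 * m - 2 + cdist m (?b - of_bool (x \<in> A) + of_bool (y \<in> A)
           - (sum p A - sum p A) + (sum ?q A - sum q A))
       \<le> full_cut E ends p q A - of_bool ((x \<in> A) \<noteq> (y \<in> A)) + (sum p A - sum p A) + (sum ?q A - sum q A)"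
    by (simp add: sq[OF A(1)])
qed

text \<open>Virtual edges enter the conditions but not \<open>solvable\<close>, so one may be
  discarded. At a positive vertex the boundary moves down with the cut, and the distance drops by
  the same 1.\<close>

lemma instance_ok_drop_virtual:
  assumes m: "2 \<le> m" and I: "instance_ok m V E ends h p q {}" and sl: "slack m V E ends h p q"
    and v: "v \<in> V" "q v > 0" "pos_residue m (boundary h p q v)"
  shows "instance_ok m V E ends h p (\<lambda>w. q w - of_bool (w = v)) {}"
proof -
  let ?q = "\<lambda>w. q w - of_bool (w = v)"
  have fin: "finite V" using instance_ok_graph[OF I] by (simp add: graph_def)
  have sq: "sum ?q A = sum q A - of_bool (v \<in> A)" if "A \<subseteq> V" for A
    using finite_subset[OF that fin] by (simp add: sum_subtractf sum_of_bool_single)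
  have C2: "sum p V + sum ?q V \<le> 2 * m - 2 + cdist m (sum p V - sum ?q V)"
  proof -
    have "cdist m (sum p V - sum q V) \<le> cdist m (sum p V - sum q V + 1) + 1"
      using cdist_add_le[OF m, of "sum p V - sum q V + 1" "-1"] by simp
    moreover have "sum p V + sum q V \<le> 2 * m - 2 + cdist m (sum p V - sum q V)"
      by (rule instance_okD(6)[OF I])
    ultimately show ?thesis using v by (simp add: sq algebra_simps)
  qed
  have C3: "2 * m - 2 + cdist m (sum (boundary h p ?q) A) \<le> full_cut E ends p ?q A"
    if A: "A \<subseteq> V" "A \<noteq> {}" "A \<noteq> V" for A
  proof -
    let ?b = "sum (boundary h p q) A"
    have c0: "2 * m - 2 + cdist m ?b \<le> full_cut E ends p q A" using instance_ok_cut[OF I] A by blast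
    have "2 * m - 2 + cdist m (?b - of_bool (v \<in> A)) \<le> full_cut E ends p q A - of_bool (v \<in> A)"
    proof (cases "v \<in> A \<and> A \<noteq> {v}")
      case True
      then obtain b where "b \<in> A" "b \<noteq> v" by blast
      then have "2 * m + cdist m ?b \<le> full_cut E ends p q A" using slackD[OF sl A(1,3)] True by blast
      then show ?thesis using True cdist_add_le[OF m, of ?b "-1"] by simp
    next
      case False
      then show ?thesis using c0 pos_cdist_minus1[OF m v(3)] by auto
    qed
    moreover have "sum (boundary h p ?q) A = ?b - of_bool (v \<in> A)" "full_cut E ends p ?q A = full_cut E ends p q A - of_bool (v \<in> A)"
      unfolding sum_boundary full_cut_def sq[OF A(1)] by simp_all
    ultimately show ?thesis by simp
  qed
  have nn: "\<forall>w\<in>V. 0 \<le> p w \<and> 0 \<le> ?q w" using instance_okD(3)[OF I] v(2) by simp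
  show ?thesis by (rule instance_okI[OF instance_okD(1,2)[OF I] nn instance_okD(4,5)[OF I] C2 _ C3]) simp_all
qed

text \<open>Add the cut conditions of \<open>A\<close> and of its complement. The bound on all
  virtual edges is absorbed by the triangle inequality, which leaves at least 2m - 2 for twice the
  number of real edges across.\<close>

lemma instance_ok_crossing:
  assumes m: "2 \<le> m" and I: "instance_ok m V E ends h p q {}" and A: "A \<subseteq> V" "A \<noteq> {}" "A \<noteq> V"
  obtains e x y where "e \<in> E" "ends e = (x, y) \<or> ends e = (y, x)" "x \<in> A" "y \<in> V - A"
proof -
  have g: "graph V E ends" using I by (rule instance_ok_graph)
  have fin: "finite V" using g by (simp add: graph_def)
  have "2 * m - 2 + cdist m (sum (boundary h p q) A) \<le> full_cut E ends p q A"
    "2 * m - 2 + cdist m (sum (boundary h p q) (V - A)) \<le> full_cut E ends p q (V - A)"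
    using A by (auto intro!: instance_ok_cut[OF I])
  moreover have "sum (boundary h p q) V = sum (boundary h p q) A + sum (boundary h p q) (V - A)"
    using A fin by (metis add.commute sum.subset_diff)
  then have "cdist m (sum p V - sum q V) \<le> cdist m (sum (boundary h p q) A) + cdist m (sum (boundary h p q) (V - A))"
    using cdist_triangle[OF m] sum_boundary_V[OF m I] by metis
  moreover have "sum p V + sum q V \<le> 2 * m - 2 + cdist m (sum p V - sum q V)"
    by (rule instance_okD(6)[OF I])
  ultimately have "cutsize E ends A \<noteq> 0" using full_cut_complement[OF I A(1)] m by linarith
  then have "edge_cut E ends A \<noteq> {}" by (auto simp: cutsize_def)
  then obtain e where "e \<in> E" "(fst (ends e) \<in> A) \<noteq> (snd (ends e) \<in> A)"
    by (auto simp: edge_cut_def)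
  then show ?thesis
    using that[of e "fst (ends e)" "snd (ends e)"] that[of e "snd (ends e)" "fst (ends e)"] g
    by (cases "fst (ends e) \<in> A") (auto simp: graph_def)
qed

text \<open>To \<open>a\<close> virtual edges in one direction, \<open>c\<close> in the other are
  added. The bound on \<open>a\<close> amounts to at most 2m - 1, and each of the three ranges of
  \<open>a - c\<close> rests on this or on \<open>c \<le> m - 1\<close>.\<close>

lemma virtual_bound:
  fixes a c m :: int
  assumes m: "2 \<le> m" and a: "0 \<le> a" "a \<le> 2 * m - 2 + cdist m a" and c: "0 \<le> c" "c \<le> m - 1"
  shows "a + c \<le> 2 * m - 2 + cdist m (a - c)"
proof -
  have a2: "a \<le> 2 * m - 1" using a cdist_le[OF m, of a 1] by simp
  have "cdist m (a - c) = (if a < c then c - a else if a - c \<le> m then a - c else 2 * m - (a - c))"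
    using a a2 c cdist_less_m[OF m, of "a - c"] cdist_ge_m[OF m, of "a - c"]
      cdist_less_m[OF m, of "c - a"] cdist_minus[OF m, of "a - c"] by auto
  then show ?thesis using a a2 c by auto
qed

text \<open>Dropping virtual edges towards the special vertex leaves only those from it, so that
  \<open>virtual_bound\<close> applies. New edges from \<open>y\<close> to the special vertex then
  raise the boundary of \<open>y\<close> to m, where it counts as negative, while its neighbour
  \<open>x\<close> stays positive.\<close>

lemma all_pos_step:
  assumes m: "2 \<le> m" and I: "instance_ok m V E ends h p q {}" and sl: "slack m V E ends h p q"
    and P: "\<forall>v\<in>V. pos_residue m (boundary h p q v)" and V: "u \<in> V" "V \<noteq> {u}"
    and H: "smaller_solvable m V E p q"
  shows "solvable m V E ends h"
proof -
  have g: "graph V E ends" using I by (rule instance_ok_graph)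
  have fin: "finite E" "finite V" using g by (auto simp: graph_def)
  show ?thesis
  proof (cases "\<exists>v\<in>V. q v > 0")
    case True
    then obtain v where v: "v \<in> V" "q v > 0" by blast
    have "smaller V E p (\<lambda>w. q w - of_bool (w = v)) V E p q"
      using v fin by (simp add: smaller_def sum_subtractf sum_of_bool_single)
    then show ?thesis using smaller_solvableD[OF H instance_ok_drop_virtual[OF m I sl v]] P v by blast
  next
    case False
    then have q0: "q v = 0" if "v \<in> V" for v using instance_okD(3)[OF I] that by force
    obtain e x y where e: "e \<in> E" "ends e = (x, y) \<or> ends e = (y, x)" "x \<in> {u}" "y \<in> V - {u}"
      using instance_ok_crossing[OF m I, of "{u}"] V by blast
    \<comment> \<open>The least number that lifts the residue of \<open>y\<close> to m. A positive
      residue is at least 1, hence \<open>c \<le> m - 1\<close>.\<close>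
    define c where "c = m - boundary h p q y mod (2 * m)"
    have py: "pos_residue m (boundary h p q y)" using P e by auto
    have c: "0 \<le> c" "c \<le> m - 1" using py by (auto simp: c_def pos_residue_def[OF m])
    have "(boundary h p q y + c) mod (2 * m) = m"
    proof -
      have "boundary h p q y + c = m + 2 * m * (boundary h p q y div (2 * m))"
        using minus_mod_eq_mult_div[of "boundary h p q y" "2 * m"] by (simp add: c_def)
      then show ?thesis using m by simp
    qed
    then have "(- (boundary h p q y + c)) mod (2 * m) = m"
      unfolding zmod_zminus1_eq_if using m by simp
    then have pc: "pos_residue m (- (boundary h p q y + c))" using m by (simp add: pos_residue_def[OF m])
    have "sum p V + sum q V \<le> 2 * m - 2 + cdist m (sum p V - sum q V)" "0 \<le> sum p V"
      using instance_okD(3,6)[OF I] by (simp_all add: sum_nonneg)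
    then have "sum p V + sum q V + c \<le> 2 * m - 2 + cdist m (sum p V - sum q V - c)"
      using virtual_bound[OF m _ _ c, of "sum p V"] q0 by simp
    moreover have "pos_residue m (boundary h p q x)" "x \<noteq> y" using P V e by auto
    ultimately have "solvable m V (E - {e}) ends (boundary_del x y h)"
      using smaller_solvableD[OF H instance_ok_delete_pos[OF m I sl e(1,2) _ _ c(1) pc]] smaller_remove[OF fin(1) e(1)] by blast
    then show ?thesis using solvable_delete[of E e ends x y m V h] fin e \<open>x \<noteq> y\<close> by metis
  qed
qed

lemma nonzero_step:
  assumes m: "2 \<le> m" and I: "instance_ok m V E ends h p q X" and sl: "slack m V E ends h p q"
    and nz: "\<forall>v\<in>V. \<not> 2 * m dvd boundary h p q v" and V: "u \<in> V" "V \<noteq> {u}"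
    and H: "smaller_solvable m V E p q"
  shows "solvable m V E ends h"
proof -
  have X: "X = {}" using instance_okD(7)[OF I] nz by blast
  note I = I[unfolded X]
  have g: "graph V E ends" using I by (rule instance_ok_graph)
  have fin: "finite E" "finite V" using g by (auto simp: graph_def)
  define P where "P = {v \<in> V. pos_residue m (boundary h p q v)}"
  have bdm: "boundary (\<lambda>v. - h v) q p v = - boundary h p q v" for v by (simp add: boundary_def)
  consider "P = V" | "P = {}" | "P \<noteq> V" "P \<noteq> {}" by blast
  then show ?thesis
  proof cases
    case 1
    then show ?thesis using all_pos_step[OF m I sl _ V H] by (auto simp: P_def)
  next
    case 2
    have "\<forall>v\<in>V. pos_residue m (boundary (\<lambda>v. - h v) q p v)"
      using 2 pos_or_neg[OF m] nz by (auto simp: P_def bdm)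
    then show ?thesis
      using all_pos_step[OF m instance_ok_mirror[OF m I] slack_mirror[OF m sl] _ V smaller_solvable_mirror[OF H]]
      by (blast intro: solvable_mirror)
  next
    case 3
    have "P \<subseteq> V" by (auto simp: P_def)
    then obtain e x y where e: "e \<in> E" "ends e = (x, y) \<or> ends e = (y, x)" "x \<in> P" "y \<in> V - P"
      using instance_ok_crossing[OF m I _ 3(2,1)] by blast
    have xy: "pos_residue m (boundary h p q x)" "pos_residue m (- (boundary h p q y + 0))" "x \<noteq> y"
      using e pos_or_neg[OF m] nz by (auto simp: P_def)
    have "instance_ok m V (E - {e}) ends (boundary_del x y h) p (\<lambda>v. q v + 0 * of_bool (v = y)) {}"
      using instance_okD(6)[OF I] by (intro instance_ok_delete_pos[OF m I sl e(1,2) xy(3,1) _ xy(2)]) simp_all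
    then have "solvable m V (E - {e}) ends (boundary_del x y h)"
      using smaller_solvableD[OF H] smaller_remove[OF fin(1) e(1)] by blast
    then show ?thesis using solvable_delete[of E e ends x y m V h] fin e xy by metis
  qed
qed

text \<open>The instance inside a tight set depends on the directions of the cut edges, so the
  contracted graph is solved before it.\<close>

lemma contract_step:
  assumes m: "2 \<le> m" and I: "instance_ok m V E ends h p q X" and nsl: "\<not> slack m V E ends h p q"
    and H: "smaller_solvable m V E p q"
  shows "solvable m V E ends h"
proof -
  have g: "graph V E ends" using I by (rule instance_ok_graph)
  have fin: "finite E" "finite V" using g by (auto simp: graph_def)
  obtain A r b where A: "A \<subseteq> V" "A \<noteq> V" "r \<in> A" "b \<in> A" "r \<noteq> b"
    and tight: "full_cut E ends p q A < 2 * m + cdist m (sum (boundary h p q) A)"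
    using nsl unfolding slack_def by (metis linorder_not_less)
  have "card (insert r (V - A)) < card V"
    using A fin by (intro psubset_card_mono) auto
  then obtain s where s: "\<forall>e\<in>E. s e = 1 \<or> s e = -1"
    "\<forall>v\<in>insert r (V - A). 2 * m dvd net E (map_prod (\<lambda>v. if v \<in> A then r else v) (\<lambda>v. if v \<in> A then r else v) \<circ> ends) s v - (if v = r then sum h A else h v)"
    using smaller_solvableD[OF H contract_outside(1)[OF I A(1,3-5)]] unfolding solvable_def smaller_def by blast
  have out: "\<forall>v\<in>V - A. 2 * m dvd net E ends s v - h v"
  proof
    fix v assume v: "v \<in> V - A"
    then show "2 * m dvd net E ends s v - h v"
      using s(2)[rule_format, of v] contract_outside(2)[OF I A(1,3-5), of v s] A by (auto split: if_splits)
  qed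
  \<comment> \<open>Net outflow sums to 0 over \<open>V\<close>, so the demands met outside
    \<open>A\<close> force the total demand on \<open>A\<close>.\<close>
  have "2 * m dvd (\<Sum>v\<in>A. net E ends s v - h v)"
  proof -
    have "(\<Sum>v\<in>V. net E ends s v - h v) = (\<Sum>v\<in>A. net E ends s v - h v) + (\<Sum>v\<in>V - A. net E ends s v - h v)"
      using A fin by (metis (no_types, lifting) add.commute sum.subset_diff)
    moreover have "2 * m dvd (\<Sum>v\<in>V. net E ends s v - h v)"
      using instance_okD(4)[OF I] sum_net_V[OF g] by (simp add: sum_subtractf)
    moreover have "2 * m dvd (\<Sum>v\<in>V - A. net E ends s v - h v)" using out by (blast intro: dvd_sum)
    ultimately show ?thesis by (simp only: dvd_add_left_iff)
  qed
  moreover have "A \<noteq> X" using instance_okD(7)[OF I] A(3-5) by blast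
  moreover have "smaller A F p' q' V E p q" for F p' q'
    using A fin by (simp add: smaller_def psubset_card_mono psubset_eq)
  ultimately have "solvable m A {e \<in> E. fst (ends e) \<in> A \<and> snd (ends e) \<in> A} ends
      (\<lambda>v. h v - net (edge_cut E ends A) ends s v)"
    using smaller_solvableD[OF H contract_inside[OF m I A(1,2) _ _ tight s(1)]] A(3) by blast
  then show ?thesis using contract_combine[OF g A(1,3) s(1) out] by blast
qed

lemma instance_ok_solvable:
  assumes m: "2 \<le> m"
  shows "instance_ok m V E ends h p q X \<Longrightarrow> solvable m V E ends h"
proof (induction "(V, E, p, q)" arbitrary: V E ends h p q X
    rule: wf_induct_rule[OF wf_measures[of "[\<lambda>(V, E, p, q). card V, \<lambda>(V, E, p, q). card E, \<lambda>(V, E, p, q). nat (sum p V + sum q V)]"]])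
  case (1 V E p q)
  note I = "1.prems"
  have g: "graph V E ends" using I by (rule instance_ok_graph)
  have H: "smaller_solvable m V E p q"
    unfolding smaller_solvable_def
  proof (intro allI impI)
    fix V' and E' :: "'b set" and ends' h' p' q' X'
    assume I': "instance_ok m V' E' ends' h' p' q' X'" and s: "smaller V' E' p' q' V E p q"
    have "0 \<le> sum p' V' + sum q' V'" using instance_okD(3)[OF I'] by (intro add_nonneg_nonneg sum_nonneg) simp_all
    then have "((V', E', p', q'), (V, E, p, q)) \<in> measures [\<lambda>(V, E, p, q). card V, \<lambda>(V, E, p, q). card E, \<lambda>(V, E, p, q). nat (sum p V + sum q V)]"
      using s by (auto simp: smaller_def)
    then show "solvable m V' E' ends' h'" using "1.hyps" I' by blast
  qed
  obtain u where u: "u \<in> V" using instance_okD(2)[OF I] by blast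
  show ?case
  proof (cases "V = {u}")
    case True
    \<comment> \<open>On a single vertex all edges are loops, and any signs will do.\<close>
    have "net E ends (\<lambda>_. 1) u = 0" using sum_net_V[OF g, of "\<lambda>_. 1"] True by simp
    moreover have "2 * m dvd h u" using instance_okD(4)[OF I] True by simp
    ultimately show ?thesis using True unfolding solvable_def by (intro exI[of _ "\<lambda>_. 1"]) simp
  next
    case V: False
    consider "\<not> slack m V E ends h p q"
      | "slack m V E ends h p q" "\<forall>v\<in>V. \<not> 2 * m dvd boundary h p q v"
      | x where "slack m V E ends h p q" "X \<subseteq> {x}" "x \<in> V" "2 * m dvd boundary h p q x"
      using instance_okD(7)[OF I] by blast
    then show ?thesis
    proof cases
      case 1 then show ?thesis using contract_step[OF m I _ H] by blast
    next
      case 2 then show ?thesis using nonzero_step[OF m I _ _ u V H] by blast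
    next
      case 3
      moreover have "V \<noteq> {x}" using u V by blast
      ultimately show ?thesis using exempt_step[OF m I _ _ _ _ _ H] by blast
    qed
  qed
qed

theorem modulo_orientation:
  assumes g: "graph V E ends" "V \<noteq> {}" and k: "1 \<le> k"
    and con: "\<And>A. A \<subseteq> V \<Longrightarrow> A \<noteq> {} \<Longrightarrow> A \<noteq> V \<Longrightarrow> 6 * k \<le> cutsize E ends A"
    and h: "2 * (2 * k + 1) dvd sum h V" "\<forall>v\<in>V. even (h v - deg E ends v)"
  shows "solvable (2 * k + 1) V E ends h"
proof -
  let ?m = "2 * k + 1"
  have m: "2 \<le> ?m" using k by simp
  have fin: "finite E" "finite V" using g by (auto simp: graph_def)
  have b: "boundary h (\<lambda>_. 0) (\<lambda>_. 0) = h" by (auto simp: boundary_def)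
  have "2 * ?m - 2 + cdist ?m (sum h A) \<le> cutsize E ends A" if A: "A \<subseteq> V" "A \<noteq> {}" "A \<noteq> V" for A
  proof -
    have c6: "6 * k \<le> cutsize E ends A" using con A .
    have le: "cdist ?m (sum h A) \<le> ?m"
      by (simp add: cdist_def min_le_iff_disj) linarith
    have e1: "even (\<Sum>v\<in>A. h v - deg E ends v)" using h(2) A by (intro dvd_sum) auto
    have e2: "even (sum (deg E ends) A - cutsize E ends A)"
      using even_sum_deg_cutsize fin(1) finite_subset[OF A(1) fin(2)] .
    have e3: "even (cdist ?m (sum h A) - sum h A)" by (rule even_cdist_diff[OF m])
    \<comment> \<open>A distance of 2k + 1 guarantees only 4k - 1 out of 6k, one short of 2m - 2 =
      4k. The difference is even, which supplies the missing unit.\<close>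
    have "cutsize E ends A - cdist ?m (sum h A) =
        - (\<Sum>v\<in>A. h v - deg E ends v) - (sum (deg E ends) A - cutsize E ends A) - (cdist ?m (sum h A) - sum h A)"
      by (simp add: sum_subtractf)
    also have "even \<dots>"
      by (rule dvd_diff[OF dvd_diff[OF _ e2] e3]) (simp only: dvd_minus_iff e1)
    finally have "even (cutsize E ends A - cdist ?m (sum h A))" .
    then obtain j where "cutsize E ends A - cdist ?m (sum h A) = 2 * j" by (rule evenE)
    moreover from this have "2 * k \<le> j" using c6 le by linarith
    ultimately show ?thesis by (simp add: algebra_simps)
  qed
  then have "instance_ok ?m V E ends h (\<lambda>_. 0) (\<lambda>_. 0) {}"
    using g h k by (intro instance_okI) (simp_all add: b full_cut_def cdist_def)
  then show ?thesis by (rule instance_ok_solvable[OF m])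
qed

section \<open>Two disjoint connected spanning subgraphs\<close>

definition adj :: "('e \<Rightarrow> 'v \<times> 'v) \<Rightarrow> 'e set \<Rightarrow> 'v \<Rightarrow> 'v \<Rightarrow> bool" where
  "adj ends F x y \<longleftrightarrow> (\<exists>e\<in>F. ends e = (x, y) \<or> ends e = (y, x))"

abbreviation conn :: "('e \<Rightarrow> 'v \<times> 'v) \<Rightarrow> 'e set \<Rightarrow> 'v \<Rightarrow> 'v \<Rightarrow> bool" where
  "conn ends F \<equiv> (adj ends F)\<^sup>*\<^sup>*"

lemma conn_sym: "conn ends F x y \<Longrightarrow> conn ends F y x"
  by (rule sympD[OF symp_rtranclp]) (auto simp: symp_def adj_def)

lemma conn_mono: "F \<subseteq> G \<Longrightarrow> conn ends F x y \<Longrightarrow> conn ends G x y"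
  using rtranclp_mono[of "adj ends F" "adj ends G"] by (auto simp: adj_def le_fun_def)

lemma conn_le:
  assumes "\<And>e. e \<in> F \<Longrightarrow> conn ends G (fst (ends e)) (snd (ends e))" "conn ends F x y"
  shows "conn ends G x y"
  using assms(2)
proof induction
  case (step y z)
  then obtain e where "e \<in> F" "ends e = (y, z) \<or> ends e = (z, y)" by (auto simp: adj_def)
  then have "conn ends G y z" using assms(1)[of e] conn_sym by fastforce
  with step.IH show ?case by simp
qed simp

text \<open>A connection that uses \<open>e\<close> can be shortened to cross it once, in one of two
  directions.\<close>

lemma conn_insert:
  assumes "conn ends (insert e F) x y" "ends e = (a, b)"
  shows "conn ends F x y \<or> conn ends F x a \<and> conn ends F b y \<or> conn ends F x b \<and> conn ends F a y"
  using assms(1)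
proof induction
  case (step y z)
  from step.hyps(2) consider "adj ends F y z" | "y = a" "z = b" | "y = b" "z = a"
    using assms(2) by (auto simp: adj_def)
  then show ?case
  proof cases
    case 1
    then show ?thesis using step.IH by (meson rtranclp.rtrancl_into_rtrancl)
  next
    case 2
    then show ?thesis using step.IH by (metis conn_sym rtranclp.rtrancl_refl rtranclp_trans)
  next
    case 3
    then show ?thesis using step.IH by (metis conn_sym rtranclp.rtrancl_refl rtranclp_trans)
  qed
qed simp

text \<open>Acyclicity in the form that every edge is a bridge; this avoids cycles and covers loops
  and parallel edges.\<close>

definition forest :: "('e \<Rightarrow> 'v \<times> 'v) \<Rightarrow> 'e set \<Rightarrow> bool" where
  "forest ends F \<longleftrightarrow> (\<forall>e\<in>F. \<not> conn ends (F - {e}) (fst (ends e)) (snd (ends e)))"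

lemma forest_subset: "forest ends G \<Longrightarrow> F \<subseteq> G \<Longrightarrow> forest ends F"
  unfolding forest_def by (meson Diff_mono conn_mono equalityE subset_iff)

lemma forest_insert:
  assumes F: "forest ends F" and e: "\<not> conn ends F (fst (ends e)) (snd (ends e))"
  shows "forest ends (insert e F)"
  unfolding forest_def
proof (intro ballI notI)
  fix f assume f: "f \<in> insert e F"
    and c: "conn ends (insert e F - {f}) (fst (ends f)) (snd (ends f))"
  show False
  proof (cases "f = e")
    case True
    then have "insert e F - {f} \<subseteq> F" by auto
    from conn_mono[OF this c] show False using e True by simp
  next
    case False
    let ?a = "fst (ends e)" and ?b = "snd (ends e)" and ?c = "fst (ends f)" and ?d = "snd (ends f)"
    have fF: "f \<in> F" using f False by simp
    have "insert e F - {f} = insert e (F - {f})" using False by auto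
    then have "conn ends (F - {f}) ?c ?d \<or> conn ends (F - {f}) ?c ?a \<and> conn ends (F - {f}) ?b ?d
        \<or> conn ends (F - {f}) ?c ?b \<and> conn ends (F - {f}) ?a ?d"
      using c conn_insert[of ends e "F - {f}" ?c ?d ?a ?b] by simp
    moreover have "\<not> conn ends (F - {f}) ?c ?d" using F fF by (simp add: forest_def)
    ultimately have "conn ends F ?c ?a \<and> conn ends F ?b ?d \<or> conn ends F ?c ?b \<and> conn ends F ?a ?d"
      using conn_mono[OF Diff_subset, of ends F "{f}"] by metis
    moreover have "conn ends F ?c ?d" using fF by (intro r_into_rtranclp) (auto simp: adj_def intro!: bexI[of _ f])
    ultimately show False using e by (metis conn_sym rtranclp_trans)
  qed
qed

text \<open>In a forest the edges separating \<open>x\<close> from \<open>y\<close> form the path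
  between them. A minimal connecting \<open>Q\<close> consists of such edges, since bypassing one of
  them in \<open>F\<close> would close a cycle.\<close>

lemma conn_bridges:
  assumes F: "forest ends F" "finite F" and c: "conn ends F x y"
  shows "conn ends {e \<in> F. \<not> conn ends (F - {e}) x y} x y"
proof -
  obtain Q where Q: "Q \<subseteq> F" "conn ends Q x y" "\<And>Q'. Q' \<subset> Q \<Longrightarrow> \<not> conn ends Q' x y"
  proof -
    define S where "S = {Q. Q \<subseteq> F \<and> conn ends Q x y}"
    have "finite S" "S \<noteq> {}" using F c by (auto simp: S_def)
    then obtain Q where Q: "Q \<in> S" "\<And>Q'. Q' \<in> S \<Longrightarrow> Q' \<subseteq> Q \<Longrightarrow> Q = Q'"
      using finite_has_minimal by meson
    show ?thesis
    proof (rule that[of Q])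
      show "Q \<subseteq> F" "conn ends Q x y" using Q(1) by (simp_all add: S_def)
      fix Q' assume "Q' \<subset> Q"
      then show "\<not> conn ends Q' x y" using Q by (simp add: S_def) blast
    qed
  qed
  have "Q \<subseteq> {e \<in> F. \<not> conn ends (F - {e}) x y}"
  proof
    fix e assume e: "e \<in> Q"
    have "\<not> conn ends (F - {e}) x y"
    proof
      assume 1: "conn ends (F - {e}) x y"
      let ?a = "fst (ends e)" and ?b = "snd (ends e)"
      have "insert e (Q - {e}) = Q" using e by auto
      then have "conn ends (Q - {e}) x ?a \<and> conn ends (Q - {e}) ?b y
          \<or> conn ends (Q - {e}) x ?b \<and> conn ends (Q - {e}) ?a y"
        using conn_insert[of ends e "Q - {e}" x y ?a ?b] Q(2) Q(3)[of "Q - {e}"] e by auto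
      then have "conn ends (F - {e}) x ?a \<and> conn ends (F - {e}) ?b y
          \<or> conn ends (F - {e}) x ?b \<and> conn ends (F - {e}) ?a y"
        using conn_mono[OF Diff_mono[OF Q(1) order_refl], of ends "{e}"] by metis
      then have "conn ends (F - {e}) ?a ?b" using 1 by (metis conn_sym rtranclp_trans)
      then show False using F(1) e Q(1) by (auto simp: forest_def)
    qed
    then show "e \<in> {e \<in> F. \<not> conn ends (F - {e}) x y}" using e Q by auto
  qed
  from conn_mono[OF this Q(2)] show ?thesis .
qed

definition conn_class :: "('e \<Rightarrow> 'v \<times> 'v) \<Rightarrow> 'v set \<Rightarrow> 'e set \<Rightarrow> 'v \<Rightarrow> 'v set" where
  "conn_class ends V F x = {y \<in> V. conn ends F x y}"

lemma conn_class_eq: "conn ends F x y \<Longrightarrow> conn_class ends V F x = conn_class ends V F y"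
  unfolding conn_class_def by (metis (no_types, lifting) conn_sym rtranclp_trans)

text \<open>Each class of \<open>G\<close> is a union of classes of \<open>F\<close>. The map
  \<open>up\<close> remains onto without the class of \<open>b\<close>, which is merged with that of
  \<open>a\<close>.\<close>

lemma card_conn_class_less:
  assumes V: "finite V" "a \<in> V" "b \<in> V" and G: "F \<subseteq> G" "conn ends G a b" "\<not> conn ends F a b"
  shows "card (conn_class ends V G ` V) < card (conn_class ends V F ` V)"
proof -
  define up where "up K = {y \<in> V. \<exists>x\<in>K. conn ends G x y}" for K
  have up: "up (conn_class ends V F x) = conn_class ends V G x" if "x \<in> V" for x
  proof -
    have "conn ends G x y" if "conn ends F x z" "conn ends G z y" for y z
      using that conn_mono[OF G(1)] by (metis rtranclp_trans)
    then show ?thesis using that rtranclp.rtrancl_refl[of "adj ends F" x]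
      unfolding up_def conn_class_def by fast
  qed
  let ?C = "conn_class ends V F ` V"
  have ne: "conn_class ends V F a \<noteq> conn_class ends V F b"
    using V G(3) by (auto simp: conn_class_def)
  have "conn_class ends V G ` V \<subseteq> up ` (?C - {conn_class ends V F b})"
  proof
    fix K assume "K \<in> conn_class ends V G ` V"
    then obtain x where x: "x \<in> V" "K = conn_class ends V G x" by blast
    show "K \<in> up ` (?C - {conn_class ends V F b})"
    proof (cases "conn_class ends V F x = conn_class ends V F b")
      case True
      then have "K = conn_class ends V G b" using up x V by metis
      then have "K = up (conn_class ends V F a)" using up V conn_class_eq[OF G(2)] by simp
      then show ?thesis using V ne by blast
    next
      case False
      then show ?thesis using up x by (intro image_eqI[of _ _ "conn_class ends V F x"]) auto
    qed
  qed
  then have "card (conn_class ends V G ` V) \<le> card (?C - {conn_class ends V F b})"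
    using V by (meson finite_Diff finite_imageI surj_card_le)
  also have "\<dots> < card ?C" using V by (intro card_Diff1_less) auto
  finally show ?thesis .
qed

text \<open>Each edge added to a forest merges two components. With the base \<open>C\<close> this
  bounds the number of forest edges between given classes.\<close>

lemma forest_card:
  assumes "finite V" "finite D" "\<And>e. e \<in> D \<Longrightarrow> fst (ends e) \<in> V \<and> snd (ends e) \<in> V"
    and "forest ends (C \<union> D)" "C \<inter> D = {}"
  shows "card D + card (conn_class ends V (C \<union> D) ` V) \<le> card (conn_class ends V C ` V)"
  using assms(2-)
proof (induction D)
  case (insert e D)
  have "card D + card (conn_class ends V (C \<union> D) ` V) \<le> card (conn_class ends V C ` V)"
    using insert.prems by (intro insert.IH) (auto elim: forest_subset)
  moreover have "card (conn_class ends V (C \<union> insert e D) ` V) < card (conn_class ends V (C \<union> D) ` V)"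
  proof (rule card_conn_class_less[OF assms(1)])
    have "C \<union> insert e D - {e} = C \<union> D" using insert by auto
    then show "\<not> conn ends (C \<union> D) (fst (ends e)) (snd (ends e))"
      using insert.prems(2) by (simp add: forest_def)
    show "conn ends (C \<union> insert e D) (fst (ends e)) (snd (ends e))"
      by (intro r_into_rtranclp) (auto simp: adj_def intro!: bexI[of _ e])
  qed (use insert.prems in auto)
  ultimately show ?case using insert.hyps by simp
qed simp

lemma conn_class_partition:
  assumes V: "finite V" "a \<in> V"
  shows "(\<Sum>K\<in>conn_class ends V F ` V. of_bool (a \<in> K)) = (1 :: int)"
proof -
  have "K = conn_class ends V F a" if K: "K \<in> conn_class ends V F ` V" "a \<in> K" for K
  proof -
    obtain x where x: "K = conn_class ends V F x" using K by blast
    then have "conn ends F x a" using K by (simp add: conn_class_def)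
    from conn_class_eq[OF this] show ?thesis using x by simp
  qed
  moreover have "a \<in> conn_class ends V F a" using V by (simp add: conn_class_def)
  ultimately have "(a \<in> K) = (K = conn_class ends V F a)" if "K \<in> conn_class ends V F ` V" for K
    using that by metis
  then have "(\<Sum>K\<in>conn_class ends V F ` V. of_bool (a \<in> K)) = (\<Sum>K\<in>conn_class ends V F ` V. (of_bool (K = conn_class ends V F a) :: int))"
    by (intro sum.cong) simp_all
  also have "\<dots> = 1" using V by (simp add: sum_of_bool_single)
  finally show ?thesis .
qed

section \<open>Exchanges in a pair of disjoint forests\<close>

definition forest_pair :: "'e set \<Rightarrow> ('e \<Rightarrow> 'v \<times> 'v) \<Rightarrow> (bool \<Rightarrow> 'e set) \<Rightarrow> bool" where
  "forest_pair E ends F \<longleftrightarrow> (\<forall>i. F i \<subseteq> E \<and> forest ends (F i)) \<and> F True \<inter> F False = {}"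

definition unused :: "'e set \<Rightarrow> (bool \<Rightarrow> 'e set) \<Rightarrow> 'e set" where
  "unused E F = E - (F True \<union> F False)"

text \<open>If \<open>e\<close> closes a cycle in \<open>F i\<close>, the condition says that
  \<open>e'\<close> lies on it, so the swap yields a forest of the same size.\<close>

definition exchange :: "'e set \<Rightarrow> ('e \<Rightarrow> 'v \<times> 'v) \<Rightarrow> (bool \<Rightarrow> 'e set) \<Rightarrow> (bool \<Rightarrow> 'e set) \<Rightarrow> bool" where
  "exchange E ends F F' \<longleftrightarrow> (\<exists>i. \<exists>e\<in>unused E F. \<exists>e'\<in>F i.
     \<not> conn ends (F i - {e'}) (fst (ends e)) (snd (ends e)) \<and> F' = F(i := insert e (F i - {e'})))"

definition pair_size :: "(bool \<Rightarrow> 'e set) \<Rightarrow> nat" where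
  "pair_size F = card (F True) + card (F False)"

lemma exchange_forest_pair:
  assumes "finite E" "forest_pair E ends F" "exchange E ends F F'"
  shows "forest_pair E ends F'" "pair_size F' = pair_size F"
proof -
  obtain i e e' where e: "e \<in> unused E F" "e' \<in> F i" "\<not> conn ends (F i - {e'}) (fst (ends e)) (snd (ends e))"
    "F' = F(i := insert e (F i - {e'}))" using assms(3) by (auto simp: exchange_def)
  have "forest ends (insert e (F i - {e'}))"
    using assms(2) e(3) by (intro forest_insert) (auto simp: forest_pair_def elim: forest_subset)
  then show "forest_pair E ends F'" using assms(2) e by (cases i) (auto simp: forest_pair_def unused_def)
  have "finite (F j)" for j using assms(1,2) by (auto simp: forest_pair_def intro: finite_subset)
  then have "card (insert e (F i - {e'})) = card (F i)"
    using e(1,2) by (cases i) (auto simp: unused_def card_insert_if card_Suc_Diff1 simp del: card_Diff_insert)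
  then show "pair_size F' = pair_size F" using e(4) by (cases i) (auto simp: pair_size_def)
qed

theorem two_connected_subgraphs:
  assumes g: "graph V E ends" "V \<noteq> {}"
    and con: "\<And>A. A \<subseteq> V \<Longrightarrow> A \<noteq> {} \<Longrightarrow> A \<noteq> V \<Longrightarrow> 4 \<le> cutsize E ends A"
  shows "\<exists>T T'. T \<subseteq> E \<and> T' \<subseteq> E \<and> T \<inter> T' = {} \<and>
    (\<forall>x\<in>V. \<forall>y\<in>V. conn ends T x y \<and> conn ends T' x y)"
proof -
  have fin: "finite E" "finite V" using g by (auto simp: graph_def)
  let ?S = "{n. \<exists>F. forest_pair E ends F \<and> pair_size F = n}"
  have "forest_pair E ends (\<lambda>_. {})" by (simp add: forest_pair_def forest_def)
  then have S: "?S \<noteq> {}" by blast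
  have "?S \<subseteq> {..2 * card E}"
  proof
    fix n assume "n \<in> ?S"
    then obtain F where "forest_pair E ends F" "pair_size F = n" by blast
    then have F: "F i \<subseteq> E" "pair_size F = n" for i by (auto simp: forest_pair_def)
    have "card (F i) \<le> card E" for i using F fin by (simp add: card_mono)
    from this[of True] this[of False] show "n \<in> {..2 * card E}" using F by (simp add: pair_size_def)
  qed
  then have finS: "finite ?S" by (rule finite_subset) simp
  obtain F0 where F0: "forest_pair E ends F0" "pair_size F0 = Max ?S"
    using Max_in[OF finS S] by blast
  have mx: "pair_size F \<le> pair_size F0" if "forest_pair E ends F" for F
    using Max_ge[OF finS, of "pair_size F"] that F0 by auto
  let ?R = "(exchange E ends)\<^sup>*\<^sup>*"
  have R: "forest_pair E ends F \<and> pair_size F = pair_size F0" if "?R F0 F" for F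
    using that
  proof induction
    case (step F F')
    then show ?case using exchange_forest_pair[OF fin(1) _ step.hyps(2)] by simp
  qed (simp add: F0(1))
  have ends_conn: "conn ends (F i) (fst (ends e)) (snd (ends e))" if "?R F0 F" "e \<in> unused E F" for F e i
  proof (rule ccontr)
    assume n: "\<not> ?thesis"
    have F: "forest_pair E ends F" "pair_size F = pair_size F0" using R[OF that(1)] by simp_all
    then have "forest ends (insert e (F i))" using n by (intro forest_insert) (auto simp: forest_pair_def)
    then have "forest_pair E ends (F(i := insert e (F i)))"
      using F that(2) by (cases i) (auto simp: forest_pair_def unused_def)
    from mx[OF this] have "pair_size (F(i := insert e (F i))) \<le> pair_size F" using F by simp
    moreover have "finite (F j)" for j using F fin by (auto simp: forest_pair_def intro: finite_subset)
    ultimately show False using that(2) by (cases i) (auto simp: pair_size_def unused_def)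
  qed
  define C where "C = (\<Union>F\<in>{F. ?R F0 F}. unused E F)"
  have conn_C: "conn ends (F i \<inter> C) (fst (ends e)) (snd (ends e))" if F: "?R F0 F" and e: "e \<in> unused E F" for F e i
  proof -
    let ?P = "{e' \<in> F i. \<not> conn ends (F i - {e'}) (fst (ends e)) (snd (ends e))}"
    have "forest_pair E ends F" using R[OF F] by simp
    then have c: "conn ends ?P (fst (ends e)) (snd (ends e))"
      using fin by (intro conn_bridges ends_conn[OF F e]) (auto simp: forest_pair_def dest: finite_subset)
    have "?P \<subseteq> F i \<inter> C"
    proof
      fix e' assume e': "e' \<in> ?P"
      let ?F' = "F(i := insert e (F i - {e'}))"
      have "exchange E ends F ?F'" unfolding exchange_def using e e' by blast
      then have "?R F0 ?F'" using F by simp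
      moreover have "e' \<in> unused E ?F'"
        using e' e \<open>forest_pair E ends F\<close> by (cases i) (auto simp: unused_def forest_pair_def)
      ultimately show "e' \<in> F i \<inter> C" using e' by (auto simp: C_def)
    qed
    from conn_mono[OF this c] show ?thesis .
  qed
  \<comment> \<open>The edge brought in by an exchange has ends that were already connected inside
    \<open>C\<close>, so connections can be traced back to \<open>F0\<close>.\<close>
  have down: "conn ends (F0 i \<inter> C) x y" if "?R F0 F" "conn ends (F i \<inter> C) x y" for F i x y
    using that
  proof (induction arbitrary: x y)
    case (step F F')
    obtain j e e' where e: "e \<in> unused E F" "F' = F(j := insert e (F j - {e'}))"
      using step.hyps(2) unfolding exchange_def by blast
    have "conn ends (F i \<inter> C) (fst (ends f)) (snd (ends f))" if f: "f \<in> F' i \<inter> C" for f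
    proof (cases "f \<in> F i")
      case True
      then show ?thesis using f by (intro r_into_rtranclp) (auto simp: adj_def intro!: bexI[of _ f])
    next
      case False
      then have "f = e" using f e by (auto split: if_splits)
      then show ?thesis using conn_C[OF step.hyps(1) e(1)] by simp
    qed
    then have "conn ends (F i \<inter> C) x y" by (rule conn_le[OF _ step.prems])
    then show ?case by (rule step.IH)
  qed
  have C_le: "conn ends (F0 i \<inter> C) x y" if "conn ends C x y" for i x y
  proof (rule conn_le[OF _ that])
    fix e assume "e \<in> C"
    then obtain F where "?R F0 F" "e \<in> unused E F" by (auto simp: C_def)
    then show "conn ends (F0 i \<inter> C) (fst (ends e)) (snd (ends e))"
      by (intro down[of F] conn_C)
  qed
  have "conn ends (F0 i \<inter> C) x y \<longleftrightarrow> conn ends C x y" for i x y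
    using C_le conn_mono[OF Int_lower2] by metis
  then have conn_class_C: "conn_class ends V (F0 i \<inter> C) = conn_class ends V C" for i
    by (intro ext) (simp add: conn_class_def)
  let ?K = "conn_class ends V C ` V"
  define D where "D = {e \<in> E. \<not> conn ends C (fst (ends e)) (snd (ends e))}"
  have DC: "D \<inter> C = {}"
  proof -
    have "conn ends C (fst (ends e)) (snd (ends e))" if "e \<in> C" for e
      using that by (intro r_into_rtranclp) (auto simp: adj_def intro!: bexI[of _ e])
    then show ?thesis by (auto simp: D_def)
  qed
  have "unused E F0 \<subseteq> C" by (auto simp: C_def)
  then have DF: "D \<subseteq> F0 True \<union> F0 False" using DC by (auto simp: D_def unused_def)
  have finD: "finite D" using fin by (simp add: D_def)
  have D_card: "card (D \<inter> F0 i) + 1 \<le> card ?K" for i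
  proof -
    have "card (D \<inter> F0 i) + card (conn_class ends V ((F0 i \<inter> C) \<union> (D \<inter> F0 i)) ` V) \<le> card (conn_class ends V (F0 i \<inter> C) ` V)"
    proof (rule forest_card[OF fin(2)])
      show "forest ends (F0 i \<inter> C \<union> D \<inter> F0 i)"
        using F0(1) by (auto simp: forest_pair_def elim: forest_subset)
      show "F0 i \<inter> C \<inter> (D \<inter> F0 i) = {}" using DC by blast
    qed (use g finD in \<open>auto simp: D_def graph_def\<close>)
    moreover have "card (conn_class ends V ((F0 i \<inter> C) \<union> (D \<inter> F0 i)) ` V) \<ge> 1"
      using fin g(2) by (simp add: Suc_le_eq card_gt_0_iff)
    ultimately show ?thesis by (simp add: conn_class_C)
  qed
  have "card D \<le> card (D \<inter> F0 True) + card (D \<inter> F0 False)"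
    using DF card_Un_le[of "D \<inter> F0 True" "D \<inter> F0 False"] by (metis Int_Un_distrib inf.absorb1)
  then have D_le: "card D + 2 \<le> 2 * card ?K" using D_card[of True] D_card[of False] by linarith
  have "card ?K = 1"
  proof (rule ccontr)
    assume "card ?K \<noteq> 1"
    have K: "4 \<le> cutsize E ends K" if K: "K \<in> ?K" for K
    proof (rule con)
      obtain x where x: "x \<in> V" "K = conn_class ends V C x" using K by blast
      then show "K \<subseteq> V" by (simp add: conn_class_def)
      have "x \<in> K" using x by (simp add: conn_class_def)
      then show "K \<noteq> {}" by blast
      show "K \<noteq> V"
      proof
        assume KV: "K = V"
        have "conn_class ends V C y = K" if y: "y \<in> V" for y
        proof -
          have "y \<in> conn_class ends V C x" using y KV x by simp
          then have "conn ends C x y" by (simp add: conn_class_def)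
          from conn_class_eq[OF this] show ?thesis using x by simp
        qed
        then have "?K = (\<lambda>_. K) ` V" by (intro image_cong) simp_all
        then have "?K = {K}" unfolding image_constant[OF x(1)] .
        then show False using \<open>card ?K \<noteq> 1\<close> by simp
      qed
    qed
    \<comment> \<open>Double counting: an edge between classes lies in the cuts of two of them, any
      other edge in none.\<close>
    have "4 * int (card ?K) \<le> (\<Sum>K\<in>?K. cutsize E ends K)"
      using sum_bounded_below[of ?K 4 "cutsize E ends"] K by (simp only: mult.commute of_nat_id)
    also have "\<dots> = (\<Sum>e\<in>E. \<Sum>K\<in>?K. crossing ends K e)"
      unfolding cutsize_eq_sum[OF fin(1)] by (rule sum.swap)
    also have "\<dots> \<le> (\<Sum>e\<in>E. 2 * of_bool (e \<in> D))"
    proof (rule sum_mono)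
      fix e assume e: "e \<in> E"
      let ?a = "fst (ends e)" and ?b = "snd (ends e)"
      show "(\<Sum>K\<in>?K. crossing ends K e) \<le> 2 * of_bool (e \<in> D)"
      proof (cases "e \<in> D")
        case True
        have "(\<Sum>K\<in>?K. crossing ends K e) \<le> (\<Sum>K\<in>?K. of_bool (?a \<in> K) + of_bool (?b \<in> K))"
          by (rule sum_mono) (auto simp: crossing_def)
        also have "\<dots> = 2"
          using graph_ends[OF g(1) e] by (simp only: sum.distrib conn_class_partition[OF fin(2)] one_add_one)
        finally show ?thesis using True by simp
      next
        case False
        then have c: "conn ends C ?a ?b" using e by (simp add: D_def)
        have "?a \<in> K \<longleftrightarrow> ?b \<in> K" if K': "K \<in> ?K" for K
        proof -
          obtain x where "K = conn_class ends V C x" using K' by blast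
          moreover have "?a \<in> V" "?b \<in> V" using g e by (auto simp: graph_def)
          ultimately show ?thesis using rtranclp_trans[OF _ c, of x] rtranclp_trans[OF _ conn_sym[OF c], of x]
            unfolding conn_class_def by (metis (no_types, lifting) mem_Collect_eq)
        qed
        then have "(\<Sum>K\<in>?K. crossing ends K e) = 0" by (intro sum.neutral) (auto simp: crossing_def)
        then show ?thesis using False by simp
      qed
    qed
    also have "\<dots> = 2 * int (card D)"
    proof -
      have "{e \<in> E. e \<in> D} = D" by (auto simp: D_def)
      then show ?thesis using fin by (simp add: sum_distrib_left[symmetric] of_bool_def sum.If_cases Int_def)
    qed
    finally show False using D_le by linarith
  qed
  then obtain K where "?K = {K}" by (auto simp: card_1_singleton_iff)
  then have "conn_class ends V C x = conn_class ends V C y" if "x \<in> V" "y \<in> V" for x y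
    using that by (metis image_eqI singletonD)
  then have cC: "conn ends C x y" if "x \<in> V" "y \<in> V" for x y
    using that unfolding conn_class_def by (metis (no_types, lifting) mem_Collect_eq rtranclp.rtrancl_refl)
  have "conn ends (F0 i) x y" if "x \<in> V" "y \<in> V" for x y i
    by (rule conn_mono[OF Int_lower1 C_le[OF cC[OF that]]])
  then show ?thesis using F0(1) by (intro exI[of _ "F0 True"] exI[of _ "F0 False"]) (auto simp: forest_pair_def)
qed

section \<open>Euler trails of signed graphs\<close>

text \<open>Trails record only their edge set; R e y z says that e may be traversed from y to z.\<close>

inductive trail :: "('e \<Rightarrow> 'v \<Rightarrow> 'v \<Rightarrow> bool) \<Rightarrow> 'v \<Rightarrow> 'e set \<Rightarrow> 'v \<Rightarrow> bool" for R x where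
  nil: "trail R x {} x"
| step: "trail R x F y \<Longrightarrow> e \<notin> F \<Longrightarrow> R e y z \<Longrightarrow> trail R x (insert e F) z"

lemma trail_finite: "trail R x F y \<Longrightarrow> finite F"
  by (induction rule: trail.induct) auto

lemma trail_append:
  assumes "trail R y G z" "trail R x F y" "F \<inter> G = {}"
  shows "trail R x (F \<union> G) z"
  using assms
proof (induction rule: trail.induct)
  case (step G z e w)
  then have "trail R x (F \<union> G) z" "e \<notin> F \<union> G" by auto
  from trail.step[OF this step.hyps(3)] show ?case by simp
qed simp

lemma trail_single: "R e y z \<Longrightarrow> trail R y {e} z"
  using trail.step[OF trail.nil] by force

text \<open>A trail can be cut at both ends of each of its edges. Both are stated because the
  direction in which the trail uses the edge is unknown.\<close>

lemma trail_split:
  assumes "trail R x F y" "e \<in> F"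
  shows "\<exists>u z. R e u z \<and> (\<forall>v\<in>{u, z}. \<exists>G H. F = G \<union> H \<and> G \<inter> H = {} \<and> trail R x G v \<and> trail R v H y)"
  using assms
proof (induction rule: trail.induct)
  case (step F y f w)
  show ?case
  proof (cases "e = f")
    case True
    have 1: "trail R x (insert f F) w" by (rule trail.step[OF step.hyps])
    have 2: "trail R y {f} w" by (rule trail_single[of R f y w, OF step.hyps(3)])
    have "\<exists>G H. insert f F = G \<union> H \<and> G \<inter> H = {} \<and> trail R x G y \<and> trail R y H w"
      using step.hyps(1,2) 2 by (intro exI[of _ F] exI[of _ "{f}"]) auto
    moreover have "\<exists>G H. insert f F = G \<union> H \<and> G \<inter> H = {} \<and> trail R x G w \<and> trail R w H w"
      using 1 trail.nil[of R w] by (intro exI[of _ "insert f F"] exI[of _ "{}"]) auto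
    ultimately have "\<forall>v\<in>{y, w}. \<exists>G H. insert f F = G \<union> H \<and> G \<inter> H = {} \<and> trail R x G v \<and> trail R v H w"
      by simp
    then show ?thesis using True step.hyps(3) by blast
  next
    case False
    then have "e \<in> F" using step.prems by simp
    then obtain u z where uz: "R e u z"
      "\<forall>v\<in>{u, z}. \<exists>G H. F = G \<union> H \<and> G \<inter> H = {} \<and> trail R x G v \<and> trail R v H y"
      using step.IH by blast
    have "\<exists>G H. insert f F = G \<union> H \<and> G \<inter> H = {} \<and> trail R x G v \<and> trail R v H w" if v: "v \<in> {u, z}" for v
    proof -
      obtain G H where GH: "F = G \<union> H" "G \<inter> H = {}" "trail R x G v" "trail R v H y"
        using bspec[OF uz(2) v] by metis
      have "f \<notin> H" using GH step.hyps by blast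
      from trail.step[OF GH(4) this step.hyps(3)] have "trail R v (insert f H) w" .
      then show ?thesis using GH step.hyps by (intro exI[of _ G] exI[of _ "insert f H"]) auto
    qed
    then show ?thesis using uz(1) by blast
  qed
qed simp

definition joins :: "('e \<Rightarrow> 'v \<times> 'v) \<Rightarrow> 'e \<Rightarrow> 'v \<Rightarrow> 'v \<Rightarrow> bool" where
  "joins ends e y z \<longleftrightarrow> ends e = (y, z) \<or> ends e = (z, y)"

lemma joins_inc: "joins ends e y z \<Longrightarrow> inc ends e v = of_bool (v = y) + of_bool (v = z)"
  by (auto simp: joins_def ends_pair)

lemma trail_parity:
  assumes "trail (joins ends) x F y"
  shows "even (deg F ends v - of_bool (v = x) - of_bool (v = y))"
  using assms
proof (induction rule: trail.induct)
  case nil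
  then show ?case by (simp add: deg_def)
next
  case (step F y e z)
  have "deg (insert e F) ends v = inc ends e v + deg F ends v"
    using step.hyps trail_finite[OF step.hyps(1)] by (simp add: deg_def)
  then have eq: "deg (insert e F) ends v - of_bool (v = x) - of_bool (v = z)
     = (deg F ends v - of_bool (v = x) - of_bool (v = y)) + 2 * of_bool (v = y)"
    by (simp add: joins_inc[OF step.hyps(3)])
  show ?case unfolding eq by (rule dvd_add[OF step.IH dvd_triv_left])
qed

lemma trail_touch:
  assumes "trail (joins ends) x F y" "v = x \<or> (\<exists>e\<in>F. v = fst (ends e) \<or> v = snd (ends e))"
  shows "\<exists>G H. F = G \<union> H \<and> G \<inter> H = {} \<and> trail (joins ends) x G v \<and> trail (joins ends) v H y"
proof (cases "v = x")
  case True
  then show ?thesis using assms(1) trail.nil[of "joins ends" x] by (intro exI[of _ "{}"] exI[of _ F]) auto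
next
  case False
  then obtain e where e: "e \<in> F" "v = fst (ends e) \<or> v = snd (ends e)" using assms(2) by blast
  from trail_split[OF assms(1) e(1)] obtain u z where uz: "joins ends e u z"
    "\<forall>v\<in>{u, z}. \<exists>G H. F = G \<union> H \<and> G \<inter> H = {} \<and> trail (joins ends) x G v \<and> trail (joins ends) v H y"
    by metis
  have "v \<in> {u, z}" using uz(1) e(2) by (auto simp: joins_def)
  from bspec[OF uz(2) this] show ?thesis .
qed

theorem euler_trail:
  assumes H: "finite H" "V \<noteq> {}" "\<And>e. e \<in> H \<Longrightarrow> fst (ends e) \<in> V \<and> snd (ends e) \<in> V"
    and ev: "\<And>v. v \<in> V \<Longrightarrow> even (deg H ends v)"
    and con: "\<And>x y. x \<in> V \<Longrightarrow> y \<in> V \<Longrightarrow> conn ends H x y"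
  shows "\<exists>x\<in>V. trail (joins ends) x H x"
proof -
  let ?T = "\<lambda>n. \<exists>x\<in>V. \<exists>F y. trail (joins ends) x F y \<and> F \<subseteq> H \<and> card F = n"
  have "?T 0" using H(2) trail.nil[of "joins ends"] by (metis card.empty empty_subsetI ex_in_conv)
  moreover have "\<forall>n. ?T n \<longrightarrow> n \<le> card H" using H(1) by (auto intro: card_mono)
  ultimately obtain N where N: "?T N" "\<And>n. ?T n \<Longrightarrow> n \<le> N"
    using Nat.ex_has_greatest_nat[of ?T 0 "card H"] by blast
  then obtain x F y where F: "x \<in> V" "trail (joins ends) x F y" "F \<subseteq> H" "card F = N" by blast
  have finF: "finite F" using F(3) H(1) finite_subset by blast
  have no_ext: "\<not> joins ends e v w" if "u \<in> V" "trail (joins ends) u F v" "e \<in> H - F" for u v e w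
  proof
    assume "joins ends e v w"
    with that have "trail (joins ends) u (insert e F) w" by (auto intro: trail.step)
    then have "?T (card (insert e F))" using that F(3) by blast
    from N(2)[OF this] show False using F(4) finF that(3) by simp
  qed
  have end_at: "\<exists>w. joins ends e v w" if "v = fst (ends e) \<or> v = snd (ends e)" for e v
    using that unfolding joins_def by (metis prod.collapse)
  have yV: "y \<in> V" using F(2)
  proof cases
    case (step G w e)
    then have "e \<in> H" "ends e = (w, y) \<or> ends e = (y, w)" using F(3) by (auto simp: joins_def)
    then show ?thesis using H(3)[of e] by auto
  qed (simp add: F(1))
  have "y = x"
  proof (rule ccontr)
    assume "y \<noteq> x"
    then have "odd (deg F ends y)" using trail_parity[OF F(2), of y] by simp
    moreover have "deg H ends y = deg F ends y + deg (H - F) ends y"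
      using F(3) H(1) by (simp add: deg_def sum.subset_diff[of F H] add.commute)
    ultimately have "deg (H - F) ends y \<noteq> 0" using ev[OF yV] by (metis add.right_neutral)
    then obtain e where "e \<in> H - F" "inc ends e y \<noteq> 0"
      unfolding deg_def by (meson sum.neutral)
    moreover then have "y = fst (ends e) \<or> y = snd (ends e)" by (auto simp: inc_def split: if_splits)
    ultimately show False using no_ext[OF F(1,2)] end_at by blast
  qed
  note Fx = F(2)[unfolded \<open>y = x\<close>]
  define S where "S = insert x {v. \<exists>e\<in>F. v = fst (ends e) \<or> v = snd (ends e)}"
  have closed: "e \<in> F" if e: "e \<in> H" "fst (ends e) \<in> S \<or> snd (ends e) \<in> S" for e
  proof (rule ccontr)
    assume "e \<notin> F"
    obtain v where v: "v \<in> S" "v = fst (ends e) \<or> v = snd (ends e)" using e by blast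
    then obtain G K where GK: "F = G \<union> K" "G \<inter> K = {}" "trail (joins ends) x G v" "trail (joins ends) v K x"
    proof -
      have "v = x \<or> (\<exists>e\<in>F. v = fst (ends e) \<or> v = snd (ends e))" using v(1) by (simp add: S_def)
      from trail_touch[OF Fx this] show ?thesis using that by metis
    qed
    \<comment> \<open>Rotation of the closed trail to the base point \<open>v\<close>.\<close>
    have "trail (joins ends) v F v" using trail_append[OF GK(3,4)] GK(1,2) by (simp add: Un_commute Int_commute)
    moreover have "v \<in> V" using v H(3) e by auto
    ultimately show False using no_ext[of v v e] end_at[OF v(2)] e(1) \<open>e \<notin> F\<close> by blast
  qed
  have inS: "v \<in> S" if "conn ends H x v" for v
    using that
  proof induction
    case base
    then show ?case by (simp add: S_def)
  next
    case (step v w)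
    then obtain e where e: "e \<in> H" "ends e = (v, w) \<or> ends e = (w, v)" by (auto simp: adj_def)
    then have "e \<in> F" using closed[OF e(1)] step.IH by auto
    then show ?case using e(2) by (force simp: S_def)
  qed
  have "H \<subseteq> F"
  proof
    fix e assume e: "e \<in> H"
    then have "fst (ends e) \<in> S" using inS con[OF F(1)] H(3) by blast
    then show "e \<in> F" using closed e by blast
  qed
  then show ?thesis using Fx F(1,3) by (metis subset_antisym)
qed

text \<open>The sign \<open>c\<close> is carried along. The next edge receives \<open>c\<close> at
  \<open>y\<close>, cancelling the open end there, and leaves \<open>z\<close> open with a sign that
  changes exactly at negative edges. Hence sinks and sources alternate, and a closed trail has
  defect \<open>1 - c\<close>, that is 0 or 2, at its base point.\<close>

lemma trail_orientation:
  assumes "trail (joins ends) x F y" "\<And>e. e \<in> F \<Longrightarrow> \<sigma> e = 1 \<or> \<sigma> e = -1"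
  shows "\<exists>\<tau> c. orientation F \<sigma> \<tau> \<and> (c = 1 \<or> c = -1) \<and>
    (\<forall>v. net_flow F ends \<tau> (\<lambda>_. 1) v = of_bool (v = x) - c * of_bool (v = y))"
  using assms
proof (induction rule: trail.induct)
  case nil
  show ?case by (intro exI[of _ "\<lambda>_ _. 1"] exI[of _ 1]) (auto simp: orientation_def net_flow_def)
next
  case (step F y e z)
  obtain \<tau> c where t: "orientation F \<sigma> \<tau>" "c = 1 \<or> c = -1"
    "\<And>v. net_flow F ends \<tau> (\<lambda>_. 1) v = of_bool (v = x) - c * of_bool (v = y)"
    using step by (metis insertI2)
  have s: "\<sigma> e = 1 \<or> \<sigma> e = -1" using step.prems by simp
  define b where "b \<longleftrightarrow> ends e = (y, z)"
  define \<tau>' where "\<tau>' = \<tau>(e := (\<lambda>i. if i = b then c else - \<sigma> e * c))"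
  have o: "orientation (insert e F) \<sigma> \<tau>'"
    using t(1,2) s step.hyps(2) by (cases b) (auto simp: orientation_def \<tau>'_def)
  have "net_flow (insert e F) ends \<tau>' (\<lambda>_. 1) v = of_bool (v = x) - (\<sigma> e * c) * of_bool (v = z)" for v
  proof -
    have "net_flow F ends \<tau>' (\<lambda>_. 1) v = net_flow F ends \<tau> (\<lambda>_. 1) v"
      using step.hyps(2) unfolding net_flow_def by (intro sum.cong) (auto simp: \<tau>'_def)
    moreover have "(if end_of ends e True = v then \<tau>' e True * 1 else 0) + (if end_of ends e False = v then \<tau>' e False * 1 else 0)
       = c * of_bool (v = y) - \<sigma> e * c * of_bool (v = z)"
      using step.hyps(3) by (cases b) (auto simp: joins_def b_def \<tau>'_def end_of_def)
    ultimately show ?thesis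
      using t(3)[of v] step.hyps(2) trail_finite[OF step.hyps(1)] by (simp add: net_flow_def)
  qed
  moreover have "\<sigma> e * c = 1 \<or> \<sigma> e * c = -1" using s t(2) by auto
  ultimately show ?case using o by blast
qed

section \<open>Edge sets with prescribed degree parities\<close>

lemma deg_sym_diff:
  assumes "finite J" "finite K"
  shows "even (deg (J - K \<union> (K - J)) ends v - (deg J ends v + deg K ends v))"
proof -
  have "deg (J - K \<union> (K - J)) ends v = deg (J - K) ends v + deg (K - J) ends v"
    using assms unfolding deg_def by (intro sum.union_disjoint) auto
  moreover have "deg J ends v = deg (J - K) ends v + deg (J \<inter> K) ends v"
    using assms unfolding deg_def by (metis add.commute sum.Int_Diff)
  moreover have "deg K ends v = deg (K - J) ends v + deg (J \<inter> K) ends v"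
    using assms unfolding deg_def by (metis Int_commute add.commute sum.Int_Diff)
  ultimately show ?thesis by simp
qed

text \<open>Take the edges that a walk uses an odd number of times; symmetric differences avoid the
  passage to a simple path.\<close>

lemma path_join:
  assumes "conn ends T x y" "finite T"
  shows "\<exists>J\<subseteq>T. \<forall>v. even (deg J ends v - (of_bool (v = x) + of_bool (v = y)))"
  using assms(1)
proof induction
  case base
  then show ?case by (intro exI[of _ "{}"]) (auto simp: deg_def)
next
  case (step y z)
  then obtain J where J: "J \<subseteq> T" "\<And>v. even (deg J ends v - (of_bool (v = x) + of_bool (v = y)))" by blast
  obtain e where e: "e \<in> T" "joins ends e y z" using step.hyps(2) by (auto simp: adj_def joins_def)
  have "even (deg (J - {e} \<union> ({e} - J)) ends v - (of_bool (v = x) + of_bool (v = z)))" for v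
  proof -
    have "deg {e} ends v = of_bool (v = y) + of_bool (v = z)" by (simp add: deg_def joins_inc[OF e(2)])
    then have eq: "deg (J - {e} \<union> ({e} - J)) ends v - (of_bool (v = x) + of_bool (v = z)) =
      (deg (J - {e} \<union> ({e} - J)) ends v - (deg J ends v + deg {e} ends v)) +
      (deg J ends v - (of_bool (v = x) + of_bool (v = y))) + 2 * of_bool (v = y)" by simp
    have "even (deg (J - {e} \<union> ({e} - J)) ends v - (deg J ends v + deg {e} ends v))"
      using finite_subset[OF J(1) assms(2)] by (intro deg_sym_diff) simp_all
    then show ?thesis unfolding eq by (rule dvd_add[OF dvd_add[OF _ J(2)] dvd_triv_left])
  qed
  then show ?case using J(1) e(1) by (intro exI[of _ "J - {e} \<union> ({e} - J)"]) auto
qed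

text \<open>Vertices are treated one by one: a vertex of odd demand is joined to the root
  \<open>r\<close> by a path, and \<open>r\<close> collects the parities. The even total makes
  \<open>r\<close> correct at the end.\<close>

lemma parity_join:
  assumes T: "finite T" "\<And>x y. x \<in> V \<Longrightarrow> y \<in> V \<Longrightarrow> conn ends T x y"
    and V: "finite V" and t: "even (\<Sum>v\<in>V. t v)"
  shows "\<exists>J\<subseteq>T. \<forall>v\<in>V. even (deg J ends v - (t v :: int))"
proof (cases "V = {}")
  case False
  then obtain r where r: "r \<in> V" by blast
  have *: "\<exists>J\<subseteq>T. \<forall>v. even (deg J ends v - (of_bool (v \<in> S) * t v + (\<Sum>v\<in>S. t v) * of_bool (v = r)))"
    if "finite S" "S \<subseteq> V" for S
    using that
  proof (induction S)
    case empty
    then show ?case by (intro exI[of _ "{}"]) (auto simp: deg_def)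
  next
    case (insert s S)
    then obtain J where J: "J \<subseteq> T" "\<And>v. even (deg J ends v - (of_bool (v \<in> S) * t v + (\<Sum>v\<in>S. t v) * of_bool (v = r)))"
      by auto
    show ?case
    proof (cases "even (t s)")
      case True
      have "even (deg J ends v - (of_bool (v \<in> insert s S) * t v + (\<Sum>v\<in>insert s S. t v) * of_bool (v = r)))" for v
        using J(2)[of v] True insert.hyps by (cases "v = s"; cases "v = r") auto
      then show ?thesis using J(1) by blast
    next
      case False
      obtain K where K: "K \<subseteq> T" "\<And>v. even (deg K ends v - (of_bool (v = s) + of_bool (v = r)))"
        using path_join[OF T(2)[of s r] T(1)] insert.prems r by auto
      let ?J = "J - K \<union> (K - J)"
      have "even (deg ?J ends v - (of_bool (v \<in> insert s S) * t v + (\<Sum>v\<in>insert s S. t v) * of_bool (v = r)))" for v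
      proof -
        have "even (deg ?J ends v - (deg J ends v + deg K ends v))"
          using finite_subset[OF J(1) T(1)] finite_subset[OF K(1) T(1)] by (rule deg_sym_diff)
        then show ?thesis using J(2)[of v] K(2)[of v] False insert.hyps
          by (cases "v = s"; cases "v = r") auto
      qed
      then show ?thesis using J(1) K(1) by (intro exI[of _ ?J]) auto
    qed
  qed
  obtain J where J: "J \<subseteq> T" "\<And>v. even (deg J ends v - (of_bool (v \<in> V) * t v + (\<Sum>v\<in>V. t v) * of_bool (v = r)))"
    using *[OF V] by blast
  have "even (deg J ends v - t v)" if "v \<in> V" for v
    using J(2)[of v] that t by (cases "v = r") auto
  then show ?thesis using J(1) by blast
qed auto

section \<open>From modular to exact flows\<close>

definition flow_arc :: "'e set \<Rightarrow> ('e \<Rightarrow> 'v \<times> 'v) \<Rightarrow> ('e \<Rightarrow> int) \<Rightarrow> 'e \<Rightarrow> 'v \<Rightarrow> 'v \<Rightarrow> bool" where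
  "flow_arc E ends g e y z \<longleftrightarrow> e \<in> E \<and> (g e > 0 \<and> ends e = (y, z) \<or> g e < 0 \<and> ends e = (z, y))"

text \<open>For \<open>M\<close> equal to 2k + 1 the shift turns k into -(k + 1) and k + 1 into -k,
  so reversal keeps the admissible absolute values.\<close>

lemma net_flip:
  assumes "trail (flow_arc E ends g) x F y" "finite E"
  shows "net E ends (\<lambda>e. if e \<in> F then g e - sgn (g e) * M else g e) v
    = net E ends g v - M * (of_bool (v = x) - of_bool (v = y))"
  using assms(1)
proof (induction rule: trail.induct)
  case (step F y e z)
  have e: "e \<in> E" using step.hyps(3) by (simp add: flow_arc_def)
  let ?g = "\<lambda>F e. if e \<in> F then g e - sgn (g e) * M else g e"
  have "net (E - {e}) ends (?g (insert e F)) v = net (E - {e}) ends (?g F) v"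
    by (rule net_cong) auto
  moreover have "?g (insert e F) e * dinc ends e v = ?g F e * dinc ends e v - M * (of_bool (v = y) - of_bool (v = z))"
    using step.hyps(2,3) by (auto simp: flow_arc_def ends_pair algebra_simps)
  ultimately show ?case using step.IH
      net_remove[OF assms(2) e, of ends "?g (insert e F)" v] net_remove[OF assms(2) e, of ends "?g F" v]
    by (simp add: algebra_simps)
qed simp

text \<open>A trail may not repeat an edge. If it already uses \<open>e\<close>, it visits
  \<open>z\<close>, and its initial part up to \<open>z\<close> is enough.\<close>

lemma reach_closed:
  assumes "trail (flow_arc E ends g) x F y" "flow_arc E ends g e y z"
  shows "\<exists>F'. trail (flow_arc E ends g) x F' z"
proof (cases "e \<in> F")
  case True
  from trail_split[OF assms(1) True] obtain u w where uw: "flow_arc E ends g e u w"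
    "\<forall>v\<in>{u, w}. \<exists>G H. F = G \<union> H \<and> G \<inter> H = {} \<and> trail (flow_arc E ends g) x G v \<and> trail (flow_arc E ends g) v H y"
    by metis
  have "z \<in> {u, w}" using uw(1) assms(2) by (auto simp: flow_arc_def)
  from bspec[OF uw(2) this] show ?thesis by metis
next
  case False
  from trail.step[OF assms(1) this assms(2)] show ?thesis by metis
qed

text \<open>Minimise the total deviation \<open>\<Phi>\<close>. No vertex of negative deviation is
  reachable from one of positive deviation, as reversing a trail between them lowers
  \<open>\<Phi>\<close>. All cut edges of the reachable set \<open>X\<close> point inwards with
  value at least k, so \<open>X\<close> has total deviation at most 2k; yet it is a sum of
  nonnegative multiples of 2k + 1, one of them positive.\<close>

theorem exact_flow:
  fixes k :: int
  assumes g: "graph V E ends" and k: "1 \<le> k"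
    and s: "\<forall>e\<in>E. s e = 1 \<or> s e = -1"
    and cong: "\<forall>v\<in>V. 2 * k + 1 dvd k * net E ends s v + b v"
    and tot: "(\<Sum>v\<in>V. b v) = 0"
    and bound: "\<And>A. A \<subseteq> V \<Longrightarrow> (\<Sum>v\<in>A. b v) \<le> k * cutsize E ends A + 2 * k"
  shows "\<exists>f. (\<forall>e\<in>E. \<bar>f e\<bar> = k \<or> \<bar>f e\<bar> = k + 1) \<and> (\<forall>v\<in>V. net E ends f v + b v = 0)"
proof -
  have fin: "finite E" "finite V" using g by (auto simp: graph_def)
  let ?M = "2 * k + 1"
  define adm where "adm f \<longleftrightarrow> (\<forall>e\<in>E. \<bar>f e\<bar> = k \<or> \<bar>f e\<bar> = k + 1) \<and> (\<forall>v\<in>V. ?M dvd net E ends f v + b v)" for f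
  define \<Phi> where "\<Phi> f = nat (\<Sum>v\<in>V. \<bar>net E ends f v + b v\<bar>)" for f
  have "net E ends (\<lambda>e. k * s e) v = k * net E ends s v" for v
    by (simp add: net_def sum_distrib_left mult.assoc)
  then have "adm (\<lambda>e. k * s e)" using s k cong by (auto simp: adm_def abs_mult)
  then obtain f where f: "adm f" "\<And>f'. adm f' \<Longrightarrow> \<Phi> f \<le> \<Phi> f'"
    using ex_has_least_nat[of adm _ \<Phi>] by metis
  define D where "D v = net E ends f v + b v" for v
  have D0: "(\<Sum>v\<in>V. D v) = 0" using tot sum_net_V[OF g] by (simp add: D_def sum.distrib)
  have D_dvd: "?M dvd D v" if "v \<in> V" for v using f(1) that by (simp add: adm_def D_def)
  have fv: "\<bar>f e\<bar> = k \<or> \<bar>f e\<bar> = k + 1" if "e \<in> E" for e using f(1) that by (simp add: adm_def)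
  have "D v = 0" if v: "v \<in> V" for v
  proof (rule ccontr)
    assume "D v \<noteq> 0"
    have "\<exists>x\<in>V. D x > 0"
    proof (rule ccontr)
      assume "\<not> ?thesis"
      then have le: "D x \<le> 0" if "x \<in> V" for x using that by (simp add: not_less)
      then have "(\<Sum>x\<in>V. - D x) = 0 \<longleftrightarrow> (\<forall>x\<in>V. - D x = 0)"
        using fin by (intro sum_nonneg_eq_0_iff) auto
      then show False using D0 v \<open>D v \<noteq> 0\<close> by (simp add: sum_negf)
    qed
    then obtain x where x: "x \<in> V" "D x > 0" by blast
    define X where "X = {y \<in> V. \<exists>F. trail (flow_arc E ends f) x F y}"
    have xX: "x \<in> X" using x(1) trail.nil[of "flow_arc E ends f" x] unfolding X_def by blast
    have XV: "X \<subseteq> V" by (auto simp: X_def)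
    have Dnn: "0 \<le> D y" if y: "y \<in> X" for y
    proof (rule ccontr)
      assume "\<not> ?thesis"
      then have neg: "D y < 0" by simp
      obtain F where F: "trail (flow_arc E ends f) x F y" using y by (auto simp: X_def)
      have yV: "y \<in> V" using y XV by blast
      define f' where "f' = (\<lambda>e. if e \<in> F then f e - sgn (f e) * ?M else f e)"
      have n: "net E ends f' w + b w = D w - ?M * (of_bool (w = x) - of_bool (w = y))" for w
        unfolding f'_def D_def net_flip[OF F fin(1)] by (rule diff_add_eq)
      have "\<bar>f' e\<bar> = k \<or> \<bar>f' e\<bar> = k + 1" if "e \<in> E" for e
        using fv[OF that] k by (auto simp: f'_def sgn_if abs_if split: if_splits)
      moreover have "?M dvd net E ends f' w + b w" if "w \<in> V" for w
        unfolding n by (rule dvd_diff[OF D_dvd[OF that] dvd_triv_left])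
      ultimately have "adm f'" by (simp add: adm_def)
      then have "\<Phi> f \<le> \<Phi> f'" by (rule f(2))
      moreover have "\<Phi> f' < \<Phi> f"
      proof -
        have big: "?M \<le> D x" "D y \<le> - ?M"
          using zdvd_imp_le[OF D_dvd[OF x(1)] x(2)] zdvd_imp_le[of ?M "- D y"] D_dvd[OF yV] neg by auto
        have "x \<noteq> y" using neg x by auto
        have "(\<Sum>w\<in>V. \<bar>net E ends f' w + b w\<bar>) < (\<Sum>w\<in>V. \<bar>D w\<bar>)"
        proof (rule sum_strict_mono_ex1[OF fin(2)])
          show "\<forall>w\<in>V. \<bar>net E ends f' w + b w\<bar> \<le> \<bar>D w\<bar>"
            unfolding n using big \<open>x \<noteq> y\<close> k by auto
          show "\<exists>w\<in>V. \<bar>net E ends f' w + b w\<bar> < \<bar>D w\<bar>"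
            unfolding n using big \<open>x \<noteq> y\<close> k by (intro bexI[OF _ x(1)]) auto
        qed
        moreover have "0 \<le> (\<Sum>w\<in>V. \<bar>net E ends f' w + b w\<bar>)" by (rule sum_nonneg) simp
        ultimately show ?thesis unfolding \<Phi>_def D_def by (simp only: nat_less_eq_zless)
      qed
      ultimately show False by simp
    qed
    have closed: "z \<in> X" if yz: "y \<in> X" "flow_arc E ends f e y z" for y z e
    proof -
      obtain F where "trail (flow_arc E ends f) x F y" using yz(1) by (auto simp: X_def)
      from reach_closed[OF this yz(2)] obtain F' where "trail (flow_arc E ends f) x F' z" by blast
      moreover have "z \<in> V" using yz(2) g by (auto simp: flow_arc_def graph_def)
      ultimately show ?thesis by (auto simp: X_def)
    qed
    have "(\<Sum>y\<in>X. net E ends f y) \<le> - k * cutsize E ends X"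
    proof -
      have "f e * (of_bool (fst (ends e) \<in> X) - of_bool (snd (ends e) \<in> X)) \<le> - k * crossing ends X e" if e: "e \<in> E" for e
      proof (cases "f e > 0")
        case True
        then have "fst (ends e) \<in> X \<Longrightarrow> snd (ends e) \<in> X"
          using closed[of "fst (ends e)" e "snd (ends e)"] e by (simp add: flow_arc_def)
        then show ?thesis using fv[OF e] True k by (auto simp: crossing_def)
      next
        case False
        then have "f e < 0" using fv[OF e] k by auto
        then have "snd (ends e) \<in> X \<Longrightarrow> fst (ends e) \<in> X"
          using closed[of "snd (ends e)" e "fst (ends e)"] e by (simp add: flow_arc_def)
        then show ?thesis using fv[OF e] False k by (auto simp: crossing_def)
      qed
      then show ?thesis unfolding sum_net[OF finite_subset[OF XV fin(2)]] cutsize_eq_sum[OF fin(1)] sum_distrib_left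
        by (rule sum_mono)
    qed
    moreover have "D x \<le> (\<Sum>y\<in>X. D y)"
      using Dnn xX finite_subset[OF XV fin(2)] by (intro member_le_sum) auto
    moreover have "?M \<le> D x" using zdvd_imp_le[OF D_dvd[OF x(1)] x(2)] .
    ultimately show False using bound[OF XV] by (simp add: D_def sum.distrib)
  qed
  then show ?thesis using fv unfolding D_def by blast
qed

section \<open>Signed graphs\<close>

definition switch_sign :: "'v set \<Rightarrow> 'v \<Rightarrow> int" where
  "switch_sign X v = (if v \<in> X then -1 else 1)"

definition switch_set :: "('e \<Rightarrow> 'v \<times> 'v) \<Rightarrow> 'v set \<Rightarrow> ('e \<Rightarrow> int) \<Rightarrow> 'e \<Rightarrow> int" where
  "switch_set ends X \<sigma> = (\<lambda>e. switch_sign X (fst (ends e)) * switch_sign X (snd (ends e)) * \<sigma> e)"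

lemma equivalent_switch_set:
  assumes "finite X" "X \<subseteq> V"
  shows "equivalent_sig V ends \<sigma> (switch_set ends X \<sigma>)"
  using assms
proof (induction X)
  case empty
  have "switch_set ends {} \<sigma> = \<sigma>" by (auto simp: switch_set_def switch_sign_def)
  then show ?case by (simp add: equivalent_sig_def)
next
  case (insert v X)
  have "switch_set ends (insert v X) \<sigma> = switch_at ends v (switch_set ends X \<sigma>)"
    using insert.hyps by (auto simp: switch_set_def switch_sign_def switch_at_def)
  then have "switch_step V ends (switch_set ends X \<sigma>) (switch_set ends (insert v X) \<sigma>)"
    using insert.prems by (auto simp: switch_step_def)
  then show ?case using insert.IH insert.prems
    unfolding equivalent_sig_def by (simp add: rtranclp.rtrancl_into_rtrancl)
qed

lemma switch_set_switch_set: "switch_set ends Y (switch_set ends X \<sigma>) = switch_set ends (X - Y \<union> (Y - X)) \<sigma>"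
  by (auto simp: switch_set_def switch_sign_def)

lemma signature_switch_set: "signature E \<sigma> \<Longrightarrow> signature E (switch_set ends X \<sigma>)"
  by (auto simp: signature_def switch_set_def switch_sign_def)

text \<open>Reversing every half-edge at a vertex of \<open>X\<close> undoes the change of signs and
  multiplies the balance at each vertex by 1 or -1.\<close>

lemma admits_switch_set:
  assumes "admits_pq_flow a b V E ends (switch_set ends X \<sigma>)"
  shows "admits_pq_flow a b V E ends \<sigma>"
proof -
  obtain \<tau> f where t: "pq_flow a b V E ends (switch_set ends X \<sigma>) \<tau> f"
    using assms by (auto simp: admits_pq_flow_def)
  define \<tau>' where "\<tau>' e i = switch_sign X (end_of ends e i) * \<tau> e i" for e i
  have "orientation E \<sigma> \<tau>'"
    unfolding orientation_def
  proof
    fix e assume e: "e \<in> E"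
    have "\<tau> e True * \<tau> e False = - (switch_sign X (fst (ends e)) * switch_sign X (snd (ends e)) * \<sigma> e)"
      "\<tau> e True = 1 \<or> \<tau> e True = -1" "\<tau> e False = 1 \<or> \<tau> e False = -1"
      using t e by (auto simp: pq_flow_def integer_flow_def orientation_def switch_set_def)
    then show "(\<tau>' e True = 1 \<or> \<tau>' e True = -1) \<and> (\<tau>' e False = 1 \<or> \<tau>' e False = -1) \<and>
        \<tau>' e True * \<tau>' e False = - \<sigma> e"
      by (cases "fst (ends e) \<in> X"; cases "snd (ends e) \<in> X") (auto simp: \<tau>'_def switch_sign_def end_of_def)
  qed
  moreover have "net_flow E ends \<tau>' f v = switch_sign X v * net_flow E ends \<tau> f v" for v
    unfolding net_flow_def sum_distrib_left by (rule sum.cong) (auto simp: \<tau>'_def algebra_simps)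
  ultimately have "pq_flow a b V E ends \<sigma> \<tau>' f"
    using t by (auto simp: pq_flow_def integer_flow_def)
  then show ?thesis by (auto simp: admits_pq_flow_def)
qed

text \<open>Switching at all of \<open>A\<close> exchanges the positive and negative edges of its
  cut and affects no other edge, so at a minimum it gains nothing.\<close>

lemma minimal_switch:
  assumes g: "graph V E ends" and \<sigma>: "signature E \<sigma>"
  shows "\<exists>X\<subseteq>V. \<forall>A\<subseteq>V. card (edge_cut (negative_edges E (switch_set ends X \<sigma>)) ends A)
    \<le> card (edge_cut (E - negative_edges E (switch_set ends X \<sigma>)) ends A)"
proof -
  have fin: "finite E" "finite V" using g by (auto simp: graph_def)
  obtain X where X: "X \<subseteq> V"
    "\<And>Y. Y \<subseteq> V \<Longrightarrow> card (negative_edges E (switch_set ends X \<sigma>)) \<le> card (negative_edges E (switch_set ends Y \<sigma>))"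
    using ex_has_least_nat[of "\<lambda>X. X \<subseteq> V" V "\<lambda>X. card (negative_edges E (switch_set ends X \<sigma>))"] by blast
  define s where "s = switch_set ends X \<sigma>"
  define N where "N = negative_edges E s"
  have s: "s e = 1 \<or> s e = -1" if "e \<in> E" for e
    using signature_switch_set[OF \<sigma>] that by (auto simp: s_def signature_def)
  have NE: "N \<subseteq> E" by (auto simp: N_def negative_edges_def)
  have "card (edge_cut N ends A) \<le> card (edge_cut (E - N) ends A)" if A: "A \<subseteq> V" for A
  proof -
    have "negative_edges E (switch_set ends A s) = (N - edge_cut N ends A) \<union> edge_cut (E - N) ends A"
      using s by (fastforce simp: N_def negative_edges_def edge_cut_def switch_set_def switch_sign_def)
    then have "card (negative_edges E (switch_set ends A s)) = card (N - edge_cut N ends A) + card (edge_cut (E - N) ends A)"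
      using fin NE by (simp add: card_Un_disjoint finite_subset edge_cut_def Int_def)
    moreover have "card (N - edge_cut N ends A) = card N - card (edge_cut N ends A)"
      using fin NE by (intro card_Diff_subset) (auto simp: edge_cut_def intro: finite_subset)
    moreover have "card (edge_cut N ends A) \<le> card N"
      using fin NE by (intro card_mono) (auto simp: edge_cut_def intro: finite_subset)
    moreover have "card N \<le> card (negative_edges E (switch_set ends A s))"
      unfolding s_def switch_set_switch_set N_def using A X(1) by (intro X(2)) auto
    ultimately show ?thesis by linarith
  qed
  then show ?thesis using X(1) by (auto simp: s_def N_def)
qed

text \<open>Add positive edges to the negative ones until the result is connected with even degrees, and
  orient a signed Euler trail of it. The positive edges used then carry 1 each, which bounds the
  imbalance of the negative edges on A; the 2 is the defect at the base point of the trail when the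
  number of negative edges is odd.\<close>

lemma negative_orientation:
  assumes g: "graph V E ends" "V \<noteq> {}" and \<sigma>: "signature E \<sigma>"
  defines "N \<equiv> negative_edges E \<sigma>" and "P \<equiv> E - negative_edges E \<sigma>"
  assumes con: "\<And>A. A \<subseteq> V \<Longrightarrow> A \<noteq> {} \<Longrightarrow> A \<noteq> V \<Longrightarrow> 4 \<le> cutsize P ends A"
  shows "\<exists>s. (\<forall>e\<in>N. s e = 1 \<or> s e = (-1 :: int)) \<and> ((\<Sum>e\<in>N. s e) = 0 \<or> (\<Sum>e\<in>N. s e) = 1) \<and>
    (\<forall>A\<subseteq>V. (\<Sum>v\<in>A. \<Sum>e\<in>N. s e * inc ends e v) \<le> cutsize P ends A + 2)"
proof -
  have fin: "finite E" "finite V" using g by (auto simp: graph_def)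
  have NP: "N \<subseteq> E" "P \<subseteq> E" "N \<inter> P = {}" by (auto simp: N_def P_def negative_edges_def)
  have \<sigma>N: "\<sigma> e = -1" if "e \<in> N" for e using that by (simp add: N_def negative_edges_def)
  have \<sigma>P: "\<sigma> e = 1" if "e \<in> P" for e using that \<sigma> by (auto simp: P_def negative_edges_def signature_def)
  have gP: "graph V P ends" using g NP by (auto simp: graph_def intro: finite_subset)
  have "\<exists>T T'. T \<subseteq> P \<and> T' \<subseteq> P \<and> T \<inter> T' = {} \<and> (\<forall>x\<in>V. \<forall>y\<in>V. conn ends T x y \<and> conn ends T' x y)"
    by (rule two_connected_subgraphs[OF gP g(2)]) (rule con)
  then obtain T T' where T: "T \<subseteq> P" "T' \<subseteq> P" "T \<inter> T' = {}"
    "\<And>x y. x \<in> V \<Longrightarrow> y \<in> V \<Longrightarrow> conn ends T x y" "\<And>x y. x \<in> V \<Longrightarrow> y \<in> V \<Longrightarrow> conn ends T' x y"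
    by metis
  have finT: "finite T" "finite T'" "finite N" "finite P"
    using finite_subset[OF _ fin(1)] T(1,2) NP by (auto intro: subset_trans)
  have "(\<Sum>v\<in>V. deg (N \<union> T) ends v) = (\<Sum>e\<in>N \<union> T. 2)"
    unfolding sum_deg[OF fin(2)] using g T NP by (intro sum.cong) (auto simp: graph_def)
  then have ev: "even (\<Sum>v\<in>V. deg (N \<union> T) ends v)" by simp
  \<comment> \<open>\<open>T\<close> provides connectedness and \<open>J\<close> repairs the
    parities; taking \<open>J\<close> from the disjoint \<open>T'\<close> ensures that no edge is
    used twice.\<close>
  have "\<exists>J\<subseteq>T'. \<forall>v\<in>V. even (deg J ends v - deg (N \<union> T) ends v)"
    by (rule parity_join[OF finT(2) _ fin(2) ev]) (rule T(5))
  then obtain J where J: "J \<subseteq> T'" "\<And>v. v \<in> V \<Longrightarrow> even (deg J ends v - deg (N \<union> T) ends v)"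
    by blast
  have finJ: "finite J" using finite_subset[OF J(1) finT(2)] .
  define Q where "Q = T \<union> J"
  have Q: "Q \<subseteq> P" "finite Q" "N \<inter> Q = {}" using T J NP finT finJ by (auto simp: Q_def)
  have "\<exists>x\<in>V. trail (joins ends) x (N \<union> Q) x"
  proof (rule euler_trail)
    show "finite (N \<union> Q)" using finT Q by simp
    show "V \<noteq> {}" by (rule g(2))
    show "fst (ends e) \<in> V \<and> snd (ends e) \<in> V" if "e \<in> N \<union> Q" for e
      using that g Q NP by (auto simp: graph_def)
    show "even (deg (N \<union> Q) ends v)" if "v \<in> V" for v
    proof -
      have "deg (N \<union> Q) ends v = deg (N \<union> T) ends v + deg J ends v"
        unfolding deg_def Q_def using finT finJ T J NP by (subst sum.union_disjoint[symmetric]) (auto simp: Un_assoc)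
      then show ?thesis using J(2)[OF that] by simp
    qed
    show "conn ends (N \<union> Q) x y" if "x \<in> V" "y \<in> V" for x y
      using T(4)[OF that] by (rule conn_mono[rotated]) (auto simp: Q_def)
  qed
  then obtain x where x: "x \<in> V" "trail (joins ends) x (N \<union> Q) x" by blast
  have "\<And>e. e \<in> N \<union> Q \<Longrightarrow> \<sigma> e = 1 \<or> \<sigma> e = -1" using \<sigma>N \<sigma>P Q by blast
  from trail_orientation[OF x(2) this] obtain \<tau> c where tt: "orientation (N \<union> Q) \<sigma> \<tau> \<and> (c = 1 \<or> c = -1) \<and>
    (\<forall>v. net_flow (N \<union> Q) ends \<tau> (\<lambda>_. 1) v = of_bool (v = x) - c * of_bool (v = x))" by iprover
  have t: "orientation (N \<union> Q) \<sigma> \<tau>" "c = 1 \<or> c = -1"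
    "net_flow (N \<union> Q) ends \<tau> (\<lambda>_. 1) v = of_bool (v = x) - c * of_bool (v = x)" for v
    using tt by simp_all
  define s where "s e = \<tau> e True" for e
  have s: "s e = 1 \<or> s e = -1" if "e \<in> N \<union> Q" for e using t(1) that by (auto simp: orientation_def s_def)
  have tN: "\<tau> e False = s e" if "e \<in> N" for e
    using t(1) that \<sigma>N[OF that] unfolding orientation_def s_def by force
  have tQ: "\<tau> e False = - s e" if "e \<in> Q" for e
    using t(1) that \<sigma>P[of e] Q unfolding orientation_def s_def by force
  have bal: "(\<Sum>e\<in>N. s e * inc ends e v) + net Q ends s v = (1 - c) * of_bool (v = x)" for v
  proof -
    have "net_flow (N \<union> Q) ends \<tau> (\<lambda>_. 1) v =
      (\<Sum>e\<in>N. (if end_of ends e True = v then \<tau> e True * 1 else 0) + (if end_of ends e False = v then \<tau> e False * 1 else 0)) +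
      (\<Sum>e\<in>Q. (if end_of ends e True = v then \<tau> e True * 1 else 0) + (if end_of ends e False = v then \<tau> e False * 1 else 0))"
      unfolding net_flow_def using finT Q by (intro sum.union_disjoint) auto
    also have "\<dots> = (\<Sum>e\<in>N. s e * inc ends e v) + net Q ends s v"
      unfolding net_def
      by (intro arg_cong2[where f="(+)"] sum.cong) (auto simp: tN tQ end_of_def inc_def dinc_def s_def)
    finally show ?thesis using t(3)[of v] by (simp add: algebra_simps)
  qed
  have balA: "(\<Sum>v\<in>A. \<Sum>e\<in>N. s e * inc ends e v) = (1 - c) * of_bool (x \<in> A) - (\<Sum>v\<in>A. net Q ends s v)"
    if "A \<subseteq> V" for A
  proof -
    have "finite A" using that fin finite_subset by blast
    then have "(\<Sum>v\<in>A. (\<Sum>e\<in>N. s e * inc ends e v) + net Q ends s v) = (1 - c) * of_bool (x \<in> A)"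
      unfolding bal by (rule sum_of_bool_single(1))
    then show ?thesis unfolding sum.distrib by linarith
  qed
  have "(\<Sum>v\<in>A. \<Sum>e\<in>N. s e * inc ends e v) \<le> cutsize P ends A + 2" if A: "A \<subseteq> V" for A
  proof -
    have finA: "finite A" using A fin finite_subset by blast
    have "- (\<Sum>v\<in>A. net Q ends s v) \<le> (\<Sum>e\<in>Q. crossing ends A e)"
      unfolding sum_net[OF finA] sum_negf[symmetric]
    proof (rule sum_mono)
      fix e assume "e \<in> Q"
      then show "- (s e * (of_bool (fst (ends e) \<in> A) - of_bool (snd (ends e) \<in> A))) \<le> crossing ends A e"
        using s[of e] by (auto simp: crossing_def)
    qed
    also have "\<dots> \<le> cutsize P ends A"
      unfolding cutsize_eq_sum[OF finT(4)] using Q finT by (intro sum_mono2) (auto simp: crossing_def)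
    finally show ?thesis using balA[OF A] t(2) by (auto split: if_splits)
  qed
  \<comment> \<open>Summed over \<open>V\<close>, negative edges count twice and positive ones
    cancel, so twice the sum is \<open>1 - c\<close>, that is 0 or 2. A surplus is therefore always
    one sink.\<close>
  moreover have "(\<Sum>e\<in>N. s e) = 0 \<or> (\<Sum>e\<in>N. s e) = 1"
  proof -
    have "graph V Q ends" using gP Q by (auto simp: graph_def)
    then have "(\<Sum>v\<in>V. \<Sum>e\<in>N. s e * inc ends e v) = 1 - c"
      using balA[of V] x(1) sum_net_V by simp
    moreover have "(\<Sum>v\<in>V. \<Sum>e\<in>N. s e * inc ends e v) = (\<Sum>e\<in>N. s e * 2)"
    proof -
      have "(\<Sum>v\<in>V. inc ends e v) = 2" if "e \<in> N" for e
        using sum_inc[OF fin(2), of ends e] g that NP by (auto simp: graph_def)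
      then show ?thesis by (subst sum.swap) (simp add: sum_distrib_left[symmetric])
    qed
    ultimately show ?thesis using t(2) by (auto simp: sum_distrib_right[symmetric])
  qed
  ultimately show ?thesis using s by (intro exI[of _ s]) auto
qed

lemma positive_connected_flow:
  fixes k :: nat
  assumes g: "graph V E ends" "V \<noteq> {}" and \<sigma>: "signature E \<sigma>" and k: "1 \<le> k"
  defines "N \<equiv> negative_edges E \<sigma>" and "P \<equiv> E - negative_edges E \<sigma>"
  assumes con: "\<And>A. A \<subseteq> V \<Longrightarrow> A \<noteq> {} \<Longrightarrow> A \<noteq> V \<Longrightarrow> 6 * int k \<le> cutsize P ends A"
    and N: "even (card N) \<or> 2 * k + 1 \<le> card N"
  shows "admits_pq_flow (2 * int k + 1) (int k) V E ends \<sigma>"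
proof -
  let ?m = "2 * int k + 1"
  have fin: "finite E" "finite V" using g by (auto simp: graph_def)
  have NP: "N \<subseteq> E" "P \<subseteq> E" "N \<inter> P = {}" "E = N \<union> P" by (auto simp: N_def P_def negative_edges_def)
  have finNP: "finite N" "finite P" using NP fin by (meson finite_subset)+
  have gP: "graph V P ends" using g NP by (auto simp: graph_def intro: finite_subset)
  have \<sigma>N: "\<sigma> e = -1" if "e \<in> N" for e using that by (simp add: N_def negative_edges_def)
  have \<sigma>P: "\<sigma> e = 1" if "e \<in> P" for e using that \<sigma> by (auto simp: P_def negative_edges_def signature_def)
  have "\<exists>s. (\<forall>e\<in>N. s e = 1 \<or> s e = (-1 :: int)) \<and> ((\<Sum>e\<in>N. s e) = 0 \<or> (\<Sum>e\<in>N. s e) = 1) \<and>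
    (\<forall>A\<subseteq>V. (\<Sum>v\<in>A. \<Sum>e\<in>N. s e * inc ends e v) \<le> cutsize P ends A + 2)"
    unfolding N_def P_def
  proof (rule negative_orientation[OF g \<sigma>])
    fix A assume "A \<subseteq> V" "A \<noteq> {}" "A \<noteq> V"
    from con[OF this] show "4 \<le> cutsize (E - negative_edges E \<sigma>) ends A"
      using k unfolding P_def by linarith
  qed
  then obtain s where ss: "(\<forall>e\<in>N. s e = 1 \<or> s e = (-1 :: int)) \<and> ((\<Sum>e\<in>N. s e) = 0 \<or> (\<Sum>e\<in>N. s e) = 1) \<and>
    (\<forall>A\<subseteq>V. (\<Sum>v\<in>A. \<Sum>e\<in>N. s e * inc ends e v) \<le> cutsize P ends A + 2)" by iprover
  have s: "e \<in> N \<Longrightarrow> s e = 1 \<or> s e = -1" "(\<Sum>e\<in>N. s e) = 0 \<or> (\<Sum>e\<in>N. s e) = 1"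
    "A \<subseteq> V \<Longrightarrow> (\<Sum>v\<in>A. \<Sum>e\<in>N. s e * inc ends e v) \<le> cutsize P ends A + 2" for e A
    using ss by simp_all
  \<comment> \<open>\<open>K\<close> holds the sources that get the value k + 1. One surplus sink of
    value k is compensated by k raised sources. There are \<open>(card N - 1) div 2\<close> sources
    in this case, enough if \<open>2 * k + 1 \<le> card N\<close>.\<close>
  obtain K where K: "K \<subseteq> {e \<in> N. s e = -1}" "int (card K) = int k * (\<Sum>e\<in>N. s e)"
  proof (cases "(\<Sum>e\<in>N. s e) = 0")
    case True
    then show ?thesis by (intro that[of "{}"]) auto
  next
    case False
    then have s1: "(\<Sum>e\<in>N. s e) = 1" using s(2) by blast
    let ?M = "{e \<in> N. s e = -1}"
    have "(\<Sum>e\<in>N. s e) = (\<Sum>e\<in>N. 1 - 2 * of_bool (s e = -1))"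
      using s(1) by (intro sum.cong) force+
    also have "\<dots> = int (card N) - 2 * int (card ?M)"
      using finNP by (simp add: sum_subtractf sum_distrib_left[symmetric] of_bool_def sum.If_cases Int_def)
    finally have eq: "int (card N) = 2 * int (card ?M) + 1" using s1 by linarith
    then have "odd (card N)" by presburger
    then have "k \<le> card ?M" using N eq by linarith
    then obtain K where "K \<subseteq> ?M" "card K = k" by (meson obtain_subset_with_card_n)
    then show ?thesis using s1 by (intro that[of K]) auto
  qed
  define \<phi> where "\<phi> e = int k + of_bool (e \<in> K)" for e
  define b where "b v = (\<Sum>e\<in>N. s e * \<phi> e * inc ends e v)" for v
  have KN: "K \<subseteq> N" using K by auto
  have sumK: "(\<Sum>e\<in>N. s e * of_bool (e \<in> K)) = - int (card K)"
  proof -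
    have "(\<Sum>e\<in>N. s e * of_bool (e \<in> K)) = (\<Sum>e\<in>K. -1)"
      using K(1) KN finNP by (intro sum.mono_neutral_cong_right) auto
    then show ?thesis by simp
  qed
  have b0: "(\<Sum>v\<in>V. b v) = 0"
  proof -
    have "(\<Sum>v\<in>V. inc ends e v) = 2" if "e \<in> N" for e
      using sum_inc[OF fin(2), of ends e] g that NP by (auto simp: graph_def)
    then have "(\<Sum>v\<in>V. b v) = (\<Sum>e\<in>N. s e * \<phi> e * 2)"
      unfolding b_def by (subst sum.swap) (simp add: sum_distrib_left[symmetric])
    also have "\<dots> = 2 * (int k * (\<Sum>e\<in>N. s e) + (\<Sum>e\<in>N. s e * of_bool (e \<in> K)))"
      by (simp add: \<phi>_def sum_distrib_left sum.distrib[symmetric] algebra_simps del: sum_mult_of_bool_eq sum_of_bool_mult_eq)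
    finally show ?thesis using sumK K(2) by simp
  qed
  \<comment> \<open>Raising a source only lowers \<open>b\<close>, so the bound for equal values k
    carries over.\<close>
  have b_le: "(\<Sum>v\<in>A. b v) \<le> int k * cutsize P ends A + 2 * int k" if A: "A \<subseteq> V" for A
  proof -
    have "(\<Sum>v\<in>A. b v) \<le> (\<Sum>v\<in>A. int k * (\<Sum>e\<in>N. s e * inc ends e v))"
    proof (rule sum_mono)
      fix v
      show "b v \<le> int k * (\<Sum>e\<in>N. s e * inc ends e v)"
        unfolding b_def sum_distrib_left
      proof (rule sum_mono)
        fix e assume "e \<in> N"
        show "s e * \<phi> e * inc ends e v \<le> int k * (s e * inc ends e v)"
          using K(1) by (auto simp: \<phi>_def inc_def)
      qed
    qed
    also have "\<dots> \<le> int k * (cutsize P ends A + 2)"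
      unfolding sum_distrib_left[symmetric] using s(3)[OF A] by (intro mult_left_mono) auto
    finally show ?thesis by (simp add: algebra_simps)
  qed
  \<comment> \<open>Congruent to \<open>2 * b v\<close> modulo 2k + 1 and to the degree modulo 2.
    The factor 2 is the inverse of -k, so that k times the boundary cancels
    \<open>b\<close>.\<close>
  define h where "h v = 2 * b v + ?m * (deg P ends v mod 2)" for v
  have "even (\<Sum>v\<in>V. deg P ends v)"
  proof -
    have "(\<Sum>v\<in>V. deg P ends v) = (\<Sum>e\<in>P. 2)"
      unfolding sum_deg[OF fin(2)] using gP by (intro sum.cong) (auto simp: graph_def)
    then show ?thesis by simp
  qed
  moreover have "even (\<Sum>v\<in>V. deg P ends v - deg P ends v mod 2)"
    by (intro dvd_sum) (simp add: minus_mod_eq_mult_div)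
  ultimately have ev: "even (\<Sum>v\<in>V. deg P ends v mod 2)" by (simp add: sum_subtractf)
  \<comment> \<open>The sum is 2k + 1 times the number of vertices of odd degree, which is
    even.\<close>
  have "sum h V = ?m * (\<Sum>v\<in>V. deg P ends v mod 2)"
    unfolding h_def sum.distrib sum_distrib_left[symmetric] b0 by simp
  then have h1: "2 * ?m dvd sum h V"
    using mult_dvd_mono[OF ev dvd_refl[of ?m]] by (simp only: mult.commute[of ?m])
  have h2: "\<forall>v\<in>V. even (h v - deg P ends v)"
  proof
    fix v
    show "even (h v - deg P ends v)"
      by (cases "even (deg P ends v)") (simp_all add: h_def odd_iff_mod_2_eq_one even_iff_mod_2_eq_zero[symmetric])
  qed
  have "solvable ?m V P ends h"
    by (rule modulo_orientation[OF gP g(2) _ con h1 h2]) (use k in simp_all)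
  then obtain r where r: "\<forall>e\<in>P. r e = 1 \<or> r e = -1" "\<And>v. v \<in> V \<Longrightarrow> 2 * ?m dvd net P ends r v - h v"
    by (auto simp: solvable_def)
  have "\<forall>v\<in>V. ?m dvd int k * net P ends r v + b v"
  proof
    fix v assume v: "v \<in> V"
    have "?m dvd net P ends r v - h v" using r(2)[OF v] by (rule dvd_mult_right)
    then obtain j where j: "net P ends r v - h v = ?m * j" ..
    have "int k * net P ends r v + b v = ?m * (int k * j + int k * (deg P ends v mod 2) + b v)"
      using j by (simp add: h_def algebra_simps)
    then show "?m dvd int k * net P ends r v + b v" by simp
  qed
  from exact_flow[OF gP _ r(1) this b0 b_le] k
  obtain f where f: "\<And>e. e \<in> P \<Longrightarrow> \<bar>f e\<bar> = int k \<or> \<bar>f e\<bar> = int k + 1" "\<And>v. v \<in> V \<Longrightarrow> net P ends f v + b v = 0"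
    by auto
  \<comment> \<open>A negative value of \<open>f\<close> reverses the positive edge and leaves its
    absolute value as flow.\<close>
  define \<tau> where "\<tau> e i = (if e \<in> N then s e else if i then sgn (f e) else - sgn (f e))" for e i
  define F where "F e = (if e \<in> N then \<phi> e else \<bar>f e\<bar>)" for e
  have f0: "f e \<noteq> 0" if "e \<in> P" for e using f(1)[OF that] k by auto
  have "orientation E \<sigma> \<tau>"
    unfolding orientation_def
  proof
    fix e assume "e \<in> E"
    show "(\<tau> e True = 1 \<or> \<tau> e True = -1) \<and> (\<tau> e False = 1 \<or> \<tau> e False = -1) \<and> \<tau> e True * \<tau> e False = - \<sigma> e"
    proof (cases "e \<in> N")
      case True
      then show ?thesis using s(1)[OF True] \<sigma>N[OF True] by (auto simp: \<tau>_def)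
    next
      case False
      then have "e \<in> P" using \<open>e \<in> E\<close> NP by blast
      then show ?thesis using False f0 \<sigma>P by (auto simp: \<tau>_def sgn_if)
    qed
  qed
  moreover have "net_flow E ends \<tau> F v = 0" if "v \<in> V" for v
  proof -
    have "net_flow E ends \<tau> F v =
      (\<Sum>e\<in>N. (if end_of ends e True = v then \<tau> e True * F e else 0) + (if end_of ends e False = v then \<tau> e False * F e else 0)) +
      (\<Sum>e\<in>P. (if end_of ends e True = v then \<tau> e True * F e else 0) + (if end_of ends e False = v then \<tau> e False * F e else 0))"
      unfolding net_flow_def using finNP NP by (metis (no_types, lifting) sum.union_disjoint)
    also have "\<dots> = b v + net P ends f v"
      unfolding net_def b_def
    proof (intro arg_cong2[where f="(+)"] sum.cong refl)
      fix e assume "e \<in> N"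
      then show "(if end_of ends e True = v then \<tau> e True * F e else 0) + (if end_of ends e False = v then \<tau> e False * F e else 0)
          = s e * \<phi> e * inc ends e v" by (auto simp: \<tau>_def F_def end_of_def inc_def)
    next
      fix e assume "e \<in> P"
      then have "e \<notin> N" using NP by blast
      then show "(if end_of ends e True = v then \<tau> e True * F e else 0) + (if end_of ends e False = v then \<tau> e False * F e else 0)
          = f e * dinc ends e v" by (auto simp: \<tau>_def F_def end_of_def dinc_def sgn_mult_abs)
    qed
    finally show ?thesis using f(2)[OF that] by simp
  qed
  moreover have "int k \<le> F e \<and> F e \<le> ?m - int k" if "e \<in> E" for e
    using f(1)[of e] that NP by (auto simp: F_def \<phi>_def)
  ultimately show ?thesis unfolding admits_pq_flow_def pq_flow_def integer_flow_def by blast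
qed

theorem theorem6:
  fixes V :: "'v set" and E :: "'e set" and ends :: "'e \<Rightarrow> 'v \<times> 'v"
    and \<sigma> :: "'e \<Rightarrow> int" and k :: nat
  assumes "graph V E ends"
    and "signature E \<sigma>"
    and "k \<ge> 1"
    and "edge_connected (12 * k - 1) V E ends"
    and "essentially_unbalanced (2 * k + 1) V E ends \<sigma>"
  shows "admits_pq_flow (2 * int k + 1) (int k) V E ends \<sigma>"
proof (cases "V = {}")
  case True
  then have "E = {}" using assms(1) by (auto simp: graph_def)
  then show ?thesis using True
    by (auto simp: admits_pq_flow_def pq_flow_def integer_flow_def orientation_def)
next
  case False
  note g = assms(1)
  have fin: "finite E" "finite V" using g by (auto simp: graph_def)
  obtain X where X: "X \<subseteq> V" "\<And>A. A \<subseteq> V \<Longrightarrow> card (edge_cut (negative_edges E (switch_set ends X \<sigma>)) ends A)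
      \<le> card (edge_cut (E - negative_edges E (switch_set ends X \<sigma>)) ends A)"
    using minimal_switch[OF g assms(2)] by blast
  let ?s = "switch_set ends X \<sigma>"
  let ?N = "negative_edges E ?s"
  have "admits_pq_flow (2 * int k + 1) (int k) V E ends ?s"
  proof (rule positive_connected_flow[OF g False signature_switch_set[OF assms(2)] assms(3)])
    fix A assume A: "A \<subseteq> V" "A \<noteq> {}" "A \<noteq> V"
    have "edge_cut E ends A = edge_cut ?N ends A \<union> edge_cut (E - ?N) ends A"
      by (auto simp: edge_cut_def negative_edges_def)
    then have "card (edge_cut E ends A) \<le> card (edge_cut ?N ends A) + card (edge_cut (E - ?N) ends A)"
      by (simp add: card_Un_le)
    moreover have "12 * k - 1 \<le> card (edge_cut E ends A)"
      using assms(4) A by (auto simp: edge_connected_def)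
    \<comment> \<open>Half of the odd number 12k - 1 rounds up to 6k.\<close>
    ultimately have "6 * k \<le> card (edge_cut (E - ?N) ends A)" using X(2)[OF A(1)] by linarith
    then show "6 * int k \<le> cutsize (E - ?N) ends A" by (simp add: cutsize_def)
  next
    have "equivalent_sig V ends \<sigma> ?s"
      by (rule equivalent_switch_set[OF finite_subset[OF X(1) fin(2)] X(1)])
    then show "even (card ?N) \<or> 2 * k + 1 \<le> card ?N"
      using assms(5) by (simp add: essentially_unbalanced_def)
  qed
  then show ?thesis by (rule admits_switch_set)
qed

end
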